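(* Fix $p\ge1$. Let $\mu$ be a Borel measure on $\mathbb R^n$ with continuous density on $\mathbb R^n\setminus\{0\}$ that is $L^p$ $F$-concave over a class $\mathcal C\subset\mathcal K^n_o$, where $F$ is differentiable. Suppose $K,L\in\mathcal C$ are such that $\mu(K)=\mu(L)$, $S^\mu_{K,p}$ and $S^\mu_{L,p}$ are finite Borel measures on $\mathbb S^{n-1}$, and $S^\mu_{K,p}=S^\mu_{L,p}$. Then there is equality in the $L^p$ $F$-concavity inequality for $K$ and $L$, i.e. $$\mu\big((1-\lambda)\cdot K+_p\lambda\cdot L\big)=F^{-1}\big((1-\lambda)F(\mu(K))+\lambda F(\mu(L))\big)\quad\text{for }\lambda\in(0,1).$$
   Context: $\mathcal K^n_o$ is the set of convex bodies (compact convex sets with non-empty interior) in $\mathbb R^n$ containing the origin in their interior; $h_K(u)=\sup_{y\in K}\langle u,y\rangle$. For $K,L\in\mathcal K_o^n$, $p\ge 1$ and $\alpha,\beta\ge0$ (not both zero), the $L^p$ sum $\alpha\cdot K+_p\beta\cdot L$ is the convex body with support function $(\alpha h_K^p+\beta h_L^p)^{1/p}$ (for $p=1$: Minkowski addition). Let $F$ be an invertible, strictly monotonic, continuous function and $\mathcal C$ a collection of sets with finite $\mu$-measure. $\mu$ is $L^p$ $F$-concave over $\mathcal C$ if for all $K,L\in\mathcal C$ and $\lambda\in(0,1)$, $$\mu\big((1-\lambda)\cdot K+_p\lambda\cdot L\big)\ge F^{-1}\big((1-\lambda)F(\mu(K))+\lambda F(\mu(L))\big).$$ For $K\in\mathcal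 K_o^n$ with Gauss map $n_K$ and $\mu$ with density $\phi$, $S^\mu_{K,p}(E)=\int_{n_K^{-1}(E)}\langle y,n_K(y)\rangle^{1-p}\phi(y)\,d\mathcal H^{n-1}(y)$ for Borel $E\subset\mathbb S^{n-1}$.
   Formalization: The class C is additionally assumed to contain the L^p combinations (1-λ)·K +_p λ·L of the given K and L for λ in (0,1); without this the statement fails, e.g. for C = {K, L} with K = [-1,2], L = [-2,1] and a suitable even density. *)

theory Defs
  imports "HOL-Analysis.Analysis"
begin

section \<open>Convex bodies and $L^p$ sums\<close>

definition convex_body :: "'a::euclidean_space set \<Rightarrow> bool" where
  "convex_body K \<longleftrightarrow> convex K \<and> compact K \<and> interior K \<noteq> {}"

definition convex_bodies_o :: "'a::euclidean_space set set" where
  "convex_bodies_o = {K. convex_body K \<and> 0 \<in> interior K}"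

definition support_fun :: "'a::euclidean_space set \<Rightarrow> 'a \<Rightarrow> real" where
  "support_fun K u = (SUP y\<in>K. u \<bullet> y)"

text \<open>\<open>lp_sum p \<alpha> K \<beta> L\<close> is $\alpha\cdot K+_p\beta\cdot L$. The description is proper for
  \<open>p \<ge> 1\<close>, \<open>K, L \<in> convex_bodies_o\<close> and \<open>\<alpha>, \<beta> \<ge> 0\<close> not both zero: the right-hand side is
  then sublinear and positive off the origin, and a compact convex set is determined by its
  support function. At \<open>u = 0\<close> both sides are 0, because \<open>0 powr x = 0\<close>.\<close>

definition lp_sum :: "real \<Rightarrow> real \<Rightarrow> 'a::euclidean_space set \<Rightarrow> real \<Rightarrow> 'a set \<Rightarrow> 'a set" where
  "lp_sum p \<alpha> K \<beta> L = (THE M. convex_body M \<and>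
     (\<forall>u. support_fun M u =
        (\<alpha> * support_fun K u powr p + \<beta> * support_fun L u powr p) powr (1 / p)))"


section \<open>$L^p$ $F$-concavity\<close>

text \<open>\<open>I\<close> is the domain of \<open>F\<close>; it has to contain the values of \<open>\<mu>\<close> on \<open>C\<close> but need not be
  all of the half-line (\<open>ln\<close> is a typical \<open>F\<close>, with \<open>I = {0<..}\<close>). The inverse of \<open>F\<close> is taken
  on its range \<open>F ` I\<close>, which is again an interval, so \<open>inv_into\<close> is only applied to points of
  this range.\<close>

definition lp_F_concave_over ::
  "real \<Rightarrow> real set \<Rightarrow> (real \<Rightarrow> real) \<Rightarrow> 'a::euclidean_space measure \<Rightarrow> 'a set set \<Rightarrow> bool" where
  "lp_F_concave_over p I F \<mu> C \<longleftrightarrow>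
     is_interval I \<and> continuous_on I F \<and> (strict_mono_on I F \<or> strict_antimono_on I F) \<and>
     (\<forall>K\<in>C. emeasure \<mu> K < \<infinity> \<and> measure \<mu> K \<in> I) \<and>
     (\<forall>K\<in>C. \<forall>L\<in>C. \<forall>t\<in>{0<..<1}.
        emeasure \<mu> (lp_sum p (1 - t) K t L)
          \<ge> ennreal (inv_into I F ((1 - t) * F (measure \<mu> K) + t * F (measure \<mu> L))))"


section \<open>Hausdorff measure\<close>

text \<open>\<open>unit_ball_vol s / 2 ^ s\<close> is the usual normalization, making the \<open>s\<close>-dimensional Hausdorff
  measure agree with Lebesgue measure on \<open>s\<close>-dimensional subspaces. Nonempty sets of diameter 0
  contribute 1 for \<open>s = 0\<close> (where \<open>0 ^ 0 = 1\<close>), so the 0-dimensional measure is counting measure.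
  The boundedness condition is needed since \<open>diameter\<close> has no meaning on unbounded sets.\<close>

definition hausdorff_premeasure :: "nat \<Rightarrow> real \<Rightarrow> 'a::metric_space set \<Rightarrow> ennreal" where
  "hausdorff_premeasure s \<delta> A =
     (INF U \<in> {U :: nat \<Rightarrow> 'a set. A \<subseteq> (\<Union>i. U i) \<and> (\<forall>i. bounded (U i) \<and> diameter (U i) \<le> \<delta>)}.
        \<Sum>i. if U i = {} then 0 else ennreal (unit_ball_vol (real s) * (diameter (U i) / 2) ^ s))"

definition hausdorff_outer :: "nat \<Rightarrow> 'a::metric_space set \<Rightarrow> ennreal" where
  "hausdorff_outer s A = (SUP \<delta>\<in>{0<..}. hausdorff_premeasure s \<delta> A)"

text \<open>The outer measure is a metric outer measure, hence countably additive on the Borel sets.\<close>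

definition hausdorff_measure :: "nat \<Rightarrow> 'a::metric_space measure" where
  "hausdorff_measure s = measure_of UNIV (sets borel) (hausdorff_outer s)"


section \<open>Gauss map and weighted $L^p$ surface area measure\<close>

definition outer_unit_normal :: "'a::euclidean_space set \<Rightarrow> 'a \<Rightarrow> 'a \<Rightarrow> bool" where
  "outer_unit_normal K y u \<longleftrightarrow> norm u = 1 \<and> (\<forall>x\<in>K. u \<bullet> x \<le> u \<bullet> y)"

text \<open>The Gauss map is defined at those boundary points that have exactly one outer unit normal
  (almost all of them).\<close>

definition gauss_domain :: "'a::euclidean_space set \<Rightarrow> 'a set" where
  "gauss_domain K = {y \<in> frontier K. \<exists>!u. outer_unit_normal K y u}"

definition gauss_map :: "'a::euclidean_space set \<Rightarrow> 'a \<Rightarrow> 'a" where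
  "gauss_map K y = (THE u. outer_unit_normal K y u)"

text \<open>\<open>\<phi>\<close> is the density of \<open>\<mu>\<close>; only its values on the boundary of \<open>K\<close> matter, which does not
  contain the origin for \<open>K \<in> convex_bodies_o\<close>.\<close>

definition lp_surface_measure ::
  "real \<Rightarrow> ('a::euclidean_space \<Rightarrow> real) \<Rightarrow> 'a set \<Rightarrow> 'a measure" where
  "lp_surface_measure p \<phi> K =
     measure_of (sphere 0 1) (sets (restrict_space borel (sphere 0 1)))
       (\<lambda>E. \<integral>\<^sup>+ y \<in> {y \<in> gauss_domain K. gauss_map K y \<in> E}.
              ennreal ((y \<bullet> gauss_map K y) powr (1 - p) * \<phi> y)
            \<partial>hausdorff_measure (DIM('a) - 1))"

end

theory Submission
  imports Defs
begin

text \<open>Write $K_t = (1-t)\cdot K +_p t\cdot L$ and $m = \mu(K) = \mu(L)$. Concavity gives $\mu(K_t) \ge m$, and equality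
  follows once the right derivative of $\mu(K_t)$ at one of the two endpoints is known to be nonpositive.
  At \<open>K\<close> this derivative is at most $\frac1p\int (h_L^p - h_K^p)\,dS^\mu_{K,p}$ and at \<open>L\<close> (with the roles exchanged)
  at most $\frac1p\int (h_K^p - h_L^p)\,dS^\mu_{L,p}$; since the two measures agree, one of these is nonpositive.

  Only upper bounds are needed, and they are elementary: over a boundary point \<open>y\<close> of \<open>K\<close> with unique normal \<open>u\<close>,
  the radial extent of $K_t$ relative to \<open>K\<close> is at most $h_{K_t}(u)/h_K(u)$. What remains is to express the surface area
  measure through cone volumes. Locally the boundary is almost isometric to a hyperplane, where Hausdorff measure
  and the volume of the cone over a set are proportional by uniqueness of translation invariant measures.
  The factor of proportionality plays no role, so the isodiametric inequality is not used.\<close>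

subsection \<open>Hausdorff measure\<close>

text \<open>A nonpositive derivative at an endpoint suffices because of a self-similarity: p-th
  powers of support functions combine linearly, so K_{rt} is the L^p combination of K and K_t with
  weights 1-r and r. A strict gain of F(\<mu>) at K_t would therefore persist at K_{rt} with at
  least the fraction r of its size. Differentiability of F at m turns this into growth of \<mu> at
  least linear in r, against the upper bound m + o(r). A decreasing F is handled through its
  negative. The density may blow up at the origin, so it is replaced by its boundary values along
  rays only inside a shell around the boundary. The shell has volume O(t) and contains the symmetric
  difference of K and a radial set that encloses K_t up to a null set. Measures are identified by
  comparison: two measures agree up to a factor \<theta> on the pieces of a countable cover, and
  \<theta> tends to 1. This gives both the Hausdorff form of the cone measure and the volume of
  radial perturbations.\<close>

definition hausdorff_cost :: "nat \<Rightarrow> 'a::metric_space set \<Rightarrow> ennreal" where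
  "hausdorff_cost s U =
     (if U = {} then 0 else ennreal (unit_ball_vol (real s) * (diameter U / 2) ^ s))"

definition delta_cover :: "real \<Rightarrow> 'a::metric_space set \<Rightarrow> (nat \<Rightarrow> 'a set) \<Rightarrow> bool" where
  "delta_cover \<delta> A U \<longleftrightarrow> A \<subseteq> (\<Union>i. U i) \<and> (\<forall>i. bounded (U i) \<and> diameter (U i) \<le> \<delta>)"

lemma hausdorff_premeasure_eq:
  "hausdorff_premeasure s \<delta> A = (INF U\<in>{U. delta_cover \<delta> A U}. \<Sum>i. hausdorff_cost s (U i))"
  by (simp add: hausdorff_premeasure_def delta_cover_def hausdorff_cost_def)

lemma hausdorff_premeasure_le:
  assumes "delta_cover \<delta> A U"
  shows "hausdorff_premeasure s \<delta> A \<le> (\<Sum>i. hausdorff_cost s (U i))"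
  unfolding hausdorff_premeasure_eq by (rule INF_lower) (simp add: assms)

lemma hausdorff_premeasure_greatest:
  assumes "\<And>U. delta_cover \<delta> A U \<Longrightarrow> c \<le> (\<Sum>i. hausdorff_cost s (U i))"
  shows "c \<le> hausdorff_premeasure s \<delta> A"
  unfolding hausdorff_premeasure_eq by (rule INF_greatest) (simp add: assms)

lemma hausdorff_premeasure_approx:
  assumes "hausdorff_premeasure s \<delta> A < c"
  obtains U where "delta_cover \<delta> A U" "(\<Sum>i. hausdorff_cost s (U i)) < c"
  using assms unfolding hausdorff_premeasure_eq INF_less_iff by auto

lemma hausdorff_cost_empty [simp]: "hausdorff_cost s {} = 0"
  by (simp add: hausdorff_cost_def)

lemma hausdorff_cost_le:
  assumes "bounded U" "diameter U \<le> d"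
  shows "hausdorff_cost s U \<le> ennreal (unit_ball_vol (real s) * (d / 2) ^ s)"
  unfolding hausdorff_cost_def
  using assms diameter_ge_0[of U]
  by (auto intro!: ennreal_leI mult_left_mono power_mono)

lemma hausdorff_cost_mono:
  assumes "V \<subseteq> U" "bounded U"
  shows "hausdorff_cost s V \<le> hausdorff_cost s U"
proof (cases "V = {}")
  case False
  then have "hausdorff_cost s U = ennreal (unit_ball_vol (real s) * (diameter U / 2) ^ s)"
    using assms(1) by (auto simp: hausdorff_cost_def)
  then show ?thesis
    using hausdorff_cost_le[OF bounded_subset[OF assms(2,1)] diameter_subset[OF assms]] by simp
qed simp

lemma delta_cover_mono:
  assumes "delta_cover \<delta> A U" "B \<subseteq> A" "\<delta> \<le> \<delta>'"
  shows "delta_cover \<delta>' B U"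
proof -
  have "B \<subseteq> (\<Union>i. U i)"
    using assms(1,2) by (auto simp: delta_cover_def)
  moreover have "bounded (U i) \<and> diameter (U i) \<le> \<delta>'" for i
    using assms(1,3) order_trans[of "diameter (U i)" \<delta> \<delta>'] by (simp add: delta_cover_def)
  ultimately show ?thesis
    by (simp add: delta_cover_def)
qed

lemma hausdorff_premeasure_mono:
  assumes "B \<subseteq> A" "\<delta> \<le> \<delta>'"
  shows "hausdorff_premeasure s \<delta>' B \<le> hausdorff_premeasure s \<delta> A"
  by (rule hausdorff_premeasure_greatest, rule hausdorff_premeasure_le)
    (rule delta_cover_mono[OF _ assms])

lemma hausdorff_premeasure_le_outer:
  "\<delta> > 0 \<Longrightarrow> hausdorff_premeasure s \<delta> A \<le> hausdorff_outer s A"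
  unfolding hausdorff_outer_def by (rule SUP_upper) simp

lemma hausdorff_outer_least:
  assumes "\<And>\<delta>. \<delta> > 0 \<Longrightarrow> hausdorff_premeasure s \<delta> A \<le> c"
  shows "hausdorff_outer s A \<le> c"
  unfolding hausdorff_outer_def by (rule SUP_least) (simp add: assms)

lemma hausdorff_outer_mono:
  assumes "B \<subseteq> A"
  shows "hausdorff_outer s B \<le> hausdorff_outer s A"
  by (rule hausdorff_outer_least, rule order_trans[OF hausdorff_premeasure_mono[OF assms order_refl]])
    (rule hausdorff_premeasure_le_outer)

lemma hausdorff_outer_empty [simp]: "hausdorff_outer s {} = 0"
proof -
  have "hausdorff_premeasure s \<delta> {} \<le> 0" if "\<delta> > 0" for \<delta> :: real
    using hausdorff_premeasure_le[of \<delta> "{}" "\<lambda>_. {}" s] that by (simp add: delta_cover_def)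
  then have "hausdorff_outer s {} \<le> 0"
    by (intro hausdorff_outer_least)
  then show ?thesis by simp
qed

text \<open>Covers of the \<open>A j\<close> that are optimal up to \<open>e * (1/2) ^ Suc j\<close>
  are merged into one sequence through \<open>prod_decode\<close>. An infinite right-hand side is
  split off because a near-optimal cover needs a finite infimum.\<close>

lemma hausdorff_premeasure_countable_subadditive:
  "hausdorff_premeasure s \<delta> (\<Union>j. A j) \<le> (\<Sum>j. hausdorff_premeasure s \<delta> (A j))"
proof (cases "(\<Sum>j. hausdorff_premeasure s \<delta> (A j)) = top")
  case False
  show ?thesis
  proof (rule ennreal_le_epsilon)
    fix e :: real
    assume "0 < e"
    have fin: "hausdorff_premeasure s \<delta> (A j) \<noteq> top" for j
      using ennreal_suminf_lessD[of "\<lambda>j. hausdorff_premeasure s \<delta> (A j)" top j] False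
      by (auto simp: less_top)
    have "\<exists>U. delta_cover \<delta> (A j) U \<and> (\<Sum>i. hausdorff_cost s (U i))
           \<le> hausdorff_premeasure s \<delta> (A j) + ennreal (e * (1/2) ^ Suc j)" for j
    proof -
      have "hausdorff_premeasure s \<delta> (A j)
          < hausdorff_premeasure s \<delta> (A j) + ennreal (e * (1/2) ^ Suc j)"
        using fin[of j] \<open>0 < e\<close>
          ennreal_add_left_cancel_less[of "hausdorff_premeasure s \<delta> (A j)" 0 "ennreal (e * (1/2) ^ Suc j)"]
        by (simp add: less_top)
      then obtain W where "delta_cover \<delta> (A j) W" "(\<Sum>i. hausdorff_cost s (W i))
          < hausdorff_premeasure s \<delta> (A j) + ennreal (e * (1/2) ^ Suc j)"
        by (rule hausdorff_premeasure_approx)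
      then show ?thesis by (auto intro: less_imp_le)
    qed
    then obtain U where U: "\<And>j. delta_cover \<delta> (A j) (U j)"
      "\<And>j. (\<Sum>i. hausdorff_cost s (U j i))
           \<le> hausdorff_premeasure s \<delta> (A j) + ennreal (e * (1/2) ^ Suc j)"
      by metis
    define V where "V k = (case prod_decode k of (j, i) \<Rightarrow> U j i)" for k
    have V: "delta_cover \<delta> (\<Union>j. A j) V"
      unfolding delta_cover_def
    proof (intro conjI allI subsetI)
      fix x assume "x \<in> (\<Union>j. A j)"
      then obtain j i where "x \<in> U j i"
        using U(1) unfolding delta_cover_def by blast
      then have "x \<in> V (prod_encode (j, i))"
        by (simp add: V_def)
      then show "x \<in> (\<Union>k. V k)" by blast
    qed (use U(1) in \<open>auto simp: V_def delta_cover_def split: prod.split\<close>)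
    have "(\<Sum>k. hausdorff_cost s (V k)) = (\<Sum>j. \<Sum>i. hausdorff_cost s (U j i))"
    proof -
      have "(\<Sum>k. (\<lambda>(j,i). hausdorff_cost s (U j i)) (prod_decode k))
          = (\<Sum>j. \<Sum>i. hausdorff_cost s (U j i))"
        using suminf_ennreal_2dimen[of "\<lambda>j. \<Sum>i. hausdorff_cost s (U j i)"
            "\<lambda>(j,i). hausdorff_cost s (U j i)"] by (simp add: o_def)
      moreover have "hausdorff_cost s (V k) = (\<lambda>(j,i). hausdorff_cost s (U j i)) (prod_decode k)" for k
        by (simp add: V_def split: prod.split)
      ultimately show ?thesis by simp
    qed
    also have "\<dots> \<le> (\<Sum>j. hausdorff_premeasure s \<delta> (A j) + ennreal (e * (1/2) ^ Suc j))"
      by (intro suminf_le U(2)) auto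
    also have "\<dots> = (\<Sum>j. hausdorff_premeasure s \<delta> (A j)) + (\<Sum>j. ennreal (e * (1/2) ^ Suc j))"
      by (intro suminf_add[symmetric]) auto
    also have "(\<Sum>j. ennreal (e * (1/2) ^ Suc j)) = ennreal e"
      using \<open>0 < e\<close> sums_mult[OF power_half_series, of e]
      by (intro suminf_ennreal_eq) auto
    finally show "hausdorff_premeasure s \<delta> (\<Union>j. A j)
        \<le> (\<Sum>j. hausdorff_premeasure s \<delta> (A j)) + ennreal e"
      using hausdorff_premeasure_le[OF V, of s] by (meson order_trans)
  qed
qed simp

lemma hausdorff_outer_countable_subadditive:
  "hausdorff_outer s (\<Union>j. A j) \<le> (\<Sum>j. hausdorff_outer s (A j))"
proof (rule hausdorff_outer_least)
  fix \<delta> :: real assume "\<delta> > 0"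
  then show "hausdorff_premeasure s \<delta> (\<Union>j. A j) \<le> (\<Sum>j. hausdorff_outer s (A j))"
    by (intro order_trans[OF hausdorff_premeasure_countable_subadditive] suminf_le
        hausdorff_premeasure_le_outer) auto
qed

lemma outer_measure_space_hausdorff: "outer_measure_space UNIV (hausdorff_outer s)"
  using hausdorff_outer_countable_subadditive hausdorff_outer_mono
  by (auto simp: outer_measure_space_def positive_def increasing_def countably_subadditive_def)

lemma hausdorff_outer_Un_le: "hausdorff_outer s (A \<union> B) \<le> hausdorff_outer s A + hausdorff_outer s B"
proof -
  have "subadditive UNIV (hausdorff_outer s)"
    using outer_measure_space_hausdorff[of s]
    by (intro ring_of_sets.countably_subadditive_subadditive[of UNIV])
      (auto simp: outer_measure_space_def intro: algebra.axioms(1) sigma_algebra.axioms(1)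
        sigma_algebra_Pow[of UNIV, simplified])
  then have "hausdorff_outer s (A \<union> (B - A)) \<le> hausdorff_outer s A + hausdorff_outer s (B - A)"
    unfolding subadditive_def by blast
  moreover have "hausdorff_outer s (B - A) \<le> hausdorff_outer s B"
    by (rule hausdorff_outer_mono) blast
  ultimately show ?thesis
    using add_left_mono[of "hausdorff_outer s (B - A)" "hausdorff_outer s B" "hausdorff_outer s A"]
    by (simp add: order_trans)
qed

text \<open>A set of diameter at most \<open>\<delta>\<close> cannot meet both \<open>A\<close> and
  \<open>B\<close>, so every cover splits into its traces on \<open>A\<close> and on
  \<open>B\<close>, and at most one of the two traces of each member costs anything.\<close>

lemma hausdorff_premeasure_separated:
  assumes "\<And>x y. x \<in> A \<Longrightarrow> y \<in> B \<Longrightarrow> dist x y > \<delta>"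
  shows "hausdorff_premeasure s \<delta> A + hausdorff_premeasure s \<delta> B
          \<le> hausdorff_premeasure s \<delta> (A \<union> B)"
proof (rule hausdorff_premeasure_greatest)
  fix U assume U: "delta_cover \<delta> (A \<union> B) U"
  have bd: "bounded (U i)" and diam: "diameter (U i) \<le> \<delta>" for i
    using U by (auto simp: delta_cover_def)
  have cov: "delta_cover \<delta> X (\<lambda>i. U i \<inter> X)" if "X \<subseteq> A \<union> B" for X
  proof -
    have "diameter (U i \<inter> X) \<le> \<delta>" for i
      using diameter_subset[OF Int_lower1 bd, of i X] diam[of i] by linarith
    moreover have "bounded (U i \<inter> X)" for i
      using bd[of i] by (meson Int_lower1 bounded_subset)
    ultimately show ?thesis
      using U that unfolding delta_cover_def by blast
  qed
  have "hausdorff_cost s (U i \<inter> A) + hausdorff_cost s (U i \<inter> B) \<le> hausdorff_cost s (U i)" for i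
  proof -
    have "U i \<inter> A = {} \<or> U i \<inter> B = {}"
    proof (rule ccontr)
      assume "\<not> ?thesis"
      then obtain x y where "x \<in> U i" "x \<in> A" "y \<in> U i" "y \<in> B" by blast
      then show False
        using assms[of x y] diameter_bounded_bound[OF bd, of x i y] diam[of i] by simp
    qed
    then show ?thesis
      using hausdorff_cost_mono[OF Int_lower1 bd, of s i A]
        hausdorff_cost_mono[OF Int_lower1 bd, of s i B] by auto
  qed
  then have "(\<Sum>i. hausdorff_cost s (U i \<inter> A)) + (\<Sum>i. hausdorff_cost s (U i \<inter> B))
      \<le> (\<Sum>i. hausdorff_cost s (U i))"
    by (subst suminf_add) (auto intro!: suminf_le)
  moreover have "hausdorff_premeasure s \<delta> A + hausdorff_premeasure s \<delta> B
      \<le> (\<Sum>i. hausdorff_cost s (U i \<inter> A)) + (\<Sum>i. hausdorff_cost s (U i \<inter> B))"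
    by (intro add_mono hausdorff_premeasure_le cov) auto
  ultimately show "hausdorff_premeasure s \<delta> A + hausdorff_premeasure s \<delta> B
      \<le> (\<Sum>i. hausdorff_cost s (U i))"
    by (rule order_trans[rotated])
qed

lemma hausdorff_outer_separated:
  assumes "d > 0" "\<And>x y. x \<in> A \<Longrightarrow> y \<in> B \<Longrightarrow> dist x y \<ge> d"
  shows "hausdorff_outer s A + hausdorff_outer s B \<le> hausdorff_outer s (A \<union> B)"
proof -
  have *: "hausdorff_premeasure s \<delta> A + hausdorff_premeasure s \<epsilon> B \<le> hausdorff_outer s (A \<union> B)"
    if "\<delta> > 0" "\<epsilon> > 0" for \<delta> \<epsilon>
  proof -
    \<comment> \<open>The suprema over \<open>\<delta>\<close> and \<open>\<epsilon>\<close> are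
      taken independently, so both scales are lowered to one value that is also below the distance
      \<open>d\<close>.\<close>
    define m where "m = min (d/2) (min \<delta> \<epsilon>)"
    have m: "m > 0" "m \<le> \<delta>" "m \<le> \<epsilon>" "m < d"
      using that assms(1) by (auto simp: m_def)
    have "hausdorff_premeasure s \<delta> A + hausdorff_premeasure s \<epsilon> B
        \<le> hausdorff_premeasure s m A + hausdorff_premeasure s m B"
      using m by (intro add_mono hausdorff_premeasure_mono) auto
    also have "\<dots> \<le> hausdorff_premeasure s m (A \<union> B)"
      using m(4) assms(2) by (intro hausdorff_premeasure_separated) (meson less_le_trans)
    also have "\<dots> \<le> hausdorff_outer s (A \<union> B)"
      using m by (intro hausdorff_premeasure_le_outer) auto
    finally show ?thesis .
  qed
  show ?thesis
    unfolding hausdorff_outer_def[of s A] hausdorff_outer_def[of s B]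
    by (subst ennreal_SUP_add_left[symmetric], force, rule SUP_least,
        subst ennreal_SUP_add_right, force, rule SUP_least) (auto intro: *)
qed

text \<open>Caratheodory's criterion. The shells \<open>R k = {1/(k+2) \<le> infdist < 1/(k+1)}\<close> of equal parity have
  positive mutual distance, so their outer measures are summable and the tails tend to 0.\<close>

lemma hausdorff_outer_closed_split:
  fixes C E :: "'a::metric_space set"
  assumes "closed C"
  shows "hausdorff_outer s (E \<inter> C) + hausdorff_outer s (E - C) \<le> hausdorff_outer s E"
proof (cases "hausdorff_outer s E = top \<or> C = {}")
  case False
  then have fin: "hausdorff_outer s E \<noteq> top" and ne: "C \<noteq> {}" by auto
  define h :: "'a set \<Rightarrow> ennreal" where "h = hausdorff_outer s"
  define D where "D k = {x \<in> E. infdist x C \<ge> 1 / real (Suc k)}" for k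
  define R where "R k = D (Suc k) - D k" for k
  have hmono: "X \<subseteq> Y \<Longrightarrow> h X \<le> h Y" for X Y :: "'a set"
    by (simp add: h_def hausdorff_outer_mono)
  \<comment> \<open>\<open>infdist\<close> is 1-Lipschitz, so a gap \<open>d\<close> between its
    values on the two sets is a gap between the sets.\<close>
  have sep: "h A + h B \<le> h (A \<union> B)"
    if "0 < d" "\<And>x y. x \<in> A \<Longrightarrow> y \<in> B \<Longrightarrow> infdist y C + d \<le> infdist x C"
    for A B :: "'a set" and d
    unfolding h_def
  proof (rule hausdorff_outer_separated[OF that(1)])
    fix x y assume "x \<in> A" "y \<in> B"
    then show "d \<le> dist x y"
      using that(2)[of x y] infdist_triangle[of x C y] by simp
  qed
  have D_E: "D k \<subseteq> E" "R k \<subseteq> E" for k by (auto simp: D_def R_def)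
  have D_mono: "D k \<subseteq> D l" if "k \<le> l" for k l
  proof -
    have "1 / real (Suc l) \<le> 1 / real (Suc k)"
      using that by (simp add: frac_le)
    then show ?thesis by (auto simp: D_def simp del: of_nat_Suc)
  qed
  have sum_R: "(\<Sum>j<m. h (R (2 * j + i))) \<le> h (\<Union>j<m. R (2 * j + i))" for m i
  proof (induction m)
    case (Suc m)
    define X where "X = (\<Union>j<m. R (2 * j + i))"
    have "h X + h (R (2 * m + i)) \<le> h (X \<union> R (2 * m + i))"
    proof (cases "m = 0")
      case False
      show ?thesis
      proof (rule sep)
        \<comment> \<open>\<open>X\<close> lies in \<open>D (2 * m + i - 1)\<close>, where
          \<open>infdist\<close> is at least \<open>1 / (2 * m + i)\<close>, and the new shell lies
          below \<open>1 / (2 * m + i + 1)\<close>. The case \<open>m = 0\<close>, where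
          \<open>X\<close> is empty, is apart because the denominator could be 0.\<close>
        let ?d = "1 / real (2 * m + i) - 1 / real (2 * m + i + 1)"
        have "1 / real (2 * m + i + 1) < 1 / real (2 * m + i)"
          using False by (intro frac_less2) auto
        then show "0 < ?d" by simp
        fix x y assume x: "x \<in> X" and y: "y \<in> R (2 * m + i)"
        obtain j where j: "j < m" "x \<in> D (Suc (2 * j + i))"
          using x by (auto simp: X_def R_def)
        moreover have "Suc (2 * j + i) \<le> 2 * m + i - 1"
          using j(1) by linarith
        ultimately have "x \<in> D (2 * m + i - 1)"
          using D_mono[of "Suc (2 * j + i)" "2 * m + i - 1"] by force
        then have "infdist x C \<ge> 1 / real (2 * m + i)"
          using False by (simp add: D_def)
        moreover have "infdist y C \<le> 1 / real (2 * m + i + 1)"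
          using y by (auto simp: R_def D_def)
        ultimately show "infdist y C + ?d \<le> infdist x C" by linarith
      qed
    qed (simp add: X_def h_def)
    moreover have "(\<Union>j<Suc m. R (2 * j + i)) = X \<union> R (2 * m + i)"
      by (auto simp: X_def less_Suc_eq)
    ultimately show ?case
      using Suc.IH by (simp add: X_def) (meson add_right_mono order_trans)
  qed (simp add: h_def)
  have sum_R': "(\<Sum>j. h (R (2 * j + i))) \<le> h E" for i
  proof (rule suminf_le_const)
    show "(\<Sum>j<m. h (R (2 * j + i))) \<le> h E" for m
      using sum_R[where m=m and i=i] hmono[of "\<Union>j<m. R (2 * j + i)" E] D_E(2) by (meson UN_least order_trans)
  qed auto
  define r where "r k = h (R (2 * k)) + h (R (2 * k + 1))" for k
  have "(\<Sum>k. r k) = (\<Sum>j. h (R (2 * j + 0))) + (\<Sum>j. h (R (2 * j + 1)))"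
    unfolding r_def by (subst suminf_add[symmetric]) auto
  also have "\<dots> < top"
    using sum_R'[of 0] sum_R'[of 1] fin
    by (auto simp: h_def less_top[symmetric] top_unique)
  finally have r_fin: "(\<Sum>k. r k) \<noteq> top" by simp
  \<comment> \<open>The tails of a convergent series vanish; this is carried over from real series,
    since all terms are finite.\<close>
  have tail: "(\<lambda>k. \<Sum>j. r (j + k)) \<longlonglongrightarrow> 0"
  proof -
    have r_top: "r k \<noteq> top" for k
      using ennreal_suminf_lessD[of r top k] r_fin by (auto simp: less_top)
    define r' where "r' k = enn2real (r k)" for k
    have rr: "r k = ennreal (r' k)" "r' k \<ge> 0" for k
      using r_top[of k] by (auto simp: r'_def less_top)
    have "summable r'"
      using r_fin rr by (intro summable_suminf_not_top) auto
    then have "(\<lambda>k. ennreal (\<Sum>j. r' (j + k))) \<longlonglongrightarrow> ennreal 0"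
      by (intro tendsto_ennrealI suminf_exist_split2)
    moreover have "(\<Sum>j. r (j + k)) = ennreal (\<Sum>j. r' (j + k))" for k
      using \<open>summable r'\<close> rr
      by (simp add: rr(1) suminf_ennreal2 summable_iff_shift)
    ultimately show ?thesis by simp
  qed
  \<comment> \<open>A point outside the closed set \<open>C\<close> has positive
    \<open>infdist\<close>, so it lies in some \<open>D m\<close>; the least such index puts it into
    \<open>D (2 * k)\<close> or into a later shell.\<close>
  have split: "h (E - C) \<le> h (D (2 * k)) + (\<Sum>j. r (j + k))" for k
  proof -
    have sub: "E - C \<subseteq> D (2 * k) \<union> (\<Union>j. R (2 * (j + k)) \<union> R (2 * (j + k) + 1))"
    proof
      fix x assume x: "x \<in> E - C"
      then have "infdist x C > 0"
        using infdist_pos_not_in_closed[OF assms ne] by auto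
      then obtain m where "1 / real (Suc m) < infdist x C"
        by (metis inverse_eq_divide reals_Archimedean)
      then have "\<exists>m. x \<in> D m" using x by (intro exI[of _ m]) (simp add: D_def)
      define l where "l = (LEAST m. x \<in> D m)"
      have l: "x \<in> D l" "\<And>m. m < l \<Longrightarrow> x \<notin> D m"
        using \<open>\<exists>m. x \<in> D m\<close> unfolding l_def by (auto intro: LeastI dest: not_less_Least)
      show "x \<in> D (2 * k) \<union> (\<Union>j. R (2 * (j + k)) \<union> R (2 * (j + k) + 1))"
      proof (cases "l \<le> 2 * k")
        case True
        then show ?thesis using D_mono[of l "2 * k"] l(1) by blast
      next
        case False
        then have "x \<in> R (l - 1)"
          using l by (cases l) (auto simp: R_def)
        moreover obtain j where "l - 1 = 2 * (j + k) \<or> l - 1 = 2 * (j + k) + 1"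
        proof (rule that)
          have "(l - 1) div 2 - k + k = (l - 1) div 2"
            using False by simp
          then show "l - 1 = 2 * ((l - 1) div 2 - k + k) \<or> l - 1 = 2 * ((l - 1) div 2 - k + k) + 1"
            by (simp only:) presburger
        qed
        ultimately have "x \<in> R (2 * (j + k)) \<union> R (2 * (j + k) + 1)"
          by auto
        then show ?thesis by blast
      qed
    qed
    have "h (E - C) \<le> h (D (2 * k) \<union> (\<Union>j. R (2 * (j + k)) \<union> R (2 * (j + k) + 1)))"
      by (rule hmono[OF sub])
    also have "\<dots> \<le> h (D (2 * k)) + h (\<Union>j. R (2 * (j + k)) \<union> R (2 * (j + k) + 1))"
      unfolding h_def by (rule hausdorff_outer_Un_le)
    also have "\<dots> \<le> h (D (2 * k)) + (\<Sum>j. h (R (2 * (j + k)) \<union> R (2 * (j + k) + 1)))"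
      unfolding h_def by (intro add_left_mono hausdorff_outer_countable_subadditive)
    also have "\<dots> \<le> h (D (2 * k)) + (\<Sum>j. r (j + k))"
      unfolding r_def h_def
      by (intro add_left_mono suminf_le hausdorff_outer_Un_le) auto
    finally show ?thesis .
  qed
  have part: "h (E \<inter> C) + h (D k) \<le> h E" for k
  proof -
    have "h (D k) + h (E \<inter> C) \<le> h (D k \<union> (E \<inter> C))"
      by (rule sep[of "1 / real (Suc k)"]) (auto simp: D_def)
    also have "\<dots> \<le> h E" by (rule hmono) (auto simp: D_def)
    finally show ?thesis by (simp add: add.commute)
  qed
  have "h (E \<inter> C) + h (E - C) \<le> h E + (\<Sum>j. r (j + k))" for k
  proof -
    have "h (E \<inter> C) + h (E - C) \<le> h (E \<inter> C) + (h (D (2 * k)) + (\<Sum>j. r (j + k)))"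
      by (intro add_left_mono split)
    also have "\<dots> = (h (E \<inter> C) + h (D (2 * k))) + (\<Sum>j. r (j + k))"
      by (simp add: add.assoc)
    also have "\<dots> \<le> h E + (\<Sum>j. r (j + k))"
      by (intro add_right_mono part)
    finally show ?thesis .
  qed
  moreover have "(\<lambda>k. h E + (\<Sum>j. r (j + k))) \<longlonglongrightarrow> h E + 0"
    by (intro tendsto_add tendsto_const tail)
  ultimately show ?thesis
    using LIMSEQ_le_const[of "\<lambda>k. h E + (\<Sum>j. r (j + k))" "h E"] by (auto simp: h_def)
qed (auto)

text \<open>The Caratheodory measurable sets of an outer measure form a sigma algebra on which it is
  countably additive, and \<open>hausdorff_outer_closed_split\<close> puts the closed sets into
  it.\<close>

lemma measure_space_hausdorff:
  "measure_space UNIV (sets borel) (hausdorff_outer s :: 'a::metric_space set \<Rightarrow> ennreal)"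
proof -
  interpret P: sigma_algebra UNIV "UNIV :: 'a set set"
    by (metis Pow_UNIV sigma_algebra_Pow)
  define L where "L = lambda_system UNIV UNIV (hausdorff_outer s :: 'a set \<Rightarrow> ennreal)"
  have ms: "measure_space UNIV L (hausdorff_outer s)"
    unfolding L_def by (rule P.caratheodory_lemma[OF outer_measure_space_hausdorff])
  then interpret L: sigma_algebra UNIV L by (simp add: measure_space_def)
  have "C \<in> L" if "closed C" for C
    unfolding L_def P.lambda_system_eq
  proof (safe intro!: antisym)
    fix X :: "'a set"
    show "hausdorff_outer s X \<le> hausdorff_outer s (X \<inter> C) + hausdorff_outer s (X - C)"
      by (metis hausdorff_outer_Un_le Int_Diff_Un)
  qed (auto intro: hausdorff_outer_closed_split that)
  then have "sets borel \<subseteq> L"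
    unfolding borel_eq_closed
    by (subst sets_measure_of, simp, intro L.sigma_sets_subset) auto
  then show ?thesis
    using ms sets.sigma_algebra_axioms[of "borel :: 'a measure"]
    unfolding measure_space_def countably_additive_def positive_def
    by (auto simp: subset_iff)
qed

lemma sets_hausdorff_measure [measurable_cong, simp]: "sets (hausdorff_measure s :: 'a::metric_space measure) = sets borel"
  using sets.sigma_sets_eq[of "borel :: 'a measure"] by (simp add: hausdorff_measure_def)

lemma space_hausdorff_measure [simp]: "space (hausdorff_measure s) = UNIV"
  by (simp add: hausdorff_measure_def)

text \<open>\<open>measure_of\<close> returns the given set function only if it is positive and
  countably additive; on the Borel sets this is what Caratheodory's criterion supplies.\<close>

lemma emeasure_hausdorff_measure:
  assumes "A \<in> sets borel"
  shows "emeasure (hausdorff_measure s) A = hausdorff_outer s A"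
proof (rule emeasure_measure_of[OF hausdorff_measure_def])
  show "countably_additive (sets (hausdorff_measure s)) (hausdorff_outer s)"
    "positive (sets (hausdorff_measure s)) (hausdorff_outer s)"
    using measure_space_hausdorff[of s] by (auto simp: measure_space_def)
qed (use assms in auto)

text \<open>The images of the traces \<open>U i \<inter> A\<close> form a cover whose diameters grow
  at most by \<open>L\<close>, hence whose costs grow at most by \<open>L ^ s\<close>. Traces are
  taken because the Lipschitz bound holds on \<open>A\<close> only.\<close>

lemma hausdorff_outer_lipschitz:
  fixes f :: "'a::real_normed_vector \<Rightarrow> 'b::real_normed_vector"
  assumes "L > 0" "\<And>x y. x \<in> A \<Longrightarrow> y \<in> A \<Longrightarrow> norm (f x - f y) \<le> L * norm (x - y)"
  shows "hausdorff_outer s (f ` A) \<le> ennreal (L ^ s) * hausdorff_outer s A"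
proof (rule hausdorff_outer_least)
  fix \<delta> :: real assume "\<delta> > 0"
  have "hausdorff_premeasure s \<delta> (f ` A) \<le> ennreal (L ^ s) * (\<Sum>i. hausdorff_cost s (U i))"
    if U: "delta_cover (\<delta> / L) A U" for U
  proof -
    have bd: "bounded (U i)" and diam: "diameter (U i) \<le> \<delta> / L" for i
      using U by (auto simp: delta_cover_def)
    define V where "V i = f ` (U i \<inter> A)" for i
    have V1: "norm (x - y) \<le> L * diameter (U i)" if xy: "x \<in> V i" "y \<in> V i" for x y i
    proof -
      obtain x' y' where *: "x = f x'" "y = f y'" "x' \<in> U i" "x' \<in> A" "y' \<in> U i" "y' \<in> A"
        using xy by (auto simp: V_def)
      have "norm (x - y) \<le> L * norm (x' - y')"
        using * assms(2) by simp
      also have "\<dots> \<le> L * diameter (U i)"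
        using diameter_bounded_bound[OF bd, of x' i y'] * \<open>L > 0\<close>
        by (intro mult_left_mono) (auto simp: dist_norm)
      finally show ?thesis .
    qed
    have V2: "diameter (V i) \<le> L * diameter (U i)" for i
      using V1[of _ i] diameter_ge_0[OF bd, of i] \<open>L > 0\<close> by (intro diameter_le) auto
    have V3: "bounded (V i)" for i
      using V1[of _ i] unfolding bounded_two_points dist_norm by blast
    have cost: "hausdorff_cost s (V i) \<le> ennreal (L ^ s) * hausdorff_cost s (U i)" for i
    proof (cases "V i = {}")
      case False
      then have ne: "U i \<noteq> {}" by (auto simp: V_def)
      have "hausdorff_cost s (V i)
          \<le> ennreal (unit_ball_vol (real s) * (L * diameter (U i) / 2) ^ s)"
        by (rule hausdorff_cost_le[OF V3 V2])
      also have "\<dots> = ennreal (L ^ s) * hausdorff_cost s (U i)"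
        using ne \<open>L > 0\<close> diameter_ge_0[OF bd, of i]
        by (simp add: hausdorff_cost_def ennreal_mult'[symmetric] power_mult_distrib power_divide field_simps)
      finally show ?thesis .
    qed simp
    have "delta_cover \<delta> (f ` A) V"
      unfolding delta_cover_def
    proof (intro conjI allI)
      show "f ` A \<subseteq> \<Union> (range V)" using U by (fastforce simp: V_def delta_cover_def)
      show "diameter (V i) \<le> \<delta>" for i
        using V2[of i] mult_left_mono[OF diam[of i], of L] \<open>L > 0\<close> by simp
    qed (rule V3)
    then have "hausdorff_premeasure s \<delta> (f ` A) \<le> (\<Sum>i. hausdorff_cost s (V i))"
      by (rule hausdorff_premeasure_le)
    also have "\<dots> \<le> (\<Sum>i. ennreal (L ^ s) * hausdorff_cost s (U i))"
      by (intro suminf_le cost) auto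
    finally show ?thesis by simp
  qed
  \<comment> \<open>Dividing by \<open>L ^ s\<close> isolates the cost of the cover, so that the
    infimum over covers can be taken.\<close>
  then have "hausdorff_premeasure s \<delta> (f ` A) / ennreal (L ^ s) \<le> hausdorff_premeasure s (\<delta> / L) A"
    using \<open>L > 0\<close>
    by (intro hausdorff_premeasure_greatest divide_le_posI_ennreal) auto
  also have "\<dots> \<le> hausdorff_outer s A"
    using \<open>\<delta> > 0\<close> \<open>L > 0\<close> by (intro hausdorff_premeasure_le_outer) auto
  finally have "ennreal (L ^ s) * (hausdorff_premeasure s \<delta> (f ` A) / ennreal (L ^ s))
      \<le> ennreal (L ^ s) * hausdorff_outer s A"
    by (rule mult_left_mono) auto
  then show "hausdorff_premeasure s \<delta> (f ` A) \<le> ennreal (L ^ s) * hausdorff_outer s A"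
    using \<open>L > 0\<close> by (simp add: ennreal_times_divide mult.commute[of "ennreal (L ^ s)"] ennreal_mult_divide_eq)
qed

subsection \<open>Translation invariant measures\<close>

text \<open>The Fubini proof that Haar measure is unique, applied to the double integral of
  \<open>indicator A (x + y) * indicator B y\<close>. Invariance of \<open>M\<close> evaluates it as
  the left-hand side; invariance of \<open>N\<close> replaces \<open>y\<close> by
  \<open>y - x\<close>, after which invariance of \<open>M\<close> in \<open>x\<close> gives the
  right-hand side. Symmetry of \<open>B\<close> allows reading \<open>y - x\<close> as the translate
  \<open>x - y\<close> of \<open>x\<close>. Both measures live on the subspace \<open>S\<close> and
  are invariant only along it, which is why the inner identities hold almost everywhere.\<close>

lemma translation_invariant_measures_proportional:
  fixes M N :: "'a::euclidean_space measure"
  assumes sets_M [measurable_cong]: "sets M = sets borel"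
    and sets_N [measurable_cong]: "sets N = sets borel"
    and sigma_M: "sigma_finite_measure M" and sigma_N: "sigma_finite_measure N"
    and S: "subspace S"
    and AE_M: "AE x in M. x \<in> S" and AE_N: "AE x in N. x \<in> S"
    and tr_M: "\<And>v A. v \<in> S \<Longrightarrow> A \<in> sets borel \<Longrightarrow> emeasure M ((\<lambda>x. x + v) -` A) = emeasure M A"
    and tr_N: "\<And>v A. v \<in> S \<Longrightarrow> A \<in> sets borel \<Longrightarrow> emeasure N ((\<lambda>x. x + v) -` A) = emeasure N A"
    and A [measurable]: "A \<in> sets borel" and B [measurable]: "B \<in> sets borel"
    and sym: "\<And>x. - x \<in> B \<longleftrightarrow> x \<in> B"
  shows "emeasure M A * emeasure N B = emeasure N A * emeasure M B"
proof -
  interpret M: sigma_finite_measure M by fact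
  interpret N: sigma_finite_measure N by fact
  interpret MN: pair_sigma_finite M N by unfold_locales
  have spM [simp]: "space M = UNIV" and spN [simp]: "space N = UNIV"
    using sets_eq_imp_space_eq[OF sets_M] sets_eq_imp_space_eq[OF sets_N] by auto
  have shift_meas: "{z \<in> A. z - x \<in> B} \<in> sets borel" for x
    by measurable
  have "emeasure M A * emeasure N B = (\<integral>\<^sup>+y. emeasure M A * indicator B y \<partial>N)"
    by (simp add: nn_integral_cmult)
  also have "\<dots> = (\<integral>\<^sup>+y. (\<integral>\<^sup>+x. indicator A (x + y) * indicator B y \<partial>M) \<partial>N)"
  proof (rule nn_integral_cong_AE)
    have "emeasure M A * indicator B y = (\<integral>\<^sup>+x. indicator A (x + y) * indicator B y \<partial>M)"
      if "y \<in> S" for y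
    proof -
      have "(\<integral>\<^sup>+x. indicator A (x + y) * indicator B y \<partial>M)
          = (\<integral>\<^sup>+x. indicator ((\<lambda>x. x + y) -` A) x \<partial>M) * indicator B y"
        by (subst nn_integral_multc[symmetric]) (auto simp: indicator_def)
      also have "(\<integral>\<^sup>+x. indicator ((\<lambda>x. x + y) -` A) x \<partial>M) = emeasure M ((\<lambda>x. x + y) -` A)"
        using measurable_sets_borel[of "\<lambda>x. x + y" borel A] by (intro nn_integral_indicator) (simp add: sets_M)
      finally show ?thesis
        using tr_M[OF that A] by simp
    qed
    with AE_N show "AE y in N. emeasure M A * indicator B y
        = (\<integral>\<^sup>+x. indicator A (x + y) * indicator B y \<partial>M)"
      by (auto elim!: eventually_mono)
  qed
  also have "\<dots> = (\<integral>\<^sup>+x. (\<integral>\<^sup>+y. indicator A (x + y) * indicator B y \<partial>N) \<partial>M)"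
    by (rule MN.Fubini'[symmetric, of "\<lambda>x y. indicator A (x + y) * indicator B y", symmetric]) measurable
  also have "\<dots> = (\<integral>\<^sup>+x. (\<integral>\<^sup>+y. indicator A y * indicator B (y - x) \<partial>N) \<partial>M)"
  proof (rule nn_integral_cong_AE)
    have "(\<integral>\<^sup>+y. indicator A (x + y) * indicator B y \<partial>N) = (\<integral>\<^sup>+y. indicator A y * indicator B (y - x) \<partial>N)"
      if "x \<in> S" for x
    proof -
      have "(\<integral>\<^sup>+y. indicator A (x + y) * indicator B y \<partial>N)
          = (\<integral>\<^sup>+y. indicator ((\<lambda>y. y + x) -` {z \<in> A. z - x \<in> B}) y \<partial>N)"
        by (intro nn_integral_cong) (auto simp: indicator_def add.commute)
      also have "\<dots> = emeasure N ((\<lambda>y. y + x) -` {z \<in> A. z - x \<in> B})"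
        using measurable_sets_borel[of "\<lambda>y. y + x" borel "{z \<in> A. z - x \<in> B}"] shift_meas
        by (intro nn_integral_indicator) (simp add: sets_N)
      also have "\<dots> = emeasure N {z \<in> A. z - x \<in> B}"
        by (rule tr_N[OF that shift_meas])
      also have "\<dots> = (\<integral>\<^sup>+y. indicator {z \<in> A. z - x \<in> B} y \<partial>N)"
        using shift_meas by (intro nn_integral_indicator[symmetric]) (simp add: sets_N)
      also have "\<dots> = (\<integral>\<^sup>+y. indicator A y * indicator B (y - x) \<partial>N)"
        by (intro nn_integral_cong) (auto simp: indicator_def)
      finally show ?thesis .
    qed
    with AE_M show "AE x in M. (\<integral>\<^sup>+y. indicator A (x + y) * indicator B y \<partial>N)
        = (\<integral>\<^sup>+y. indicator A y * indicator B (y - x) \<partial>N)"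
      by (auto elim!: eventually_mono)
  qed
  also have "\<dots> = (\<integral>\<^sup>+y. (\<integral>\<^sup>+x. indicator A y * indicator B (y - x) \<partial>M) \<partial>N)"
    by (rule MN.Fubini'[of "\<lambda>x y. indicator A y * indicator B (y - x)", symmetric]) measurable
  also have "\<dots> = (\<integral>\<^sup>+y. emeasure M B * indicator A y \<partial>N)"
  proof (rule nn_integral_cong_AE)
    have "(\<integral>\<^sup>+x. indicator A y * indicator B (y - x) \<partial>M) = emeasure M B * indicator A y"
      if "y \<in> S" for y
    proof -
      have "indicator B (y - x) = (indicator ((\<lambda>x. x + - y) -` B) x :: ennreal)" for x
        using sym[of "y - x"] by (auto simp: indicator_def)
      then have "(\<integral>\<^sup>+x. indicator A y * indicator B (y - x) \<partial>M)
          = (\<integral>\<^sup>+x. indicator A y * indicator ((\<lambda>x. x + - y) -` B) x \<partial>M)"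
        by simp
      also have "\<dots> = indicator A y * emeasure M ((\<lambda>x. x + - y) -` B)"
        using measurable_sets_borel[of "\<lambda>x. x + - y" borel B]
        by (intro nn_integral_cmult_indicator) (simp add: sets_M)
      also have "emeasure M ((\<lambda>x. x + - y) -` B) = emeasure M B"
        using S that by (intro tr_M) (auto simp: subspace_neg)
      finally show ?thesis by (simp add: mult.commute)
    qed
    with AE_N show "AE y in N. (\<integral>\<^sup>+x. indicator A y * indicator B (y - x) \<partial>M)
        = emeasure M B * indicator A y"
      by (auto elim!: eventually_mono)
  qed
  also have "\<dots> = emeasure N A * emeasure M B"
    by (subst nn_integral_cmult_indicator) (auto simp: mult.commute sets_N)
  finally show ?thesis .
qed

lemma sigma_finite_measure_cball:
  fixes M :: "'a::euclidean_space measure"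
  assumes "sets M = sets borel" "\<And>r. emeasure M (cball 0 r) < top"
  shows "sigma_finite_measure M"
proof
  have "(\<Union>n::nat. cball (0::'a) (real n)) = UNIV"
    by (auto simp: real_arch_simple)
  then show "\<exists>A. countable A \<and> A \<subseteq> sets M \<and> \<Union> A = space M \<and> (\<forall>a\<in>A. emeasure M a \<noteq> \<infinity>)"
    using assms sets_eq_imp_space_eq[OF assms(1)]
    by (intro exI[of _ "range (\<lambda>n::nat. cball 0 (real n))"]) (auto simp: less_top[symmetric])
qed

section \<open>Lebesgue measure under linear maps, reflections and shears\<close>

lemma emeasure_lborel_cball_pos:
  "0 < emeasure lborel (cball (c::'a::euclidean_space) 1)"
  by (simp add: emeasure_cball)

lemma emeasure_lborel_bounded_finite:
  fixes A :: "'a::euclidean_space set"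
  assumes "bounded A"
  shows "emeasure lborel A < top"
  using emeasure_bounded_finite[OF assms] by simp

lemma emeasure_lborel_vimage_add:
  fixes A :: "'a::euclidean_space set"
  assumes "A \<in> sets borel"
  shows "emeasure lborel ((\<lambda>x. x + v) -` A) = emeasure lborel A"
proof -
  have "emeasure lborel A = emeasure (distr lborel borel ((+) v)) A"
    by (simp add: lborel_distr_plus)
  also have "\<dots> = emeasure lborel ((\<lambda>x. x + v) -` A)"
    using assms by (subst emeasure_distr) (auto simp: add.commute[of v] vimage_def)
  finally show ?thesis by simp
qed

lemma nn_integral_lborel_scale:
  fixes f :: "'a::euclidean_space \<Rightarrow> ennreal"
  assumes [measurable]: "f \<in> borel_measurable borel" and "c > 0"
  shows "(\<integral>\<^sup>+x. f x \<partial>lborel) = ennreal (c ^ DIM('a)) * (\<integral>\<^sup>+x. f (c *\<^sub>R x) \<partial>lborel)"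
proof -
  have "(\<integral>\<^sup>+x. f x \<partial>lborel)
      = (\<integral>\<^sup>+x. f x \<partial>density (distr lborel borel (\<lambda>x. 0 + c *\<^sub>R x)) (\<lambda>_. \<bar>c\<bar>^DIM('a)))"
    using lborel_affine[of c "0::'a"] assms(2) by simp
  also have "\<dots> = ennreal (c ^ DIM('a)) * (\<integral>\<^sup>+x. f (c *\<^sub>R x) \<partial>lborel)"
    using assms(2) by (simp add: nn_integral_density nn_integral_distr nn_integral_cmult ennreal_power)
  finally show ?thesis .
qed

text \<open>The image of Lebesgue measure under \<open>f\<close> is translation invariant, since a
  shift by \<open>v\<close> corresponds to a shift by \<open>g v\<close> before applying
  \<open>f\<close>. The unit ball is the symmetric reference set, and the volume of its preimage
  takes the place of the determinant.\<close>

lemma emeasure_lborel_linear: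
  fixes f g :: "'a::euclidean_space \<Rightarrow> 'a"
  assumes f: "linear f" and g: "linear g" and fg: "\<And>x. f (g x) = x" and gf: "\<And>x. g (f x) = x"
    and A [measurable]: "A \<in> sets borel"
  shows "emeasure lborel (f -` A) * emeasure lborel (cball (0::'a) 1)
       = emeasure lborel A * emeasure lborel (f -` cball 0 1)"
proof -
  have [measurable]: "f \<in> borel_measurable borel"
    using f by (intro borel_measurable_continuous_onI linear_continuous_on) (simp add: linear_linear)
  define M where "M = distr lborel borel f"
  have M: "emeasure M B = emeasure lborel (f -` B)" if "B \<in> sets borel" for B
    using that by (simp add: M_def emeasure_distr)
  have "f -` B = g ` B" for B
    using fg gf by (metis (no_types, lifting) bijI' bij_vimage_eq_inv_image inv_equality)
  then have bd: "emeasure M (cball 0 r) < top" for r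
    using bounded_linear_image[of "cball 0 r" g] g
    by (simp add: M emeasure_lborel_bounded_finite linear_linear)
  have "emeasure M A * emeasure lborel (cball (0::'a) 1) = emeasure lborel A * emeasure M (cball 0 1)"
  proof (rule translation_invariant_measures_proportional[of _ _ UNIV])
    show "sigma_finite_measure M"
      using bd by (intro sigma_finite_measure_cball) (simp_all add: M_def)
    show "emeasure M ((\<lambda>x. x + v) -` B) = emeasure M B" if B: "B \<in> sets borel" for v B
    proof -
      have [measurable]: "B \<in> sets borel" by fact
      have "f -` ((\<lambda>x. x + v) -` B) = (\<lambda>x. x + g v) -` (f -` B)"
        using linear_add[OF f] fg by auto
      moreover have "f -` B \<in> sets borel" "(\<lambda>x. x + v) -` B \<in> sets borel"
        using measurable_sets_borel[of f borel B] measurable_sets_borel[of "\<lambda>x. x + v" borel B] B by auto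
      ultimately show ?thesis
        using B by (simp add: M emeasure_lborel_vimage_add)
    qed
  qed (auto simp: M_def lborel.sigma_finite_measure_axioms emeasure_lborel_vimage_add)
  then show ?thesis by (simp add: M)
qed

text \<open>The reference ball is its own preimage, so the volume factor is 1.\<close>

lemma emeasure_lborel_isometry:
  fixes f g :: "'a::euclidean_space \<Rightarrow> 'a"
  assumes "linear f" "linear g" "\<And>x. f (g x) = x" "\<And>x. g (f x) = x" "\<And>x. norm (f x) = norm x"
    and "A \<in> sets borel"
  shows "emeasure lborel (f -` A) = emeasure lborel A"
proof -
  let ?b = "emeasure lborel (cball (0::'a) 1)"
  have "f -` cball 0 1 = cball 0 1" using assms(5) by auto
  then have "emeasure lborel (f -` A) * ?b = emeasure lborel A * ?b"
    using emeasure_lborel_linear[OF assms(1-4,6)] by simp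
  moreover have "?b \<noteq> 0" "?b \<noteq> top"
    using emeasure_lborel_cball_pos[of "0::'a"] emeasure_lborel_bounded_finite[of "cball (0::'a) 1"]
    by auto
  ultimately show ?thesis
    by (metis ennreal_mult_divide_eq)
qed

text \<open>Reflection in the hyperplane orthogonal to \<open>w\<close>; for \<open>w = 0\<close>
  division by zero makes it the identity.\<close>

definition reflect :: "'a::euclidean_space \<Rightarrow> 'a \<Rightarrow> 'a" where
  "reflect w x = x - (2 * (x \<bullet> w) / (w \<bullet> w)) *\<^sub>R w"

lemma linear_reflect: "linear (reflect w)"
  by (rule linearI) (auto simp: reflect_def inner_left_distrib algebra_simps add_divide_distrib)

lemma reflect_reflect [simp]: "reflect w (reflect w x) = x"
  by (cases "w = 0") (simp_all add: reflect_def inner_diff_left)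

lemma inner_reflect: "reflect w x \<bullet> reflect w y = x \<bullet> y"
  by (cases "w = 0")
    (simp_all add: reflect_def inner_diff_left inner_diff_right inner_commute field_simps)

lemma norm_reflect [simp]: "norm (reflect w x) = norm x"
  by (simp add: norm_eq_sqrt_inner inner_reflect)

text \<open>Vectors of equal length are exchanged by the reflection in their bisecting hyperplane.
  This carries any unit normal to a coordinate vector, so that hyperplanes need to be treated in one
  direction only.\<close>

lemma reflect_diff_eq:
  assumes "norm u = norm v"
  shows "reflect (u - v) u = v"
proof (cases "u = v")
  case False
  have *: "u \<bullet> u = v \<bullet> v" using assms by (simp add: norm_eq)
  have "(u - v) \<bullet> (u - v) \<noteq> 0" using False by simp
  moreover have "2 * (u \<bullet> (u - v)) = (u - v) \<bullet> (u - v)"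
    using * by (simp add: inner_diff_left inner_diff_right inner_commute)
  ultimately have "2 * (u \<bullet> (u - v)) / ((u - v) \<bullet> (u - v)) = 1"
    by (metis divide_self)
  then show ?thesis unfolding reflect_def by (simp only: scaleR_one) simp
qed (simp add: reflect_def)

lemma emeasure_lborel_reflect:
  "A \<in> sets borel \<Longrightarrow> emeasure lborel (reflect w -` A) = emeasure lborel A"
  by (rule emeasure_lborel_isometry[of _ "reflect w"]) (auto simp: linear_reflect)

text \<open>Conjugation by the reflection in the hyperplane orthogonal to \<open>b\<close> turns the shear by \<open>v\<close> into
  its inverse, so the shear scales volumes by a factor with square 1.\<close>

lemma emeasure_lborel_shear:
  fixes b v :: "'a::euclidean_space"
  assumes "b \<bullet> v = 0" "norm b = 1" "A \<in> sets borel"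
  shows "emeasure lborel ((\<lambda>x. x + (b \<bullet> x) *\<^sub>R v) -` A) = emeasure lborel A"
proof -
  define f where "f w x = x + (b \<bullet> x) *\<^sub>R w" for w x :: 'a
  have lin: "linear (f w)" for w
    by (rule linearI) (auto simp: f_def inner_right_distrib algebra_simps)
  have inv: "f w (f (- w) x) = x" if "b \<bullet> w = 0" for w x
    using that by (simp add: f_def inner_diff_right)
  have f_meas: "f w \<in> borel_measurable borel" for w
    using lin by (intro borel_measurable_continuous_onI linear_continuous_on) (simp add: linear_linear)
  let ?B = "cball (0::'a) 1"
  define c where "c w = emeasure lborel (f w -` ?B)" for w
  have scale: "emeasure lborel (f w -` X) * emeasure lborel ?B = emeasure lborel X * c w"
    if "w = v \<or> w = - v" "X \<in> sets borel" for w X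
    unfolding c_def using that assms(1) inv[of w] inv[of "- w"]
    by (intro emeasure_lborel_linear[of _ "f (- w)"] lin) auto
  have bb: "b \<bullet> b = 1" using assms(2) by (simp add: norm_eq_1)
  have "f (- v) -` ?B = reflect b -` (f v -` ?B)"
  proof -
    have "reflect b (f v (reflect b x)) = f (- v) x" for x
      using assms(1) bb
      by (simp add: reflect_def f_def inner_diff_right inner_diff_left inner_add_left inner_commute algebra_simps)
    then have "norm (f v (reflect b x)) = norm (f (- v) x)" for x
      by (metis norm_reflect)
    then show ?thesis by auto
  qed
  then have cc: "c (- v) = c v"
    using emeasure_lborel_reflect[of "f v -` ?B" b] measurable_sets_borel[OF f_meas, of ?B v]
    by (simp add: c_def)
  \<comment> \<open>The two shears are inverse to each other, so the product of their volume factors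
    is 1; as the factors agree, each of them is 1.\<close>
  have "f v -` (f (- v) -` ?B) = ?B"
    using inv[of "- v"] assms(1) by auto
  then have "emeasure lborel ?B * emeasure lborel ?B = c v * c v"
    using scale[of v "f (- v) -` ?B"] measurable_sets_borel[OF f_meas, of ?B "- v"] cc
    by (simp add: c_def)
  moreover have fin: "emeasure lborel ?B \<noteq> top" "emeasure lborel ?B \<noteq> 0"
    using emeasure_lborel_cball_pos[of "0::'a"] emeasure_lborel_bounded_finite[of ?B] by auto
  moreover have "c v \<noteq> top"
    using calculation by (auto simp: ennreal_mult_eq_top_iff)
  ultimately have "c v = emeasure lborel ?B"
    by (cases "c v"; cases "emeasure lborel ?B")
      (auto simp: power2_eq_square[symmetric] ennreal_power)
  then have "emeasure lborel (f v -` A) * emeasure lborel ?B = emeasure lborel A * emeasure lborel ?B"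
    using scale[of v A] assms(3) by simp
  then have "emeasure lborel (f v -` A) = emeasure lborel A"
    using fin by (metis ennreal_mult_divide_eq)
  then show ?thesis by (simp add: f_def[abs_def])
qed

subsection \<open>Comparison of measures\<close>

text \<open>Passage from local to global: the cover is made disjoint and the local inequalities are
  added up. It serves to compare measures that are known to be close only on small pieces.\<close>

lemma emeasure_le_countable_cover:
  fixes U :: "nat \<Rightarrow> 'a set"
  assumes sets: "sets \<beta> = sets \<alpha>" and A: "A \<in> sets \<alpha>" "A \<subseteq> (\<Union>i. U i)" and U: "\<And>i. U i \<in> sets \<alpha>"
    and le: "\<And>i B. B \<in> sets \<alpha> \<Longrightarrow> B \<subseteq> U i \<inter> A \<Longrightarrow> emeasure \<alpha> B \<le> c * emeasure \<beta> B"
  shows "emeasure \<alpha> A \<le> c * emeasure \<beta> A"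
proof -
  define D where "D i = A \<inter> disjointed U i" for i
  have D: "D i \<in> sets \<alpha>" "D i \<subseteq> U i \<inter> A" for i
    using A(1) U disjointed_subset[of U i] sets.range_disjointed_sets[of U \<alpha>] by (auto simp: D_def)
  have disj: "disjoint_family D"
    using disjoint_family_disjointed[of U] unfolding D_def disjoint_family_on_def by blast
  have un: "(\<Union>i. D i) = A"
    using A(2) UN_disjointed_eq[of U] unfolding D_def by blast
  have range: "range D \<subseteq> sets \<alpha>"
    using D(1) by auto
  have "emeasure \<alpha> A = (\<Sum>i. emeasure \<alpha> (D i))"
    using suminf_emeasure[OF range disj] un by simp
  also have "\<dots> \<le> (\<Sum>i. c * emeasure \<beta> (D i))"
    by (rule suminf_le, rule le[OF D]) auto
  also have "\<dots> = c * emeasure \<beta> A"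
    using suminf_emeasure[of D \<beta>] range disj un sets by simp
  finally show ?thesis .
qed

text \<open>Makes a comparison up to arbitrary factors above 1 exact, infinite values
  included.\<close>

lemma ennreal_le_mult_all_gt_1:
  fixes a b :: ennreal
  assumes "\<And>\<theta>::real. \<theta> > 1 \<Longrightarrow> a \<le> ennreal \<theta> * b"
  shows "a \<le> b"
proof (rule tendsto_lowerbound)
  have "((\<lambda>\<theta>. ennreal \<theta> * b) \<longlongrightarrow> ennreal 1 * b) (at_right 1)"
    by (intro tendsto_mult_ennreal tendsto_ennrealI tendsto_const) auto
  then show "((\<lambda>\<theta>. ennreal \<theta> * b) \<longlongrightarrow> b) (at_right 1)" by simp
  show "\<forall>\<^sub>F \<theta> in at_right 1. a \<le> ennreal \<theta> * b"
    using assms by (auto simp: eventually_at_right_field intro: exI[of _ 2])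
qed simp

subsection \<open>Hausdorff measure on hyperplanes\<close>

lemma hausdorff_outer_similarity:
  fixes f g :: "'a::real_normed_vector \<Rightarrow> 'a"
  assumes fg: "\<And>x. f (g x) = x" and gf: "\<And>x. g (f x) = x" and "L > 0"
    and f: "\<And>x y. norm (f x - f y) = L * norm (x - y)"
  shows "ennreal (L ^ s) * hausdorff_outer s (f -` A) = hausdorff_outer s A"
proof (rule antisym)
  have "f -` A = g ` A"
    using fg gf by (auto simp: image_iff) metis
  moreover have "norm (g x - g y) \<le> (1 / L) * norm (x - y)" for x y
    using f[of "g x" "g y"] fg \<open>L > 0\<close> by simp
  ultimately have "hausdorff_outer s (f -` A) \<le> ennreal ((1 / L) ^ s) * hausdorff_outer s A"
    using hausdorff_outer_lipschitz[of "1 / L" A g s] \<open>L > 0\<close> by simp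
  then have "ennreal (L ^ s) * hausdorff_outer s (f -` A)
      \<le> ennreal (L ^ s) * (ennreal ((1 / L) ^ s) * hausdorff_outer s A)"
    by (rule mult_left_mono) simp
  also have "\<dots> = hausdorff_outer s A"
    using \<open>L > 0\<close>
    by (simp add: mult.assoc[symmetric] ennreal_mult[symmetric] power_mult_distrib[symmetric])
  finally show "ennreal (L ^ s) * hausdorff_outer s (f -` A) \<le> hausdorff_outer s A" .
  have "f ` (f -` A) = A"
    using fg by (auto simp: image_iff) metis
  then show "hausdorff_outer s A \<le> ennreal (L ^ s) * hausdorff_outer s (f -` A)"
    using hausdorff_outer_lipschitz[of L "f -` A" f s] f \<open>L > 0\<close> by simp
qed

lemma hausdorff_outer_vimage_add:
  fixes v :: "'a::real_normed_vector"
  shows "hausdorff_outer s ((\<lambda>x. x + v) -` A) = hausdorff_outer s A"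
  using hausdorff_outer_similarity[of "\<lambda>x. x + v" "\<lambda>x. x - v" 1 s A] by simp

lemma hausdorff_premeasure_finite_cover:
  assumes "finite P" "A \<subseteq> (\<Union>p\<in>P. U p)" "\<And>p. p \<in> P \<Longrightarrow> bounded (U p) \<and> diameter (U p) \<le> \<delta>" "\<delta> > 0"
  shows "hausdorff_premeasure s \<delta> A \<le> (\<Sum>p\<in>P. hausdorff_cost s (U p))"
proof -
  obtain h where h: "bij_betw h {0..<card P} P"
    using ex_bij_betw_nat_finite[OF assms(1)] by blast
  define V where "V i = (if i < card P then U (h i) else {})" for i
  have hP: "h i \<in> P" if "i < card P" for i
    using bij_betwE[OF h] that by auto
  have "delta_cover \<delta> A V"
    unfolding delta_cover_def
  proof (intro conjI allI subsetI)
    fix x assume "x \<in> A"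
    then obtain p where "p \<in> P" "x \<in> U p" using assms(2) by blast
    moreover obtain i where "i < card P" "p = h i"
      using \<open>p \<in> P\<close> bij_betw_imp_surj_on[OF h] by (metis atLeastLessThan_iff imageE)
    ultimately have "x \<in> V i" by (simp add: V_def)
    then show "x \<in> (\<Union>i. V i)" by blast
  next
    show "bounded (V i)" "diameter (V i) \<le> \<delta>" for i
      using assms(3)[OF hP, of i] assms(4) by (auto simp: V_def)
  qed
  then have "hausdorff_premeasure s \<delta> A \<le> (\<Sum>i. hausdorff_cost s (V i))"
    by (rule hausdorff_premeasure_le)
  also have "\<dots> = (\<Sum>i\<in>{0..<card P}. hausdorff_cost s (V i))"
    by (rule suminf_finite) (auto simp: V_def)
  also have "\<dots> = (\<Sum>i\<in>{0..<card P}. hausdorff_cost s (U (h i)))"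
    by (intro sum.cong) (auto simp: V_def)
  also have "\<dots> = (\<Sum>p\<in>P. hausdorff_cost s (U p))"
    by (rule sum.reindex_bij_betw[OF h])
  finally show ?thesis .
qed

text \<open>A grid of mesh \<open>1 / k\<close> gives \<open>k ^ (DIM('a) - 1)\<close> cells of
  diameter at most \<open>DIM('a) / k\<close>, by the l1 norm. Their total cost does not depend on
  \<open>k\<close>, which bounds the premeasure at every scale.\<close>

lemma hausdorff_outer_hyperplane_cube:
  fixes b :: "'a::euclidean_space"
  assumes b: "b \<in> Basis"
  shows "hausdorff_outer (DIM('a) - 1) {z. z \<bullet> b = 0 \<and> (\<forall>i\<in>Basis - {b}. 0 \<le> z \<bullet> i \<and> z \<bullet> i < 1)} < top"
    (is "hausdorff_outer ?s ?Q < top")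
proof -
  define C where "C = unit_ball_vol (real ?s) * (real DIM('a) / 2) ^ ?s"
  have "hausdorff_outer ?s ?Q \<le> ennreal C"
  proof (rule hausdorff_outer_least)
    fix \<delta> :: real assume "\<delta> > 0"
    obtain k :: nat where k: "real k > real DIM('a) / \<delta>"
      using reals_Archimedean2 by blast
    moreover have "real DIM('a) / \<delta> > 0" using \<open>\<delta> > 0\<close> by simp
    ultimately have k0: "k > 0" by (metis gr0I of_nat_0 less_asym)
    have kd: "real DIM('a) / real k \<le> \<delta>"
      using k k0 \<open>\<delta> > 0\<close> by (simp add: field_simps)
    define P where "P = (PiE (Basis - {b}) (\<lambda>_. {..<k}) :: ('a \<Rightarrow> nat) set)"
    have finP: "finite P" by (auto simp: P_def intro!: finite_PiE)
    have cardP: "card P = k ^ ?s"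
      using b by (simp add: P_def card_PiE card_Diff_singleton)
    define U where "U p = {z. z \<bullet> b = 0 \<and> (\<forall>i\<in>Basis - {b}.
        real (p i) / real k \<le> z \<bullet> i \<and> z \<bullet> i \<le> (real (p i) + 1) / real k)}" for p
    have U_dist: "norm (x - y) \<le> real DIM('a) / real k" if "x \<in> U p" "y \<in> U p" for x y p
    proof -
      have "\<bar>(x - y) \<bullet> i\<bar> \<le> 1 / real k" if "i \<in> Basis" for i
      proof (cases "i = b")
        case False
        with that have "i \<in> Basis - {b}" by simp
        then have "real (p i) / real k \<le> x \<bullet> i" "x \<bullet> i \<le> (real (p i) + 1) / real k"
          "real (p i) / real k \<le> y \<bullet> i" "y \<bullet> i \<le> (real (p i) + 1) / real k"
          using \<open>x \<in> U p\<close> \<open>y \<in> U p\<close> by (auto simp: U_def)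
        then show ?thesis by (simp add: inner_diff_left add_divide_distrib abs_le_iff)
      qed (use \<open>x \<in> U p\<close> \<open>y \<in> U p\<close> in \<open>simp add: U_def inner_diff_left\<close>)
      then have "(\<Sum>i\<in>Basis. \<bar>(x - y) \<bullet> i\<bar>) \<le> (\<Sum>i\<in>(Basis::'a set). 1 / real k)"
        by (intro sum_mono)
      then show ?thesis
        using norm_le_l1[of "x - y"] by simp
    qed
    have U_bd: "bounded (U p)" for p
      unfolding bounded_two_points dist_norm using U_dist[of _ p] by blast
    have U_diam: "diameter (U p) \<le> real DIM('a) / real k" for p
      using U_dist[of _ p] by (intro diameter_le) auto
    have cover: "?Q \<subseteq> (\<Union>p\<in>P. U p)"
    proof
      fix z assume z: "z \<in> ?Q"
      define p where "p i = (if i \<in> Basis - {b} then nat \<lfloor>real k * (z \<bullet> i)\<rfloor> else undefined)" for i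
      have fl: "real (p i) \<le> real k * (z \<bullet> i)" "real k * (z \<bullet> i) < real (p i) + 1" "p i < k"
        if "i \<in> Basis - {b}" for i
      proof -
        have "0 \<le> z \<bullet> i" "z \<bullet> i < 1" using z that by auto
        then have "0 \<le> real k * (z \<bullet> i)" "real k * (z \<bullet> i) < real k"
          using k0 by auto
        then show "real (p i) \<le> real k * (z \<bullet> i)" "real k * (z \<bullet> i) < real (p i) + 1" "p i < k"
          using that unfolding p_def by (auto, linarith+)
      qed
      have "p \<in> P"
        unfolding P_def using fl(3) by (auto simp: PiE_def extensional_def p_def)
      moreover have "z \<in> U p"
      proof -
        have "real (p i) / real k \<le> z \<bullet> i" "z \<bullet> i \<le> (real (p i) + 1) / real k" if "i \<in> Basis - {b}" for i
          using fl(1,2)[OF that] k0 by (auto simp: field_simps)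
        then show ?thesis using z by (auto simp: U_def)
      qed
      ultimately show "z \<in> (\<Union>p\<in>P. U p)" by blast
    qed
    have "hausdorff_premeasure ?s \<delta> ?Q \<le> (\<Sum>p\<in>P. hausdorff_cost ?s (U p))"
      using U_bd U_diam kd \<open>\<delta> > 0\<close>
      by (intro hausdorff_premeasure_finite_cover finP cover) (auto intro: order_trans)
    also have "\<dots> \<le> (\<Sum>p\<in>P. ennreal (unit_ball_vol (real ?s) * (real DIM('a) / real k / 2) ^ ?s))"
      by (intro sum_mono hausdorff_cost_le U_bd U_diam)
    also have "\<dots> = ennreal (real (card P) * (unit_ball_vol (real ?s) * (real DIM('a) / real k / 2) ^ ?s))"
      by (simp add: ennreal_mult ennreal_of_nat_eq_real_of_nat)
    also have "real (card P) * (unit_ball_vol (real ?s) * (real DIM('a) / real k / 2) ^ ?s) = C"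
      using k0 by (simp add: cardP C_def power_divide)
    finally show "hausdorff_premeasure ?s \<delta> ?Q \<le> ennreal C" .
  qed
  then show ?thesis
    by (meson ennreal_less_top le_less_trans)
qed

lemma hausdorff_outer_hyperplane_bounded:
  fixes b :: "'a::euclidean_space"
  assumes b: "b \<in> Basis"
  shows "hausdorff_outer (DIM('a) - 1) (cball 0 r \<inter> {z. b \<bullet> z = 0}) < top"
proof -
  let ?s = "DIM('a) - 1"
  define Q where "Q = {z::'a. z \<bullet> b = 0 \<and> (\<forall>i\<in>Basis - {b}. 0 \<le> z \<bullet> i \<and> z \<bullet> i < 1)}"
  \<comment> \<open>The half-open unit cube, scaled by \<open>L\<close> and shifted by
    \<open>c\<close>, has to contain all coordinates from \<open>- r\<close> to \<open>r\<close>;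
    the summand 1 makes the upper bound strict and \<open>L\<close> positive.\<close>
  define L where "L = 2 * \<bar>r\<bar> + 1"
  have L: "L > 0" by (simp add: L_def)
  define c where "c = (\<Sum>i\<in>Basis - {b}. \<bar>r\<bar> *\<^sub>R i)"
  have c: "c \<bullet> i = (if i = b then 0 else \<bar>r\<bar>)" if "i \<in> Basis" for i
    using that by (simp add: c_def inner_sum_left inner_Basis if_distrib sum.delta cong: if_cong)
  define f where "f z = L *\<^sub>R z - c" for z
  have "cball 0 r \<inter> {z. b \<bullet> z = 0} \<subseteq> f ` Q"
  proof
    fix z :: 'a assume z: "z \<in> cball 0 r \<inter> {z. b \<bullet> z = 0}"
    define y where "y = (1 / L) *\<^sub>R (z + c)"
    have "y \<in> Q"
    proof -
      have "0 \<le> y \<bullet> i \<and> y \<bullet> i < 1" if "i \<in> Basis - {b}" for i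
      proof -
        have "\<bar>z \<bullet> i\<bar> \<le> r" using z Basis_le_norm[of i z] that by auto
        then have "0 \<le> z \<bullet> i + \<bar>r\<bar>" "z \<bullet> i + \<bar>r\<bar> < L" by (auto simp: L_def)
        then show ?thesis using that L by (simp add: y_def inner_add_left c)
      qed
      moreover have "z \<bullet> b = 0" using z by (simp add: inner_commute)
      then have "y \<bullet> b = 0" using b by (simp add: y_def inner_add_left c)
      ultimately show ?thesis by (simp add: Q_def)
    qed
    moreover have "z = f y" using L by (simp add: f_def y_def)
    ultimately show "z \<in> f ` Q" by blast
  qed
  then have "hausdorff_outer ?s (cball 0 r \<inter> {z. b \<bullet> z = 0}) \<le> hausdorff_outer ?s (f ` Q)"
    by (rule hausdorff_outer_mono)
  also have "\<dots> \<le> ennreal (L ^ ?s) * hausdorff_outer ?s Q"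
  proof (rule hausdorff_outer_lipschitz[OF L])
    show "norm (f x - f y) \<le> L * norm (x - y)" for x y
      using L by (simp add: f_def scaleR_diff_right[symmetric])
  qed
  also have "\<dots> < top"
    using hausdorff_outer_hyperplane_cube[OF b] by (simp add: Q_def ennreal_mult_less_top)
  finally show ?thesis .
qed

text \<open>For a unit vector \<open>u\<close>, the volume of the cone with apex 0 over
  \<open>B + u\<close>, regarded as a measure in \<open>B\<close>. Subtracting \<open>u\<close>
  moves the base from the affine hyperplane at height 1 to the linear one, on which translations
  act.\<close>

definition hyperplane_cone_measure :: "'a::euclidean_space \<Rightarrow> 'a measure" where
  "hyperplane_cone_measure u =
     distr (density lborel (indicator {x. 0 < u \<bullet> x \<and> u \<bullet> x \<le> 1})) borel (\<lambda>x. x /\<^sub>R (u \<bullet> x) - u)"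

lemma sets_hyperplane_cone_measure [measurable_cong, simp]:
  "sets (hyperplane_cone_measure u) = sets borel"
  by (simp add: hyperplane_cone_measure_def)

lemma emeasure_hyperplane_cone_measure:
  assumes [measurable]: "B \<in> sets borel"
  shows "emeasure (hyperplane_cone_measure u) B =
    emeasure lborel {x. 0 < u \<bullet> x \<and> u \<bullet> x \<le> 1 \<and> x /\<^sub>R (u \<bullet> x) - u \<in> B}"
proof -
  have [measurable]: "{x. 0 < u \<bullet> x \<and> u \<bullet> x \<le> 1} \<in> sets borel" by measurable
  have *: "(\<lambda>x. x /\<^sub>R (u \<bullet> x) - u) -` B \<in> sets borel"
    using measurable_sets_borel[of "\<lambda>x. x /\<^sub>R (u \<bullet> x) - u" borel B] by simp
  have "emeasure (hyperplane_cone_measure u) B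
      = (\<integral>\<^sup>+x. indicator {x. 0 < u \<bullet> x \<and> u \<bullet> x \<le> 1} x
          * indicator ((\<lambda>x. x /\<^sub>R (u \<bullet> x) - u) -` B) x \<partial>lborel)"
    using * by (simp add: hyperplane_cone_measure_def emeasure_distr emeasure_density)
  also have "\<dots> = (\<integral>\<^sup>+x. indicator {x. 0 < u \<bullet> x \<and> u \<bullet> x \<le> 1 \<and> x /\<^sub>R (u \<bullet> x) - u \<in> B} x \<partial>lborel)"
    by (intro nn_integral_cong) (auto simp: indicator_def)
  also have "\<dots> = emeasure lborel {x. 0 < u \<bullet> x \<and> u \<bullet> x \<le> 1 \<and> x /\<^sub>R (u \<bullet> x) - u \<in> B}"
    by (rule nn_integral_indicator) measurable
  finally show ?thesis .
qed

text \<open>A translation of the base by \<open>v\<close> orthogonal to \<open>u\<close> extends to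
  the shear \<open>x + (u \<bullet> x) *\<^sub>R v\<close> of the cone, which preserves
  volume.\<close>

lemma hyperplane_cone_measure_translate:
  assumes B [measurable]: "B \<in> sets borel" and "norm u = 1" "u \<bullet> v = 0"
  shows "emeasure (hyperplane_cone_measure u) ((\<lambda>x. x + v) -` B) = emeasure (hyperplane_cone_measure u) B"
proof -
  let ?X = "{x. 0 < u \<bullet> x \<and> u \<bullet> x \<le> 1 \<and> x /\<^sub>R (u \<bullet> x) - u \<in> B}"
  have "(\<lambda>x. x + v) -` B \<in> sets borel"
    using measurable_sets_borel[of "\<lambda>x. x + v" borel B] by simp
  then have "emeasure (hyperplane_cone_measure u) ((\<lambda>x. x + v) -` B)
      = emeasure lborel {x. 0 < u \<bullet> x \<and> u \<bullet> x \<le> 1 \<and> x /\<^sub>R (u \<bullet> x) - u + v \<in> B}"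
    by (simp add: emeasure_hyperplane_cone_measure)
  also have "{x. 0 < u \<bullet> x \<and> u \<bullet> x \<le> 1 \<and> x /\<^sub>R (u \<bullet> x) - u + v \<in> B}
      = (\<lambda>x. x + (u \<bullet> x) *\<^sub>R v) -` ?X"
    using assms(3) by (auto simp: inner_add_right scaleR_add_right algebra_simps)
  also have "emeasure lborel \<dots> = emeasure lborel ?X"
    using assms by (intro emeasure_lborel_shear) measurable
  finally show ?thesis using B by (simp add: emeasure_hyperplane_cone_measure)
qed

text \<open>A reflection carries the cone over one hyperplane to the cone over the reflected one.
  This transfers the constant of proportionality from a coordinate direction to every other
  direction.\<close>

lemma hyperplane_cone_measure_reflect:
  assumes B [measurable]: "B \<in> sets borel"
  shows "emeasure (hyperplane_cone_measure u) (reflect w -` B)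
       = emeasure (hyperplane_cone_measure (reflect w u)) B"
proof -
  have lin: "linear (reflect w)" by (rule linear_reflect)
  let ?X = "{x. 0 < reflect w u \<bullet> x \<and> reflect w u \<bullet> x \<le> 1 \<and> x /\<^sub>R (reflect w u \<bullet> x) - reflect w u \<in> B}"
  have "reflect w \<in> borel_measurable borel"
    using lin by (intro borel_measurable_continuous_onI linear_continuous_on) (simp add: linear_linear)
  then have "reflect w -` B \<in> sets borel"
    using measurable_sets_borel B by blast
  then have "emeasure (hyperplane_cone_measure u) (reflect w -` B)
      = emeasure lborel {x. 0 < u \<bullet> x \<and> u \<bullet> x \<le> 1 \<and> reflect w (x /\<^sub>R (u \<bullet> x) - u) \<in> B}"
    by (simp add: emeasure_hyperplane_cone_measure)
  also have "{x. 0 < u \<bullet> x \<and> u \<bullet> x \<le> 1 \<and> reflect w (x /\<^sub>R (u \<bullet> x) - u) \<in> B} = reflect w -` ?X"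
    by (auto simp: inner_reflect linear_diff[OF lin] linear_cmul[OF lin])
  also have "emeasure lborel \<dots> = emeasure lborel ?X"
    by (rule emeasure_lborel_reflect) measurable
  finally show ?thesis using B by (simp add: emeasure_hyperplane_cone_measure)
qed

lemma hyperplane_cone_measure_cball_finite:
  assumes "norm u = 1"
  shows "emeasure (hyperplane_cone_measure u) (cball 0 r) < top"
proof -
  let ?X = "{x. 0 < u \<bullet> x \<and> u \<bullet> x \<le> 1 \<and> x /\<^sub>R (u \<bullet> x) - u \<in> cball 0 r}"
  have "norm x \<le> r + 1" if "x \<in> ?X" for x
  proof -
    have "norm (x /\<^sub>R (u \<bullet> x)) \<le> norm (x /\<^sub>R (u \<bullet> x) - u) + norm u"
      by (metis diff_add_cancel norm_triangle_ineq)
    then have *: "norm (x /\<^sub>R (u \<bullet> x)) \<le> r + 1" using that assms by simp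
    have "norm x = (u \<bullet> x) * norm (x /\<^sub>R (u \<bullet> x))" using that by simp
    also have "\<dots> \<le> 1 * (r + 1)" using that * by (intro mult_mono) auto
    finally show ?thesis by simp
  qed
  then have "bounded ?X" unfolding bounded_iff by blast
  then show ?thesis
    by (simp only: emeasure_hyperplane_cone_measure borel_closed closed_cball
        emeasure_lborel_bounded_finite)
qed

lemma hyperplane_cone_measure_cball_pos:
  fixes u :: "'a::euclidean_space"
  assumes "norm u = 1"
  shows "emeasure (hyperplane_cone_measure u) (cball 0 1) > 0"
proof -
  let ?X = "{x. 0 < u \<bullet> x \<and> u \<bullet> x \<le> 1 \<and> x /\<^sub>R (u \<bullet> x) - u \<in> cball 0 1}"
  have uu: "u \<bullet> u = 1" using assms by (simp add: norm_eq_1)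
  \<comment> \<open>On this ball the height \<open>u \<bullet> x\<close> is between
    \<open>5/8\<close> and \<open>7/8\<close>, and the component orthogonal to \<open>u\<close> is
    shorter than \<open>1/4\<close>, so the projected point stays within distance 1 of
    \<open>u\<close>.\<close>
  have "ball ((3/4) *\<^sub>R u) (1/8) \<subseteq> ?X"
  proof
    fix x assume "x \<in> ball ((3/4) *\<^sub>R u) (1/8)"
    define e where "e = x - (3/4) *\<^sub>R u"
    have e: "norm e < 1/8" using \<open>x \<in> _\<close> by (simp add: e_def dist_norm norm_minus_commute)
    have ue: "\<bar>u \<bullet> e\<bar> < 1/8" using Cauchy_Schwarz_ineq2[of u e] e assms by simp
    have ux: "u \<bullet> x = 3/4 + u \<bullet> e" by (simp add: e_def inner_diff_right uu)
    have pos: "u \<bullet> x > 5/8" using ux ue by linarith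
    have "x - (u \<bullet> x) *\<^sub>R u = e - (u \<bullet> e) *\<^sub>R u"
      unfolding ux by (simp only: scaleR_add_left diff_diff_eq[symmetric] e_def[symmetric])
    moreover have "x /\<^sub>R (u \<bullet> x) - u = (x - (u \<bullet> x) *\<^sub>R u) /\<^sub>R (u \<bullet> x)"
      using pos by (simp add: scaleR_diff_right)
    ultimately have "norm (x /\<^sub>R (u \<bullet> x) - u) = inverse (u \<bullet> x) * norm (e - (u \<bullet> e) *\<^sub>R u)"
      using pos by simp
    then have "norm (x /\<^sub>R (u \<bullet> x) - u) = norm (e - (u \<bullet> e) *\<^sub>R u) / (u \<bullet> x)"
      by (simp only: divide_inverse_commute)
    moreover have "norm (e - (u \<bullet> e) *\<^sub>R u) \<le> 5/8"
      using norm_triangle_ineq4[of e "(u \<bullet> e) *\<^sub>R u"] e ue assms by simp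
    ultimately have "norm (x /\<^sub>R (u \<bullet> x) - u) \<le> 1"
      using pos by (simp add: divide_le_eq)
    then show "x \<in> ?X" using pos ux ue by simp
  qed
  moreover have [measurable]: "cball (0::'a) 1 \<in> sets borel" by simp
  ultimately have "emeasure lborel (ball ((3/4) *\<^sub>R u) (1/8)) \<le> emeasure lborel ?X"
    by (intro emeasure_mono) measurable
  moreover have "0 < emeasure lborel (ball ((3/4) *\<^sub>R u) (1/8))"
    by (simp add: emeasure_ball)
  ultimately show ?thesis
    by (simp add: emeasure_hyperplane_cone_measure)
qed

text \<open>A set of diameter \<open>d\<close> lies in the cube of half-side \<open>d\<close> around
  any of its points. Translation moves the cube to the origin, where the cone over it fits into a
  box of height 1 and volume \<open>(2 * d) ^ s\<close> with \<open>s = DIM('a) - 1\<close>;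
  comparison with the cost \<open>unit_ball_vol s * (d / 2) ^ s\<close> produces the
  constant.\<close>

lemma hyperplane_cone_measure_le_cost:
  fixes b :: "'a::euclidean_space"
  assumes b: "b \<in> Basis" and U: "bounded U" "U \<subseteq> {z. b \<bullet> z = 0}"
  obtains V where "V \<in> sets borel" "U \<subseteq> V"
    "emeasure (hyperplane_cone_measure b) V
      \<le> ennreal (4 ^ (DIM('a) - 1) / unit_ball_vol (real (DIM('a) - 1))) * hausdorff_cost (DIM('a) - 1) U"
proof (cases "U = {}")
  case False
  then obtain x where x: "x \<in> U" by blast
  let ?s = "DIM('a) - 1"
  define d where "d = diameter U"
  have d: "d \<ge> 0" using U(1) by (simp add: d_def diameter_ge_0)
  define W where "W = {z::'a. \<forall>i\<in>Basis. \<bar>z \<bullet> i\<bar> \<le> d}"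
  have "W = (\<Inter>i\<in>Basis. {z. \<bar>z \<bullet> i\<bar> \<le> d})" by (auto simp: W_def)
  then have "closed W"
    by (auto intro!: closed_INT closed_Collect_le continuous_intros)
  then have W [measurable]: "W \<in> sets borel" by (rule borel_closed)
  define V where "V = (\<lambda>z. z + - x) -` W"
  have V: "V \<in> sets borel"
    using measurable_sets_borel[of "\<lambda>z. z + - x" borel W] W by (simp add: V_def)
  have "U \<subseteq> V"
  proof
    fix z assume "z \<in> U"
    then have "norm (z - x) \<le> d"
      using diameter_bounded_bound[OF U(1), of z x] x by (simp add: d_def dist_norm)
    then show "z \<in> V"
      unfolding V_def W_def using Basis_le_norm[of _ "z - x"] by (fastforce intro: order_trans)
  qed
  have nb: "norm b = 1" using b by simp
  have "emeasure (hyperplane_cone_measure b) V = emeasure (hyperplane_cone_measure b) W"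
    unfolding V_def using x U(2) by (intro hyperplane_cone_measure_translate W nb) auto
  also have "\<dots> = emeasure lborel {y. 0 < b \<bullet> y \<and> b \<bullet> y \<le> 1 \<and> y /\<^sub>R (b \<bullet> y) - b \<in> W}"
    by (rule emeasure_hyperplane_cone_measure) fact
  also have "\<dots> \<le> emeasure lborel (cbox (\<Sum>i\<in>Basis. (if i = b then 0 else - d) *\<^sub>R i)
                                       (\<Sum>i\<in>Basis. (if i = b then 1 else d) *\<^sub>R i))"
  proof (intro emeasure_mono subsetI)
    fix y assume y: "y \<in> {y. 0 < b \<bullet> y \<and> b \<bullet> y \<le> 1 \<and> y /\<^sub>R (b \<bullet> y) - b \<in> W}"
    have "- d \<le> y \<bullet> i \<and> y \<bullet> i \<le> d" if i: "i \<in> Basis" "i \<noteq> b" for i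
    proof -
      have "(y /\<^sub>R (b \<bullet> y) - b) \<bullet> i = (y \<bullet> i) / (b \<bullet> y)"
        using i b by (simp add: inner_diff_left inner_Basis divide_inverse mult.commute)
      then have "\<bar>(y \<bullet> i) / (b \<bullet> y)\<bar> \<le> d"
        using y i by (auto simp: W_def)
      then have "\<bar>y \<bullet> i\<bar> \<le> d * (b \<bullet> y)"
        using y by (simp add: pos_divide_le_eq)
      also have "\<dots> \<le> d" using y d by (simp add: mult_left_le)
      finally show ?thesis by linarith
    qed
    then show "y \<in> cbox (\<Sum>i\<in>Basis. (if i = b then 0 else - d) *\<^sub>R i)
                         (\<Sum>i\<in>Basis. (if i = b then 1 else d) *\<^sub>R i)"
      using y b by (auto simp: mem_box inner_commute[of b])
  qed simp
  also have "\<dots> = ennreal (\<Prod>i\<in>Basis. if i = b then 1 else 2 * d)"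
    using d by (subst emeasure_lborel_cbox) (auto intro!: arg_cong[of _ _ ennreal] prod.cong simp: inner_diff_left)
  also have "(\<Prod>i\<in>Basis. if i = b then 1 else 2 * d) = (2 * d) ^ ?s"
    using b by (simp add: prod.remove[of Basis b] card_Diff_singleton)
  also have "(2 * d) ^ ?s = (4 ^ ?s / unit_ball_vol (real ?s)) * (unit_ball_vol (real ?s) * (d / 2) ^ ?s)"
  proof -
    have "unit_ball_vol (real ?s) \<noteq> 0" by (metis of_nat_0_le_iff less_irrefl unit_ball_vol_pos)
    moreover have "(2 * d) ^ ?s = (4 * (d / 2)) ^ ?s" by simp
    ultimately show ?thesis unfolding power_mult_distrib by simp
  qed
  also have "ennreal \<dots> = ennreal (4 ^ ?s / unit_ball_vol (real ?s)) * hausdorff_cost ?s U"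
    using False by (subst ennreal_mult) (auto simp: hausdorff_cost_def d_def d[unfolded d_def])
  finally show thesis
    using that V \<open>U \<subseteq> V\<close> by blast
next
  case True
  then show thesis using that[of "{}"] by simp
qed

text \<open>Sums the previous estimate over a cover. Its purpose is to show that Hausdorff measure
  does not vanish on the hyperplane, so that the factor of proportionality is finite.\<close>

lemma hyperplane_cone_measure_le_hausdorff:
  fixes b :: "'a::euclidean_space"
  assumes b: "b \<in> Basis" and B: "B \<in> sets borel" "B \<subseteq> {z. b \<bullet> z = 0}"
  shows "emeasure (hyperplane_cone_measure b) B
    \<le> ennreal (4 ^ (DIM('a) - 1) / unit_ball_vol (real (DIM('a) - 1))) * hausdorff_outer (DIM('a) - 1) B"
proof -
  let ?s = "DIM('a) - 1"
  define c where "c = 4 ^ ?s / unit_ball_vol (real ?s)"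
  have c: "c > 0" by (simp add: c_def)
  have "emeasure (hyperplane_cone_measure b) B / ennreal c \<le> hausdorff_premeasure ?s 1 B"
  proof (rule hausdorff_premeasure_greatest)
    fix U assume U: "delta_cover 1 B U"
    have "\<exists>V. V \<in> sets borel \<and> U i \<inter> {z. b \<bullet> z = 0} \<subseteq> V \<and>
        emeasure (hyperplane_cone_measure b) V \<le> ennreal c * hausdorff_cost ?s (U i)" for i
    proof -
      have bd: "bounded (U i)" using U by (simp add: delta_cover_def)
      obtain V where V: "V \<in> sets borel" "U i \<inter> {z. b \<bullet> z = 0} \<subseteq> V"
        "emeasure (hyperplane_cone_measure b) V \<le> ennreal c * hausdorff_cost ?s (U i \<inter> {z. b \<bullet> z = 0})"
        unfolding c_def
        by (rule hyperplane_cone_measure_le_cost[OF b bounded_subset[OF bd Int_lower1] Int_lower2])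
      moreover have "ennreal c * hausdorff_cost ?s (U i \<inter> {z. b \<bullet> z = 0}) \<le> ennreal c * hausdorff_cost ?s (U i)"
        by (intro mult_left_mono hausdorff_cost_mono bd) auto
      ultimately show ?thesis by (meson order_trans)
    qed
    then obtain V where V: "\<And>i. V i \<in> sets borel" "\<And>i. U i \<inter> {z. b \<bullet> z = 0} \<subseteq> V i"
      "\<And>i. emeasure (hyperplane_cone_measure b) (V i) \<le> ennreal c * hausdorff_cost ?s (U i)"
      by metis
    have "B \<subseteq> (\<Union>i. V i)"
      using U B(2) V(2) unfolding delta_cover_def by blast
    then have "emeasure (hyperplane_cone_measure b) B \<le> emeasure (hyperplane_cone_measure b) (\<Union>i. V i)"
      using V(1) by (intro emeasure_mono) auto
    also have "\<dots> \<le> (\<Sum>i. emeasure (hyperplane_cone_measure b) (V i))"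
      using V(1) by (intro emeasure_subadditive_countably) auto
    also have "\<dots> \<le> (\<Sum>i. ennreal c * hausdorff_cost ?s (U i))"
      by (intro suminf_le V(3)) auto
    finally show "emeasure (hyperplane_cone_measure b) B / ennreal c \<le> (\<Sum>i. hausdorff_cost ?s (U i))"
      using c by (intro divide_le_posI_ennreal) auto
  qed
  also have "\<dots> \<le> hausdorff_outer ?s B" by (rule hausdorff_premeasure_le_outer) simp
  finally have "ennreal c * (emeasure (hyperplane_cone_measure b) B / ennreal c) \<le> ennreal c * hausdorff_outer ?s B"
    by (rule mult_left_mono) simp
  then show ?thesis
    unfolding c_def[symmetric]
    using c by (simp add: ennreal_times_divide mult.commute[of "ennreal c"] ennreal_mult_divide_eq)
qed

lemma hyperplane_cone_measure_AE:
  assumes "norm u = 1"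
  shows "AE z in hyperplane_cone_measure u. z \<in> {z. u \<bullet> z = 0}"
proof (rule AE_I')
  have "{z. u \<bullet> z \<noteq> 0} \<in> sets borel" by measurable
  moreover have "{x. 0 < u \<bullet> x \<and> u \<bullet> x \<le> 1 \<and> x /\<^sub>R (u \<bullet> x) - u \<in> {z. u \<bullet> z \<noteq> 0}} = {}"
    using assms by (auto simp: inner_diff_right norm_eq_1)
  ultimately show "{z. u \<bullet> z \<noteq> 0} \<in> null_sets (hyperplane_cone_measure u)"
    by (simp only: null_sets_def mem_Collect_eq sets_hyperplane_cone_measure
        emeasure_hyperplane_cone_measure emeasure_empty)
qed auto

text \<open>On the hyperplane both measures are finite on balls and invariant under its
  translations. The unit ball is the symmetric reference set; its mass is positive and finite for
  both, which makes \<open>\<kappa>\<close> a positive real.\<close>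

lemma hyperplane_cone_measure_proportional_Basis:
  fixes b :: "'a::euclidean_space"
  assumes b: "b \<in> Basis"
  obtains \<kappa> :: real where "\<kappa> > 0"
    "\<And>A. A \<in> sets borel \<Longrightarrow> A \<subseteq> {z. b \<bullet> z = 0} \<Longrightarrow>
       emeasure (hyperplane_cone_measure b) A = ennreal \<kappa> * hausdorff_outer (DIM('a) - 1) A"
proof -
  let ?s = "DIM('a) - 1"
  let ?N = "hyperplane_cone_measure b"
  define S where "S = {z. b \<bullet> z = 0}"
  have nb: "norm b = 1" using b by simp
  have S [measurable]: "S \<in> sets borel" unfolding S_def by measurable
  \<comment> \<open>Hausdorff measure is restricted by an indicator density, because on the whole
    space it is not sigma finite in this dimension.\<close>
  define M where "M = density (hausdorff_measure ?s :: 'a measure) (indicator S)"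
  have sets_M: "sets M = sets borel" by (simp add: M_def)
  have M: "emeasure M A = hausdorff_outer ?s (A \<inter> S)" if "A \<in> sets borel" for A
  proof -
    have "emeasure M A = (\<integral>\<^sup>+x. indicator S x * indicator A x \<partial>hausdorff_measure ?s)"
      using that unfolding M_def by (subst emeasure_density) auto
    also have "\<dots> = (\<integral>\<^sup>+x. indicator (A \<inter> S) x \<partial>hausdorff_measure ?s)"
      by (intro nn_integral_cong) (auto simp: indicator_def)
    also have "\<dots> = hausdorff_outer ?s (A \<inter> S)"
      using that by (subst nn_integral_indicator) (auto simp: emeasure_hausdorff_measure)
    finally show ?thesis .
  qed
  have scale: "emeasure M A * emeasure ?N (cball 0 1) = emeasure ?N A * emeasure M (cball 0 1)"
    if A: "A \<in> sets borel" for A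
  proof (rule translation_invariant_measures_proportional[of _ _ S])
    show "sigma_finite_measure M" "sigma_finite_measure ?N"
      using hausdorff_outer_hyperplane_bounded[OF b] hyperplane_cone_measure_cball_finite[OF nb]
      by (auto intro!: sigma_finite_measure_cball simp: M S_def sets_M)
    show "subspace S" unfolding S_def by (rule subspace_hyperplane)
    show "AE x in ?N. x \<in> S" unfolding S_def by (rule hyperplane_cone_measure_AE[OF nb])
    show "AE x in M. x \<in> S"
      unfolding M_def by (subst AE_density) (auto simp: indicator_def)
    fix v and A :: "'a set" assume v: "v \<in> S" and A: "A \<in> sets borel"
    then show "emeasure ?N ((\<lambda>x. x + v) -` A) = emeasure ?N A"
      using nb by (intro hyperplane_cone_measure_translate) (auto simp: S_def)
    have "(\<lambda>x. x + v) -` A \<in> sets borel"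
      using measurable_sets_borel[of "\<lambda>x. x + v" borel A] A by simp
    moreover have "(\<lambda>x. x + v) -` A \<inter> S = (\<lambda>x. x + v) -` (A \<inter> S)"
      using v by (auto simp: S_def inner_add_right)
    ultimately show "emeasure M ((\<lambda>x. x + v) -` A) = emeasure M A"
      using A by (simp add: M hausdorff_outer_vimage_add del: vimage_Int)
  qed (use A in \<open>auto simp: M_def\<close>)
  let ?B = "cball (0::'a) 1"
  have N_AE: "emeasure ?N (?B \<inter> S) = emeasure ?N ?B"
    using hyperplane_cone_measure_AE[OF nb] by (intro emeasure_eq_AE) (auto simp: S_def)
  have "emeasure ?N ?B \<le> ennreal (4 ^ ?s / unit_ball_vol (real ?s)) * emeasure M ?B"
    using hyperplane_cone_measure_le_hausdorff[OF b, of "?B \<inter> S"] by (simp add: M N_AE S_def[symmetric])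
  moreover have N_pos: "emeasure ?N ?B > 0" by (rule hyperplane_cone_measure_cball_pos[OF nb])
  ultimately have M_pos: "emeasure M ?B \<noteq> 0" by auto
  have M_fin: "emeasure M ?B \<noteq> top" and N_fin: "emeasure ?N ?B \<noteq> top"
    using hausdorff_outer_hyperplane_bounded[OF b, of 1] hyperplane_cone_measure_cball_finite[OF nb, of 1]
    by (auto simp: M S_def)
  obtain m n where mn: "emeasure M ?B = ennreal m" "emeasure ?N ?B = ennreal n" "m > 0" "n > 0"
    using M_pos M_fin N_pos N_fin by (cases "emeasure M ?B"; cases "emeasure ?N ?B") (auto simp: less_le)
  show thesis
  proof (rule that[of "n / m"])
    fix A assume A: "A \<in> sets borel" "A \<subseteq> {z. b \<bullet> z = 0}"
    then have "A \<inter> S = A" by (auto simp: S_def)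
    then have "hausdorff_outer ?s A * ennreal n = emeasure ?N A * ennreal m"
      using scale[OF A(1)] mn A(1) by (simp add: M)
    then have "emeasure ?N A = hausdorff_outer ?s A * ennreal n / ennreal m"
      using mn by (simp add: ennreal_mult_divide_eq)
    also have "\<dots> = ennreal (n / m) * hausdorff_outer ?s A"
      using mn by (simp add: divide_ennreal[symmetric] ennreal_divide_times ennreal_times_divide mult.commute)
    finally show "emeasure ?N A = ennreal (n / m) * hausdorff_outer ?s A" .
  qed (use mn in simp)
qed

lemma emeasure_lborel_vimage_scale:
  fixes A :: "'a::euclidean_space set"
  assumes [measurable]: "A \<in> sets borel" and "c > 0"
  shows "emeasure lborel A = ennreal (c ^ DIM('a)) * emeasure lborel ((\<lambda>x. c *\<^sub>R x) -` A)"
proof -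
  have "(\<lambda>x. c *\<^sub>R x) -` A \<in> sets borel"
    using measurable_sets_borel[of "\<lambda>x. c *\<^sub>R x" borel A] by simp
  moreover have "indicator A (c *\<^sub>R x) = (indicator ((\<lambda>x. c *\<^sub>R x) -` A) x :: ennreal)" for x
    by (simp add: indicator_def)
  ultimately show ?thesis
    using nn_integral_lborel_scale[of "indicator A" c] assms(2) by simp
qed

text \<open>The value of the constant is \<open>1 / DIM('a)\<close>, by the isodiametric inequality.\<close>

lemma emeasure_cone_over_hyperplane:
  obtains \<kappa> :: real where "\<kappa> > 0"
    "\<And>(u::'a::euclidean_space) a B. norm u = 1 \<Longrightarrow> a > 0 \<Longrightarrow> B \<in> sets borel \<Longrightarrow> B \<subseteq> {z. u \<bullet> z = a} \<Longrightarrow>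
       emeasure lborel {x. 0 < u \<bullet> x \<and> u \<bullet> x \<le> a \<and> (a / (u \<bullet> x)) *\<^sub>R x \<in> B}
         = ennreal (a * \<kappa>) * hausdorff_outer (DIM('a) - 1) B"
proof -
  let ?s = "DIM('a) - 1"
  obtain b :: 'a where b: "b \<in> Basis" using nonempty_Basis by blast
  obtain \<kappa> :: real where \<kappa>: "\<kappa> > 0"
    "\<And>A. A \<in> sets borel \<Longrightarrow> A \<subseteq> {z. b \<bullet> z = 0} \<Longrightarrow>
       emeasure (hyperplane_cone_measure b) A = ennreal \<kappa> * hausdorff_outer ?s A"
    using hyperplane_cone_measure_proportional_Basis[OF b] by metis
  have 1: "emeasure (hyperplane_cone_measure u) A = ennreal \<kappa> * hausdorff_outer ?s A"
    if u: "norm u = 1" and A: "A \<in> sets borel" "A \<subseteq> {z. u \<bullet> z = 0}" for u :: 'a and A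
  proof -
    define w where "w = u - b"
    have ub: "reflect w u = b" unfolding w_def using u b by (intro reflect_diff_eq) simp
    have RA: "reflect w -` A \<in> sets borel"
      using linear_reflect[of w] A(1)
      by (intro measurable_sets_borel[of _ borel] borel_measurable_continuous_onI linear_continuous_on)
        (simp_all add: linear_linear)
    have "reflect w -` A \<subseteq> {z. b \<bullet> z = 0}"
    proof
      fix z assume "z \<in> reflect w -` A"
      then have "u \<bullet> reflect w z = 0" using A(2) by auto
      then have "reflect w u \<bullet> reflect w (reflect w z) = 0" by (simp only: inner_reflect)
      then show "z \<in> {z. b \<bullet> z = 0}" by (simp add: ub)
    qed
    then have "emeasure (hyperplane_cone_measure b) (reflect w -` A)
        = ennreal \<kappa> * hausdorff_outer ?s (reflect w -` A)"
      using RA \<kappa>(2) by blast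
    moreover have "hausdorff_outer ?s (reflect w -` A) = hausdorff_outer ?s A"
      using hausdorff_outer_similarity[of "reflect w" "reflect w" 1 ?s A]
      by (simp add: linear_diff[OF linear_reflect, symmetric])
    moreover have "emeasure (hyperplane_cone_measure u) A = emeasure (hyperplane_cone_measure b) (reflect w -` A)"
    proof -
      have "reflect w -` (reflect w -` A) = A" by auto
      then show ?thesis
        using hyperplane_cone_measure_reflect[OF RA, of u w] ub by simp
    qed
    ultimately show ?thesis by simp
  qed
  show thesis
  proof (rule that[OF \<kappa>(1)])
    fix u :: 'a and a :: real and B
    assume u: "norm u = 1" and a: "a > 0" and B [measurable]: "B \<in> sets borel" and BT: "B \<subseteq> {z. u \<bullet> z = a}"
    \<comment> \<open>Maps the linear hyperplane to the affine one at height \<open>a\<close>.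
      Volume scales by \<open>a ^ DIM('a)\<close> and the Hausdorff measure of the base by
      \<open>a ^ (DIM('a) - 1)\<close>, which leaves the factor \<open>a\<close> of the
      statement.\<close>
    define f where "f z = a *\<^sub>R (z + u)" for z
    have uu: "u \<bullet> u = 1" using u by (simp add: norm_eq_1)
    have B': "f -` B \<in> sets borel"
    proof -
      have "f \<in> borel_measurable borel"
        unfolding f_def by measurable
      then show ?thesis using B by (rule measurable_sets_borel)
    qed
    have B'S: "f -` B \<subseteq> {z. u \<bullet> z = 0}"
    proof
      fix z assume "z \<in> f -` B"
      then have "a * (u \<bullet> z + 1) = a * 1"
        using BT uu by (auto simp: f_def inner_add_right)
      then show "z \<in> {z. u \<bullet> z = 0}" using a by simp
    qed
    have "f ((1 / a) *\<^sub>R z - u) = z" "(1 / a) *\<^sub>R f z - u = z" for z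
      using a by (auto simp: f_def)
    moreover have "norm (f x - f y) = a * norm (x - y)" for x y
      using a by (simp add: f_def scaleR_diff_right[symmetric])
    ultimately have sim: "ennreal (a ^ ?s) * hausdorff_outer ?s (f -` B) = hausdorff_outer ?s B"
      using a by (intro hausdorff_outer_similarity[of f "\<lambda>z. (1 / a) *\<^sub>R z - u"])
    let ?X = "{x. 0 < u \<bullet> x \<and> u \<bullet> x \<le> a \<and> (a / (u \<bullet> x)) *\<^sub>R x \<in> B}"
    have "?X \<in> sets borel" by measurable
    then have "emeasure lborel ?X = ennreal (a ^ DIM('a)) * emeasure lborel ((\<lambda>x. a *\<^sub>R x) -` ?X)"
      using a by (intro emeasure_lborel_vimage_scale)
    also have "(\<lambda>x. a *\<^sub>R x) -` ?X = {x. 0 < u \<bullet> x \<and> u \<bullet> x \<le> 1 \<and> x /\<^sub>R (u \<bullet> x) - u \<in> f -` B}"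
    proof -
      have "(a / (u \<bullet> (a *\<^sub>R x))) *\<^sub>R (a *\<^sub>R x) = f (x /\<^sub>R (u \<bullet> x) - u)" for x
      proof -
        have "a / (a * (u \<bullet> x)) * a = a * inverse (u \<bullet> x)"
          using a by (cases "u \<bullet> x = 0") (auto simp: field_simps)
        then show ?thesis by (simp add: f_def)
      qed
      moreover have "0 < u \<bullet> (a *\<^sub>R x) \<longleftrightarrow> 0 < u \<bullet> x" "u \<bullet> (a *\<^sub>R x) \<le> a \<longleftrightarrow> u \<bullet> x \<le> 1" for x
        using a by (auto simp: zero_less_mult_iff)
      ultimately show ?thesis by (simp only: vimage_def mem_Collect_eq)
    qed
    also have "emeasure lborel \<dots> = emeasure (hyperplane_cone_measure u) (f -` B)"
      by (rule emeasure_hyperplane_cone_measure[OF B', symmetric])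
    also have "\<dots> = ennreal \<kappa> * hausdorff_outer ?s (f -` B)"
      by (rule 1[OF u B' B'S])
    also have "ennreal (a ^ DIM('a)) * \<dots> = ennreal (a * \<kappa>) * (ennreal (a ^ ?s) * hausdorff_outer ?s (f -` B))"
    proof -
      have "a ^ DIM('a) * \<kappa> = a * \<kappa> * a ^ ?s"
        by (simp add: power_eq_if[of a "DIM('a)"])
      then have "ennreal (a ^ DIM('a)) * ennreal \<kappa> = ennreal (a * \<kappa>) * ennreal (a ^ ?s)"
        using a \<kappa>(1) by (simp add: ennreal_mult[symmetric])
      then show ?thesis by (simp only: mult.assoc[symmetric])
    qed
    also have "\<dots> = ennreal (a * \<kappa>) * hausdorff_outer ?s B" by (simp only: sim)
    finally show "emeasure lborel ?X = ennreal (a * \<kappa>) * hausdorff_outer ?s B" .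
  qed
qed

subsection \<open>Support functions and gauges\<close>

lemma support_fun_upper:
  assumes "compact K" "y \<in> K"
  shows "u \<bullet> y \<le> support_fun K u"
proof -
  have "bdd_above ((\<lambda>y. u \<bullet> y) ` K)"
    using assms(1) by (intro bounded_imp_bdd_above compact_imp_bounded compact_continuous_image
        continuous_intros)
  then show ?thesis unfolding support_fun_def using assms(2) by (intro cSUP_upper)
qed

lemma support_fun_least:
  assumes "K \<noteq> {}" "\<And>y. y \<in> K \<Longrightarrow> u \<bullet> y \<le> c"
  shows "support_fun K u \<le> c"
  unfolding support_fun_def using assms by (intro cSUP_least)

lemma support_fun_attained:
  fixes K :: "'a::euclidean_space set"
  assumes "compact K" "K \<noteq> {}"
  obtains y where "y \<in> K" "support_fun K u = u \<bullet> y"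
proof -
  have "continuous_on K (\<lambda>y. u \<bullet> y)" by (intro continuous_intros)
  then obtain y where "y \<in> K" "\<forall>z\<in>K. u \<bullet> z \<le> u \<bullet> y"
    using continuous_attains_sup[OF assms] by blast
  then show thesis
    using that[of y] support_fun_upper[OF assms(1), of y u] support_fun_least[OF assms(2), of u "u \<bullet> y"]
    by (metis order_antisym)
qed

lemma support_fun_scaleR:
  fixes K :: "'a::euclidean_space set"
  assumes "compact K" "K \<noteq> {}" "c \<ge> 0"
  shows "support_fun K (c *\<^sub>R u) = c * support_fun K u"
proof (rule antisym)
  show "support_fun K (c *\<^sub>R u) \<le> c * support_fun K u"
    using assms support_fun_upper[OF assms(1)] by (intro support_fun_least) (auto intro: mult_left_mono)
  obtain y where "y \<in> K" "support_fun K u = u \<bullet> y"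
    by (rule support_fun_attained[OF assms(1,2)])
  then show "c * support_fun K u \<le> support_fun K (c *\<^sub>R u)"
    using support_fun_upper[OF assms(1), of y "c *\<^sub>R u"] by simp
qed

lemma support_fun_add:
  fixes K :: "'a::euclidean_space set"
  assumes "compact K" "K \<noteq> {}"
  shows "support_fun K (u + v) \<le> support_fun K u + support_fun K v"
  using assms support_fun_upper[OF assms(1)]
  by (intro support_fun_least) (auto simp: inner_add_left intro: add_mono)

lemma support_fun_le_norm:
  fixes K :: "'a::euclidean_space set"
  assumes "K \<noteq> {}" "\<And>y. y \<in> K \<Longrightarrow> norm y \<le> B"
  shows "support_fun K u \<le> B * norm u"
proof (rule support_fun_least[OF assms(1)])
  fix y assume "y \<in> K"
  then have "norm u * norm y \<le> norm u * B"
    by (intro mult_left_mono assms(2)) auto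
  then show "u \<bullet> y \<le> B * norm u"
    using norm_cauchy_schwarz[of u y] by (simp add: mult.commute)
qed

text \<open>Sublinearity makes the support function Lipschitz, with any radius of a ball around the
  origin containing \<open>K\<close> as its constant.\<close>

lemma continuous_on_support_fun:
  fixes K :: "'a::euclidean_space set"
  assumes "compact K" "K \<noteq> {}"
  shows "continuous_on A (support_fun K)"
proof -
  obtain B where B: "B > 0" "\<And>y. y \<in> K \<Longrightarrow> norm y \<le> B"
    using compact_imp_bounded[OF assms(1)] unfolding bounded_pos by blast
  have *: "support_fun K u - support_fun K v \<le> B * norm (u - v)" for u v
    using support_fun_add[OF assms, of v "u - v"] support_fun_le_norm[OF assms(2) B(2), of "u - v"] by simp
  have "dist (support_fun K u) (support_fun K v) \<le> B * dist u v" for u v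
    using *[of u v] *[of v u] by (simp add: dist_real_def dist_norm norm_minus_commute abs_le_iff)
  then have "B-lipschitz_on A (support_fun K)"
    using B(1) by (intro lipschitz_onI) auto
  then show ?thesis by (rule lipschitz_on_continuous_on)
qed

section \<open>Polar set, gauge and radial projection\<close>

definition polar_set :: "'a::euclidean_space set \<Rightarrow> 'a set" where
  "polar_set K = {v. \<forall>y\<in>K. v \<bullet> y \<le> 1}"

text \<open>The gauge as support function of the polar set, so that continuity, homogeneity and a
  maximizing vector come from the facts on support functions.\<close>

definition minkowski_gauge :: "'a::euclidean_space set \<Rightarrow> 'a \<Rightarrow> real" where
  "minkowski_gauge K = support_fun (polar_set K)"

text \<open>Central projection to the boundary; the origin, where the gauge is 0, is sent to 0 by
  \<open>inverse 0 = 0\<close>.\<close>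

definition radial_proj :: "'a::euclidean_space set \<Rightarrow> 'a \<Rightarrow> 'a" where
  "radial_proj K x = x /\<^sub>R minkowski_gauge K x"

text \<open>The Gauss map extended by 0 to the whole space, which makes it a Borel function.\<close>

definition normal_field :: "'a::euclidean_space set \<Rightarrow> 'a \<Rightarrow> 'a" where
  "normal_field K y = indicator (gauss_domain K) y *\<^sub>R gauss_map K y"

text \<open>The cone-volume measure of \<open>K\<close>: a set of boundary points gets the volume of
  the part of \<open>K\<close> on the rays through it.\<close>

definition cone_measure :: "'a::euclidean_space set \<Rightarrow> 'a measure" where
  "cone_measure K = distr (density lborel (indicator K)) borel (radial_proj K)"

locale origin_body =
  fixes K :: "'a::euclidean_space set"
  assumes K: "K \<in> convex_bodies_o"
begin

lemma compact_K: "compact K" and convex_K: "convex K" and zero_interior: "0 \<in> interior K"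
  using K by (auto simp: convex_bodies_o_def convex_body_def)

lemma zero_K: "0 \<in> K"
  using zero_interior interior_subset by blast

lemma K_nonempty: "K \<noteq> {}"
  using zero_K by blast

lemma inner_radius: obtains r where "r > 0" "cball 0 r \<subseteq> K"
  using zero_interior unfolding mem_interior_cball by blast

lemma outer_radius: obtains R where "R > 0" "\<And>y. y \<in> K \<Longrightarrow> norm y \<le> R"
  using compact_imp_bounded[OF compact_K] unfolding bounded_pos by blast

lemma K_borel [measurable]: "K \<in> sets borel"
  using compact_K by (simp add: compact_imp_closed)

lemma support_fun_pos:
  assumes "u \<noteq> 0"
  shows "support_fun K u > 0"
proof -
  obtain r where r: "r > 0" "cball 0 r \<subseteq> K" by (rule inner_radius)
  have "(r / norm u) *\<^sub>R u \<in> K" using r assms by auto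
  then have "u \<bullet> ((r / norm u) *\<^sub>R u) \<le> support_fun K u"
    by (rule support_fun_upper[OF compact_K])
  moreover have "u \<bullet> ((r / norm u) *\<^sub>R u) > 0" using r assms by simp
  ultimately show ?thesis by linarith
qed

lemma support_fun_nonneg: "support_fun K u \<ge> 0"
  using support_fun_upper[OF compact_K zero_K, of u] by simp

lemma zero_polar: "0 \<in> polar_set K"
  by (simp add: polar_set_def)

lemma polar_bound:
  assumes "cball 0 r \<subseteq> K" "r > 0" "v \<in> polar_set K"
  shows "norm v \<le> 1 / r"
proof (cases "v = 0")
  case False
  have "(r / norm v) *\<^sub>R v \<in> K" using assms(1,2) False by auto
  then have "v \<bullet> ((r / norm v) *\<^sub>R v) \<le> 1" using assms(3) unfolding polar_set_def by blast
  then have "(r / norm v) * (norm v * norm v) \<le> 1"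
    by (simp only: inner_scaleR_right dot_square_norm power2_eq_square)
  moreover have "(r / c) * (c * c) = r * c" if "c \<noteq> 0" for c :: real using that by simp
  ultimately have "r * norm v \<le> 1" using False by (metis norm_eq_zero)
  then show ?thesis using assms(2) by (simp add: field_simps)
qed (use assms in simp)

lemma compact_polar: "compact (polar_set K)"
proof -
  have "polar_set K = (\<Inter>y\<in>K. {v. v \<bullet> y \<le> 1})" by (auto simp: polar_set_def)
  then have "closed (polar_set K)"
    by (auto intro!: closed_INT closed_Collect_le continuous_intros)
  moreover have "bounded (polar_set K)"
    using inner_radius polar_bound unfolding bounded_iff by metis
  ultimately show ?thesis by (simp add: compact_eq_bounded_closed)
qed

lemma polar_nonempty: "polar_set K \<noteq> {}"
  using zero_polar by blast

abbreviation "g \<equiv> minkowski_gauge K"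
abbreviation "\<pi> \<equiv> radial_proj K"

lemma continuous_on_gauge: "continuous_on A g"
  unfolding minkowski_gauge_def by (rule continuous_on_support_fun[OF compact_polar polar_nonempty])

lemma gauge_borel [measurable]: "g \<in> borel_measurable borel"
  by (intro borel_measurable_continuous_onI continuous_on_gauge)

lemma radial_proj_borel [measurable]: "\<pi> \<in> borel_measurable borel"
  unfolding radial_proj_def[abs_def] by measurable

lemma gauge_scaleR: "c \<ge> 0 \<Longrightarrow> g (c *\<^sub>R x) = c * g x"
  unfolding minkowski_gauge_def by (rule support_fun_scaleR[OF compact_polar polar_nonempty])

lemma gauge_polar: "v \<in> polar_set K \<Longrightarrow> v \<bullet> x \<le> g x"
  unfolding minkowski_gauge_def using support_fun_upper[OF compact_polar, of v x] by (simp add: inner_commute)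

lemma gauge_attained: obtains v where "v \<in> polar_set K" "g x = v \<bullet> x"
  unfolding minkowski_gauge_def
  using support_fun_attained[OF compact_polar polar_nonempty, of x] by (metis inner_commute)

text \<open>As \<open>K\<close> lies in the ball of radius \<open>R\<close>, the polar set contains
  the ball of radius \<open>1 / R\<close>; its boundary point in the direction of \<open>x\<close>
  gives the bound.\<close>

lemma gauge_ge_norm:
  assumes "\<And>y. y \<in> K \<Longrightarrow> norm y \<le> R" "R > 0"
  shows "norm x \<le> R * g x"
proof (cases "x = 0")
  case True
  then show ?thesis using gauge_scaleR[of 0 0] by simp
next
  case False
  have "(1 / (R * norm x)) *\<^sub>R x \<in> polar_set K"
    unfolding polar_set_def
  proof safe
    fix y assume "y \<in> K"
    have "x \<bullet> y \<le> norm x * R"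
      using norm_cauchy_schwarz[of x y] assms(1)[OF \<open>y \<in> K\<close>] by (meson mult_left_mono norm_ge_zero order_trans)
    then show "((1 / (R * norm x)) *\<^sub>R x) \<bullet> y \<le> 1"
      using False assms(2) by (simp add: divide_le_eq mult.commute)
  qed
  from gauge_polar[OF this, of x] have "norm x / R \<le> g x"
    using False by (simp add: dot_square_norm power2_eq_square)
  then show ?thesis using assms(2) by (simp add: field_simps)
qed

lemma gauge_zero [simp]: "g 0 = 0"
  using gauge_scaleR[of 0 0] by simp

lemma gauge_pos: "x \<noteq> 0 \<Longrightarrow> g x > 0"
proof -
  assume "x \<noteq> 0"
  obtain R where R: "R > 0" "\<And>y. y \<in> K \<Longrightarrow> norm y \<le> R" using outer_radius by blast
  then have "R * g x > 0"
    using gauge_ge_norm[of R x] \<open>x \<noteq> 0\<close> by (meson less_le_trans zero_less_norm_iff)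
  then show ?thesis using R(1) by (simp add: zero_less_mult_iff)
qed

text \<open>The bipolar theorem. A hyperplane \<open>a \<bullet> z = b\<close> separating
  \<open>x\<close> from \<open>K\<close> has \<open>b < 0\<close>, since \<open>K\<close> contains
  0, and dividing by \<open>b\<close> yields a polar vector whose product with \<open>x\<close>
  exceeds 1.\<close>

lemma gauge_le_1_iff: "x \<in> K \<longleftrightarrow> g x \<le> 1"
proof
  assume "x \<in> K"
  then show "g x \<le> 1"
    unfolding minkowski_gauge_def
    by (intro support_fun_least polar_nonempty) (auto simp: polar_set_def inner_commute)
next
  assume le: "g x \<le> 1"
  show "x \<in> K"
  proof (rule ccontr)
    assume "x \<notin> K"
    then obtain a b where ab: "a \<bullet> x < b" "\<And>y. y \<in> K \<Longrightarrow> b < a \<bullet> y"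
      using separating_hyperplane_closed_point[OF convex_K compact_imp_closed[OF compact_K]] by blast
    have b: "b < 0" using ab(2)[OF zero_K] by simp
    have "(1 / b) *\<^sub>R a \<in> polar_set K"
      using ab(2) b by (auto simp: polar_set_def divide_le_eq less_imp_le)
    then have "(1 / b) * (a \<bullet> x) \<le> 1" using gauge_polar[of "(1 / b) *\<^sub>R a" x] le by simp
    then show False using ab(1) b by (simp add: divide_le_eq)
  qed
qed

lemma interior_eq_gauge: "interior K = {x. g x < 1}"
proof
  have "open {x. g x < 1}"
    by (intro open_Collect_less continuous_on_gauge continuous_intros)
  then show "{x. g x < 1} \<subseteq> interior K"
    by (intro interior_maximal) (auto simp: gauge_le_1_iff)
  show "interior K \<subseteq> {x. g x < 1}"
  proof
    fix x assume "x \<in> interior K"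
    then obtain e where e: "e > 0" "cball x e \<subseteq> K" unfolding mem_interior_cball by blast
    show "x \<in> {x. g x < 1}"
    proof (cases "x = 0")
      case False
      \<comment> \<open>Room around \<open>x\<close> allows stretching it by \<open>1 + c\<close>
        within \<open>K\<close>, which forces its gauge below 1.\<close>
      define c where "c = e / norm x"
      have c: "c > 0" using e False by (simp add: c_def)
      have "x + c *\<^sub>R x \<in> cball x e" using e False by (simp add: c_def dist_norm)
      then have "g ((1 + c) *\<^sub>R x) \<le> 1"
        using e(2) by (auto simp: gauge_le_1_iff[symmetric] scaleR_add_left)
      then have "(1 + c) * g x \<le> 1" using c by (simp add: gauge_scaleR)
      moreover have "c * g x > 0" using c gauge_pos[OF False] by simp
      ultimately show ?thesis by (simp add: distrib_right)
    qed simp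
  qed
qed

lemma frontier_eq_gauge: "frontier K = {x. g x = 1}"
  unfolding frontier_def closure_closed[OF compact_imp_closed[OF compact_K]] interior_eq_gauge
  by (auto simp: gauge_le_1_iff)

lemma frontier_subset_K: "frontier K \<subseteq> K"
  by (auto simp: frontier_eq_gauge gauge_le_1_iff)

lemma frontier_nonzero: "y \<in> frontier K \<Longrightarrow> y \<noteq> 0"
  by (auto simp: frontier_eq_gauge)

lemma radial_proj_frontier: "x \<noteq> 0 \<Longrightarrow> \<pi> x \<in> frontier K"
  using gauge_pos[of x] by (simp add: frontier_eq_gauge radial_proj_def gauge_scaleR)

lemma scaleR_radial_proj: "g x *\<^sub>R \<pi> x = x"
  using gauge_pos[of x] by (cases "x = 0") (auto simp: radial_proj_def)

lemma radial_proj_scaleR: "c > 0 \<Longrightarrow> \<pi> (c *\<^sub>R x) = \<pi> x"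
  by (simp add: radial_proj_def gauge_scaleR)

lemma radial_proj_id: "y \<in> frontier K \<Longrightarrow> \<pi> y = y"
  by (simp add: frontier_eq_gauge radial_proj_def)

lemma radial_proj_zero [simp]: "\<pi> 0 = 0"
  by (simp add: radial_proj_def)

subsection \<open>The Gauss map\<close>

lemma normal_support_fun:
  assumes "y \<in> frontier K" "outer_unit_normal K y u"
  shows "support_fun K u = u \<bullet> y"
  using assms frontier_subset_K support_fun_upper[OF compact_K, of y u] support_fun_least[OF K_nonempty, of u "u \<bullet> y"]
  by (auto simp: outer_unit_normal_def intro: antisym)

lemma normal_inner_pos:
  assumes "y \<in> frontier K" "outer_unit_normal K y u"
  shows "u \<bullet> y > 0"
  using normal_support_fun[OF assms] support_fun_pos[of u] assms(2)
  by (cases "u = 0") (auto simp: outer_unit_normal_def)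

text \<open>Scaled to have product 1 with \<open>y\<close>, an outer normal becomes a polar vector
  attaining the gauge at \<open>y\<close>, that is, a subgradient of the gauge.\<close>

lemma normal_polar:
  assumes "y \<in> frontier K" "outer_unit_normal K y u"
  shows "u /\<^sub>R (u \<bullet> y) \<in> polar_set K"
  using normal_inner_pos[OF assms] assms(2)
  by (auto simp: polar_set_def outer_unit_normal_def field_simps)

lemma normal_exists:
  assumes "y \<in> frontier K"
  obtains u where "outer_unit_normal K y u"
proof -
  obtain v where v: "v \<in> polar_set K" "g y = v \<bullet> y" by (rule gauge_attained)
  have "v \<bullet> y = 1" using v assms by (simp add: frontier_eq_gauge)
  then have "v \<noteq> 0" by auto
  then have "outer_unit_normal K y (v /\<^sub>R norm v)"
    using v(1) \<open>v \<bullet> y = 1\<close> by (simp add: outer_unit_normal_def polar_set_def)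
  then show thesis by (rule that)
qed

lemma gauss_map_normal:
  assumes "y \<in> gauss_domain K"
  shows "outer_unit_normal K y (gauss_map K y)" "\<And>u. outer_unit_normal K y u \<Longrightarrow> u = gauss_map K y"
proof -
  have "\<exists>!u. outer_unit_normal K y u" using assms by (simp add: gauss_domain_def)
  then show 1: "outer_unit_normal K y (gauss_map K y)"
    unfolding gauss_map_def by (rule theI')
  show "u = gauss_map K y" if "outer_unit_normal K y u" for u
    using \<open>\<exists>!u. outer_unit_normal K y u\<close> 1 that by blast
qed

lemma gauss_domain_frontier: "y \<in> gauss_domain K \<Longrightarrow> y \<in> frontier K"
  by (simp add: gauss_domain_def)

lemma norm_gauss_map: "y \<in> gauss_domain K \<Longrightarrow> norm (gauss_map K y) = 1"
  using gauss_map_normal(1)[of y] by (simp add: outer_unit_normal_def)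

lemma support_fun_gauss_map:
  "y \<in> gauss_domain K \<Longrightarrow> support_fun K (gauss_map K y) = y \<bullet> gauss_map K y"
  using normal_support_fun[OF gauss_domain_frontier gauss_map_normal(1), of y] by (simp add: inner_commute)

text \<open>The pairs of a boundary point and a normal in \<open>E\<close> form a compact set, of
  which this set is the projection. Continuity of the Gauss map and measurability of its domain both
  rest on it.\<close>

lemma closed_normal_preimage:
  assumes "closed E"
  shows "closed {y \<in> frontier K. \<exists>u\<in>E. outer_unit_normal K y u}"
proof -
  define Z where "Z = (frontier K \<times> (sphere 0 1 \<inter> E)) \<inter> {q. \<forall>x\<in>K. snd q \<bullet> x \<le> snd q \<bullet> fst q}"
  have "{q. \<forall>x\<in>K. snd q \<bullet> x \<le> snd q \<bullet> fst q} = (\<Inter>x\<in>K. {q. snd q \<bullet> x \<le> snd q \<bullet> fst q})"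
    by auto
  then have "closed {q. \<forall>x\<in>K. snd q \<bullet> x \<le> snd q \<bullet> fst q}"
    by (auto intro!: closed_INT closed_Collect_le continuous_intros)
  then have "compact Z"
    unfolding Z_def
    by (intro compact_Int_closed compact_Times compact_frontier compact_K assms compact_sphere)
  then have "compact (fst ` Z)"
    by (intro compact_continuous_image continuous_intros)
  moreover have "fst ` Z = {y \<in> frontier K. \<exists>u\<in>E. outer_unit_normal K y u}"
    by (force simp: Z_def outer_unit_normal_def)
  ultimately show ?thesis by (simp add: compact_imp_closed)
qed

text \<open>Points with a normal at distance at least \<open>\<epsilon>\<close> from
  \<open>gauss_map K y0\<close> form a closed set, which misses \<open>y0\<close> because the normal
  there is unique. The conclusion covers all normals of nearby points, singular ones
  included.\<close>

lemma normal_near: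
  assumes "y0 \<in> gauss_domain K" "\<epsilon> > 0"
  obtains \<delta> where "\<delta> > 0"
    "\<And>y u. y \<in> frontier K \<Longrightarrow> dist y y0 < \<delta> \<Longrightarrow> outer_unit_normal K y u \<Longrightarrow> norm (u - gauss_map K y0) < \<epsilon>"
proof -
  define E where "E = {u. norm (u - gauss_map K y0) \<ge> \<epsilon>}"
  have "closed E" unfolding E_def by (intro closed_Collect_le continuous_intros)
  then have "open (- {y \<in> frontier K. \<exists>u\<in>E. outer_unit_normal K y u})"
    using closed_normal_preimage by blast
  moreover have "y0 \<in> - {y \<in> frontier K. \<exists>u\<in>E. outer_unit_normal K y u}"
    using gauss_map_normal(2)[OF assms(1)] assms(2) by (auto simp: E_def)
  ultimately obtain \<delta> where "\<delta> > 0" "ball y0 \<delta> \<subseteq> - {y \<in> frontier K. \<exists>u\<in>E. outer_unit_normal K y u}"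
    by (meson openE)
  then show thesis
    by (intro that[of \<delta>]) (auto simp: E_def dist_commute subset_iff not_le)
qed

lemma continuous_on_gauss_map: "continuous_on (gauss_domain K) (gauss_map K)"
  unfolding continuous_on_iff
proof safe
  fix y0 and e :: real assume "y0 \<in> gauss_domain K" "e > 0"
  then obtain \<delta> where \<delta>: "\<delta> > 0"
    "\<And>y u. y \<in> frontier K \<Longrightarrow> dist y y0 < \<delta> \<Longrightarrow> outer_unit_normal K y u \<Longrightarrow> norm (u - gauss_map K y0) < e"
    using normal_near by metis
  have "dist (gauss_map K y) (gauss_map K y0) < e" if "y \<in> gauss_domain K" "dist y y0 < \<delta>" for y
    using \<delta>(2)[OF gauss_domain_frontier _ gauss_map_normal(1)] that by (simp add: dist_norm)
  with \<delta>(1) show "\<exists>d>0. \<forall>y\<in>gauss_domain K. dist y y0 < d \<longrightarrow> dist (gauss_map K y) (gauss_map K y0) < e"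
    by blast
qed

lemma countable_Basis_rat_intervals:
  "countable ((Basis :: 'a set) \<times> {(p, q). p \<in> \<rat> \<and> q \<in> \<rat> \<and> p < (q::real)})"
proof -
  have "{(p, q). p \<in> \<rat> \<and> q \<in> \<rat> \<and> p < (q::real)} \<subseteq> \<rat> \<times> \<rat>" by auto
  then have "countable {(p, q). p \<in> \<rat> \<and> q \<in> \<rat> \<and> p < (q::real)}"
    by (rule countable_subset) (intro countable_SIGMA countable_rat)
  then show ?thesis by (intro countable_SIGMA) (auto intro: countable_finite)
qed

lemma two_normals:
  assumes "y \<in> frontier K" "y \<notin> gauss_domain K"
  obtains u1 u2 where "outer_unit_normal K y u1" "outer_unit_normal K y u2" "u1 \<noteq> u2"
  using assms normal_exists[OF assms(1)] unfolding gauss_domain_def by blast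

text \<open>Two normals at one point differ in some coordinate \<open>b\<close>, and rationals
  \<open>p < q\<close> fit between the two values. The singular set is thus a countable union of
  closed sets, one for each triple.\<close>

lemma gauss_domain_borel [measurable]: "gauss_domain K \<in> sets borel"
proof -
  define N where "N E = {y \<in> frontier K. \<exists>u\<in>E. outer_unit_normal K y u}" for E
  define J where "J = (Basis :: 'a set) \<times> {(p, q). p \<in> \<rat> \<and> q \<in> \<rat> \<and> p < (q::real)}"
  define T where "T j = (case j of (b, p, q) \<Rightarrow> N {u. u \<bullet> b \<le> p} \<inter> N {u. u \<bullet> b \<ge> q})" for j :: "'a \<times> real \<times> real"
  have cJ: "countable J"
    unfolding J_def by (rule countable_Basis_rat_intervals)
  have "closed (T j)" for j
  proof -
    obtain b p q where j: "j = (b, p, q)" by (cases j) auto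
    have "closed {u. u \<bullet> b \<le> p}" "closed {u. u \<bullet> b \<ge> q}"
      by (auto intro!: closed_Collect_le continuous_intros)
    then show ?thesis
      unfolding T_def N_def j prod.case by (intro closed_Int closed_normal_preimage)
  qed
  then have "(\<Union>j\<in>J. T j) \<in> sets borel"
    by (intro sets.countable_UN' cJ) auto
  moreover have "gauss_domain K = frontier K - (\<Union>j\<in>J. T j)"
  proof (intro equalityI subsetI)
    fix y assume y: "y \<in> gauss_domain K"
    have "y \<notin> T j" if jJ: "j \<in> J" for j
    proof
      assume yT: "y \<in> T j"
      obtain b p q where j: "j = (b, p, q)" "p < q" using jJ unfolding J_def by (cases j) auto
      obtain u1 u2 where "outer_unit_normal K y u1" "outer_unit_normal K y u2" "u1 \<bullet> b \<le> p" "q \<le> u2 \<bullet> b"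
        using yT unfolding T_def N_def j by auto
      then show False using gauss_map_normal(2)[OF y] j(2) by (metis less_le_trans not_less)
    qed
    then show "y \<in> frontier K - (\<Union>j\<in>J. T j)"
      using gauss_domain_frontier[OF y] by blast
  next
    fix y assume y: "y \<in> frontier K - (\<Union>j\<in>J. T j)"
    show "y \<in> gauss_domain K"
    proof (rule ccontr)
      assume "y \<notin> gauss_domain K"
      then obtain u1 u2 where u: "outer_unit_normal K y u1" "outer_unit_normal K y u2" "u1 \<noteq> u2"
        using two_normals y by blast
      then obtain b where b: "b \<in> Basis" "u1 \<bullet> b \<noteq> u2 \<bullet> b"
        using euclidean_eqI by blast
      have *: False if n: "outer_unit_normal K y v" "outer_unit_normal K y w" "v \<bullet> b < w \<bullet> b" for v w
      proof -
        obtain p where p: "p \<in> \<rat>" "v \<bullet> b < p" "p < w \<bullet> b" using Rats_dense_in_real[OF n(3)] by blast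
        obtain q where q: "q \<in> \<rat>" "p < q" "q < w \<bullet> b" using Rats_dense_in_real[OF p(3)] by blast
        have "(b, p, q) \<in> J" using b p q by (simp add: J_def)
        moreover have "y \<in> T (b, p, q)"
          using n y p q unfolding T_def N_def by (auto intro: less_imp_le)
        ultimately show False using y by blast
      qed
      show False using *[of u1 u2] *[of u2 u1] u b(2) by linarith
    qed
  qed
  ultimately show ?thesis by simp
qed

lemma normal_field_eq: "y \<in> gauss_domain K \<Longrightarrow> normal_field K y = gauss_map K y"
  by (simp add: normal_field_def)

lemma normal_field_borel [measurable]: "normal_field K \<in> borel_measurable borel"
  unfolding normal_field_def[abs_def]
  by (intro borel_measurable_continuous_on_indicator gauss_domain_borel continuous_on_gauss_map)

end

subsection \<open>Singular boundary points\<close>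

text \<open>All translates of \<open>A\<close> along \<open>b\<close> have equal mass, so the mass
  of \<open>A\<close> is its average over \<open>t\<close> in the unit interval. After exchanging
  the integrals, each \<open>x\<close> satisfies \<open>x + t *\<^sub>R b \<in> A\<close> for at
  most one \<open>t\<close>, and a single \<open>t\<close> has measure 0.\<close>

lemma emeasure_lborel_line_singletons:
  fixes A :: "'a::euclidean_space set"
  assumes A [measurable]: "A \<in> sets borel" and one: "\<And>x t. x \<in> A \<Longrightarrow> x + t *\<^sub>R b \<in> A \<Longrightarrow> t = (0::real)"
  shows "emeasure lborel A = 0"
proof -
  have shift: "(\<integral>\<^sup>+x. indicator A (x + t *\<^sub>R b) \<partial>lborel) = emeasure lborel A" for t
  proof -
    have "(\<lambda>x. x + t *\<^sub>R b) -` A \<in> sets borel"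
      using measurable_sets_borel[of "\<lambda>x. x + t *\<^sub>R b" borel A] by simp
    moreover have "indicator A (x + t *\<^sub>R b) = (indicator ((\<lambda>x. x + t *\<^sub>R b) -` A) x :: ennreal)" for x
      by (simp add: indicator_def)
    ultimately show ?thesis
      by (simp add: emeasure_lborel_vimage_add)
  qed
  have "emeasure lborel A = (\<integral>\<^sup>+t. emeasure lborel A * indicator {0..1::real} t \<partial>lborel)"
    by (simp add: nn_integral_cmult_indicator)
  also have "\<dots> = (\<integral>\<^sup>+t. (\<integral>\<^sup>+x. indicator A (x + t *\<^sub>R b) * indicator {0..1} t \<partial>lborel) \<partial>lborel)"
    by (subst nn_integral_multc) (auto simp: shift)
  also have "\<dots> = (\<integral>\<^sup>+x. (\<integral>\<^sup>+t. indicator A (x + t *\<^sub>R b) * indicator {0..1} t \<partial>lborel) \<partial>lborel)"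
    by (rule lborel_pair.Fubini'[of "\<lambda>x t. indicator A (x + t *\<^sub>R b) * indicator {0..1} t"]) measurable
  also have "\<dots> = (\<integral>\<^sup>+(x::'a). 0 \<partial>lborel)"
  proof (rule nn_integral_cong)
    fix x :: 'a
    obtain s where s: "\<And>t. x + t *\<^sub>R b \<in> A \<Longrightarrow> t = s"
    proof (cases "\<exists>t. x + t *\<^sub>R b \<in> A")
      case True
      then obtain s where "x + s *\<^sub>R b \<in> A" by blast
      have "t = s" if "x + t *\<^sub>R b \<in> A" for t
        using one[OF \<open>x + s *\<^sub>R b \<in> A\<close>, of "t - s"] that by (simp add: algebra_simps)
      then show thesis by (rule that)
    qed (use that in blast)
    have "(\<integral>\<^sup>+t. indicator A (x + t *\<^sub>R b) * indicator {0..1} t \<partial>lborel) \<le> (\<integral>\<^sup>+t. indicator {s} t \<partial>lborel)"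
      by (intro nn_integral_mono) (auto simp: indicator_def dest: s)
    then show "(\<integral>\<^sup>+t. indicator A (x + t *\<^sub>R b) * indicator {0..1} t \<partial>lborel) = 0" by simp
  qed
  finally show ?thesis by simp
qed

context origin_body
begin

text \<open>At a singular point the gauge has two subgradients, hence, for some coordinate direction \<open>b\<close>
  and rationals \<open>p < q\<close>, both \<open>p\<close> and \<open>q\<close> are one-dimensional subgradients along \<open>b\<close>. This happens
  at most once on each line parallel to \<open>b\<close>.\<close>

lemma radial_proj_gauss_domain_AE: "AE x in lborel. \<pi> x \<in> gauss_domain K"
proof -
  define J where "J = (Basis :: 'a set) \<times> {(p, q). p \<in> \<rat> \<and> q \<in> \<rat> \<and> p < (q::real)}"
  define T where "T j = (case j of (b, p, q) \<Rightarrow>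
      {x. \<forall>t. g x + t * p \<le> g (x + t *\<^sub>R b) \<and> g x + t * q \<le> g (x + t *\<^sub>R b)})" for j :: "'a \<times> real \<times> real"
  have cJ: "countable J"
    unfolding J_def by (rule countable_Basis_rat_intervals)
  have "T j \<in> null_sets lborel" if jJ: "j \<in> J" for j
  proof -
    obtain b p q where j: "j = (b, p, q)" "p < q" using jJ unfolding J_def by (cases j) auto
    have gc: "continuous_on UNIV (\<lambda>x. g (x + c))" for c
      by (intro continuous_on_compose2[OF continuous_on_gauge[of UNIV]] continuous_intros) auto
    have "T j = (\<Inter>t. {x. g x + t * p \<le> g (x + t *\<^sub>R b)} \<inter> {x. g x + t * q \<le> g (x + t *\<^sub>R b)})"
      by (auto simp: T_def j)
    then have "closed (T j)"
      by (auto intro!: closed_INT closed_Int closed_Collect_le gc continuous_on_gauge continuous_intros)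
    then have "T j \<in> sets borel" by simp
    moreover have "t = 0" if "x \<in> T j" "x + t *\<^sub>R b \<in> T j" for x t
    proof -
      have 1: "g x + t * p \<le> g (x + t *\<^sub>R b)" "g x + t * q \<le> g (x + t *\<^sub>R b)"
        using that(1) by (auto simp: T_def j)
      have "g (x + t *\<^sub>R b) + (- t) * p \<le> g (x + t *\<^sub>R b + (- t) *\<^sub>R b)"
        "g (x + t *\<^sub>R b) + (- t) * q \<le> g (x + t *\<^sub>R b + (- t) *\<^sub>R b)"
        using that(2) unfolding T_def j by blast+
      then have "g (x + t *\<^sub>R b) - t * p \<le> g x" "g (x + t *\<^sub>R b) - t * q \<le> g x" by simp_all
      with 1 have "t * p = t * q" by linarith
      then show ?thesis using j(2) by simp
    qed
    ultimately show ?thesis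
      using emeasure_lborel_line_singletons[of "T j" b] by (auto simp: null_sets_def)
  qed
  then have null: "(\<Union>j\<in>J. T j) \<in> null_sets lborel"
    by (intro null_sets_UN' cJ)
  have sub: "x \<in> (\<Union>j\<in>J. T j)" if x: "x \<noteq> 0" "\<pi> x \<notin> gauss_domain K" for x
  proof -
    define y where "y = \<pi> x"
    have y: "y \<in> frontier K" using x radial_proj_frontier by (simp add: y_def)
    obtain u1 u2 where u: "outer_unit_normal K y u1" "outer_unit_normal K y u2" "u1 \<noteq> u2"
      using two_normals[OF y] x by (auto simp: y_def)
    define v1 where "v1 = u1 /\<^sub>R (u1 \<bullet> y)"
    define v2 where "v2 = u2 /\<^sub>R (u2 \<bullet> y)"
    have pos: "u1 \<bullet> y > 0" "u2 \<bullet> y > 0" using normal_inner_pos[OF y] u by auto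
    \<comment> \<open>The length of \<open>v1\<close> recovers \<open>u1 \<bullet> y\<close>, so
      different normals cannot lead to the same scaled vector.\<close>
    have norm_v: "norm v1 = inverse (u1 \<bullet> y)" "norm v2 = inverse (u2 \<bullet> y)"
      using u pos by (auto simp: v1_def v2_def outer_unit_normal_def)
    have "v1 \<noteq> v2"
    proof
      assume "v1 = v2"
      then have "u1 \<bullet> y = u2 \<bullet> y" using norm_v by simp
      then show False using \<open>v1 = v2\<close> u(3) pos by (simp add: v1_def v2_def)
    qed
    then obtain b where b: "b \<in> Basis" "v1 \<bullet> b \<noteq> v2 \<bullet> b"
      using euclidean_eqI by blast
    have sg: "g x + t * (v1 \<bullet> b) \<le> g (x + t *\<^sub>R b)" "g x + t * (v2 \<bullet> b) \<le> g (x + t *\<^sub>R b)" for t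
    proof -
      have xy: "x = g x *\<^sub>R y" by (simp add: y_def scaleR_radial_proj)
      have "v1 \<bullet> y = 1" "v2 \<bullet> y = 1" using pos by (auto simp: v1_def v2_def)
      then have "v1 \<bullet> x = g x" "v2 \<bullet> x = g x" by (metis xy inner_scaleR_right mult.right_neutral)+
      then show "g x + t * (v1 \<bullet> b) \<le> g (x + t *\<^sub>R b)" "g x + t * (v2 \<bullet> b) \<le> g (x + t *\<^sub>R b)"
        using gauge_polar[OF normal_polar[OF y u(1)], of "x + t *\<^sub>R b"]
          gauge_polar[OF normal_polar[OF y u(2)], of "x + t *\<^sub>R b"]
        unfolding v1_def[symmetric] v2_def[symmetric] by (simp_all add: inner_add_right)
    qed
    define m where "m = min (v1 \<bullet> b) (v2 \<bullet> b)"
    define M where "M = max (v1 \<bullet> b) (v2 \<bullet> b)"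
    have "m < M" using b(2) by (auto simp: m_def M_def)
    obtain p where p: "p \<in> \<rat>" "m < p" "p < M" using Rats_dense_in_real[OF \<open>m < M\<close>] by blast
    obtain q where q: "q \<in> \<rat>" "p < q" "q < M" using Rats_dense_in_real[OF p(3)] by blast
    have mM: "g x + t * m \<le> g (x + t *\<^sub>R b)" "g x + t * M \<le> g (x + t *\<^sub>R b)" for t
      using sg[of t] by (auto simp: m_def M_def min_def max_def)
    \<comment> \<open>The one-dimensional subgradients along \<open>b\<close> form an interval, so
      every value between \<open>m\<close> and \<open>M\<close> is one, in particular
      \<open>p\<close> and \<open>q\<close>.\<close>
    have between: "g x + t * r \<le> g (x + t *\<^sub>R b)" if "m < r" "r < M" for r t
    proof (cases "t \<ge> 0")
      case True
      then have "t * r \<le> t * M" using that by (intro mult_left_mono) auto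
      then show ?thesis using mM(2)[of t] by linarith
    next
      case False
      then have "t * r \<le> t * m" using that by (intro mult_left_mono_neg) auto
      then show ?thesis using mM(1)[of t] by linarith
    qed
    have "(b, p, q) \<in> J" using b(1) p(1) q(1,2) by (simp add: J_def)
    moreover have "x \<in> T (b, p, q)" using between p q by (simp add: T_def)
    ultimately show ?thesis by blast
  qed
  \<comment> \<open>The origin is added because it has no radial projection to the boundary.\<close>
  have "{0} \<union> (\<Union>j\<in>J. T j) \<in> null_sets lborel"
    using null by (intro null_sets.Un) auto
  then show ?thesis
    by (rule AE_I') (use sub in auto)
qed

end

subsection \<open>The cone measure and Hausdorff measure\<close>

text \<open>The constant is kept as an abstract number with its characteristic property; the type
  argument fixes the dimension. One \<open>\<kappa>\<close> serves all bodies, directions and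
  heights.\<close>

definition cone_constant :: "'a::euclidean_space itself \<Rightarrow> real \<Rightarrow> bool" where
  "cone_constant T \<kappa> \<longleftrightarrow> \<kappa> > 0 \<and>
     (\<forall>(u::'a) a B. norm u = 1 \<longrightarrow> a > 0 \<longrightarrow> B \<in> sets borel \<longrightarrow> B \<subseteq> {z. u \<bullet> z = a} \<longrightarrow>
       emeasure lborel {x. 0 < u \<bullet> x \<and> u \<bullet> x \<le> a \<and> (a / (u \<bullet> x)) *\<^sub>R x \<in> B}
         = ennreal (a * \<kappa>) * hausdorff_outer (DIM('a) - 1) B)"

lemma cone_constant_exists:
  obtains \<kappa> where "cone_constant TYPE('a::euclidean_space) \<kappa>"
proof (rule emeasure_cone_over_hyperplane[where 'a='a])
  fix \<kappa> :: real
  assume "\<kappa> > 0"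
    "\<And>(u::'a) a B. norm u = 1 \<Longrightarrow> a > 0 \<Longrightarrow> B \<in> sets borel \<Longrightarrow> B \<subseteq> {z. u \<bullet> z = a} \<Longrightarrow>
       emeasure lborel {x. 0 < u \<bullet> x \<and> u \<bullet> x \<le> a \<and> (a / (u \<bullet> x)) *\<^sub>R x \<in> B}
         = ennreal (a * \<kappa>) * hausdorff_outer (DIM('a) - 1) B"
  then have "cone_constant TYPE('a) \<kappa>" by (simp add: cone_constant_def)
  then show thesis by (rule that)
qed

context origin_body
begin

lemma sets_cone_measure [measurable_cong, simp]: "sets (cone_measure K) = sets borel"
  by (simp add: cone_measure_def)

lemma nn_integral_cone_measure:
  assumes [measurable]: "f \<in> borel_measurable borel"
  shows "(\<integral>\<^sup>+y. f y \<partial>cone_measure K) = (\<integral>\<^sup>+x. indicator K x * f (\<pi> x) \<partial>lborel)"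
  by (simp add: cone_measure_def nn_integral_distr nn_integral_density)

lemma emeasure_cone_measure:
  assumes [measurable]: "A \<in> sets borel"
  shows "emeasure (cone_measure K) A = emeasure lborel {x \<in> K. \<pi> x \<in> A}"
proof -
  have "emeasure (cone_measure K) A = (\<integral>\<^sup>+y. indicator A y \<partial>cone_measure K)"
    by simp
  also have "\<dots> = (\<integral>\<^sup>+x. indicator K x * indicator A (\<pi> x) \<partial>lborel)"
    by (rule nn_integral_cone_measure) measurable
  also have "\<dots> = (\<integral>\<^sup>+x. indicator {x \<in> K. \<pi> x \<in> A} x \<partial>lborel)"
    by (intro nn_integral_cong) (auto simp: indicator_def)
  also have "\<dots> = emeasure lborel {x \<in> K. \<pi> x \<in> A}"
    by (rule nn_integral_indicator) measurable
  finally show ?thesis .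
qed

text \<open>Near a point with normal \<open>u\<close> all normals are close to \<open>u\<close>; together with the convexity
  inequality \<open>u' \<bullet> (y' - y) \<le> 0\<close> this makes \<open>u\<close> almost constant along the boundary, so the central
  projection to the tangent hyperplane at that point is nearly isometric.\<close>

lemma tangent_projection_near:
  assumes y0: "y0 \<in> gauss_domain K" and \<eta>: "\<eta> > 1"
  defines "u \<equiv> gauss_map K y0"
  defines "a \<equiv> u \<bullet> y0"
  obtains \<delta> where "\<delta> > 0"
    "\<And>y. y \<in> frontier K \<Longrightarrow> dist y y0 < \<delta> \<Longrightarrow> u \<bullet> y > 0 \<and> u \<bullet> y \<le> a \<and> a \<le> \<eta> * (u \<bullet> y)"
    "\<And>y y'. y \<in> frontier K \<Longrightarrow> dist y y0 < \<delta> \<Longrightarrow> y' \<in> frontier K \<Longrightarrow> dist y' y0 < \<delta> \<Longrightarrow>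
       norm ((a / (u \<bullet> y)) *\<^sub>R y - (a / (u \<bullet> y')) *\<^sub>R y') \<le> \<eta> * norm (y - y')
       \<and> norm (y - y') \<le> \<eta> * norm ((a / (u \<bullet> y)) *\<^sub>R y - (a / (u \<bullet> y')) *\<^sub>R y')"
    "\<And>y. y \<in> gauss_domain K \<Longrightarrow> dist y y0 < \<delta> \<Longrightarrow>
       y \<bullet> gauss_map K y \<le> \<eta> * a \<and> a \<le> \<eta> * (y \<bullet> gauss_map K y)"
proof -
  have fr0: "y0 \<in> frontier K" by (rule gauss_domain_frontier[OF y0])
  have nu: "outer_unit_normal K y0 u" unfolding u_def by (rule gauss_map_normal(1)[OF y0])
  have a: "a > 0" unfolding a_def by (rule normal_inner_pos[OF fr0 nu])
  have le_a: "u \<bullet> y \<le> a" if "y \<in> frontier K" for y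
    using nu that frontier_subset_K by (auto simp: outer_unit_normal_def a_def)
  obtain R where R: "R > 0" "\<And>y. y \<in> K \<Longrightarrow> norm y \<le> R" using outer_radius by blast
  \<comment> \<open>\<open>\<zeta>\<close> bounds the scale factors
    \<open>a / (u \<bullet> y)\<close>; the gap between \<open>\<zeta>\<close> and
    \<open>\<eta>\<close> is left for the error caused by their variation.\<close>
  define \<zeta> where "\<zeta> = (1 + \<eta>) / 2"
  have \<zeta>: "1 < \<zeta>" "\<zeta> < \<eta>" using \<eta> by (auto simp: \<zeta>_def)
  define c where "c = R * \<zeta>\<^sup>2 / a"
  have c: "c > 0" using R a \<zeta> by (simp add: c_def)
  \<comment> \<open>\<open>c * \<epsilon>\<close> is the relative error from varying scale factors.
    The two entries of the minimum are what the bounds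
    \<open>\<zeta> + c * \<epsilon> \<le> \<eta>\<close> and
    \<open>1 - c * \<epsilon> \<ge> 1 / \<eta>\<close> allow for it.\<close>
  define \<epsilon> where "\<epsilon> = min (\<eta> - \<zeta>) (1 - 1 / \<eta>) / c"
  have "min (\<eta> - \<zeta>) (1 - 1 / \<eta>) > 0" using \<eta> \<zeta> by simp
  then have \<epsilon>: "\<epsilon> > 0" "c * \<epsilon> \<le> \<eta> - \<zeta>" "c * \<epsilon> \<le> 1 - 1 / \<eta>"
    using c by (auto simp: \<epsilon>_def)
  obtain \<delta>1 where \<delta>1: "\<delta>1 > 0"
    "\<And>y v. y \<in> frontier K \<Longrightarrow> dist y y0 < \<delta>1 \<Longrightarrow> outer_unit_normal K y v \<Longrightarrow> norm (v - u) < \<epsilon>"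
    unfolding u_def using normal_near[OF y0 \<epsilon>(1)] by metis
  have "continuous_on UNIV (\<lambda>y. u \<bullet> y)" by (intro continuous_intros)
  moreover have "a - a / \<zeta> > 0" using a \<zeta> by (simp add: field_simps)
  ultimately obtain \<delta>2 where \<delta>2: "\<delta>2 > 0" "\<And>y. dist y y0 < \<delta>2 \<Longrightarrow> dist (u \<bullet> y) (u \<bullet> y0) < a - a / \<zeta>"
    unfolding continuous_on_iff by blast
  have "continuous_on (gauss_domain K) (\<lambda>y. y \<bullet> gauss_map K y)"
    by (intro continuous_intros continuous_on_gauss_map)
  moreover have "a - a / \<eta> > 0" using a \<eta> by (simp add: field_simps)
  ultimately obtain \<delta>3 where \<delta>3: "\<delta>3 > 0"
    "\<And>y. y \<in> gauss_domain K \<Longrightarrow> dist y y0 < \<delta>3 \<Longrightarrow> dist (y \<bullet> gauss_map K y) (y0 \<bullet> u) < a - a / \<eta>"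
    unfolding continuous_on_iff u_def using y0 by blast
  define \<delta> where "\<delta> = min \<delta>1 (min \<delta>2 \<delta>3)"
  have uy: "u \<bullet> y > 0 \<and> a \<le> \<zeta> * (u \<bullet> y)" if "dist y y0 < \<delta>" for y
  proof -
    have "\<bar>u \<bullet> y - a\<bar> < a - a / \<zeta>"
      using \<delta>2(2)[of y] that by (simp add: \<delta>_def dist_real_def a_def)
    then have "u \<bullet> y > a / \<zeta>" by linarith
    moreover have "a / \<zeta> > 0" using a \<zeta> by simp
    ultimately have "u \<bullet> y > 0" by linarith
    then show ?thesis using \<zeta> \<open>u \<bullet> y > a / \<zeta>\<close> by (simp add: field_simps)
  qed
  have flat: "u \<bullet> (y' - y) \<le> \<epsilon> * norm (y' - y)"
    if "y \<in> frontier K" "dist y y0 < \<delta>" "y' \<in> frontier K" for y y'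
  proof -
    obtain v where v: "outer_unit_normal K y v" using normal_exists \<open>y \<in> frontier K\<close> by blast
    have "norm (v - u) < \<epsilon>" using \<delta>1(2)[OF that(1) _ v] that(2) by (simp add: \<delta>_def)
    then have "norm (u - v) * norm (y' - y) \<le> \<epsilon> * norm (y' - y)"
      by (intro mult_right_mono) (auto simp: norm_minus_commute)
    moreover have "(u - v) \<bullet> (y' - y) \<le> norm (u - v) * norm (y' - y)" by (rule norm_cauchy_schwarz)
    moreover have "v \<bullet> (y' - y) \<le> 0"
      using v that(3) frontier_subset_K by (auto simp: outer_unit_normal_def inner_diff_right)
    moreover have "u \<bullet> (y' - y) = v \<bullet> (y' - y) + (u - v) \<bullet> (y' - y)" by (simp add: inner_diff_left)
    ultimately show ?thesis by linarith
  qed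
  show thesis
  proof (rule that)
    show "\<delta> > 0" using \<delta>1 \<delta>2 \<delta>3 by (simp add: \<delta>_def)
    show "u \<bullet> y > 0 \<and> u \<bullet> y \<le> a \<and> a \<le> \<eta> * (u \<bullet> y)" if "y \<in> frontier K" "dist y y0 < \<delta>" for y
    proof -
      have "\<zeta> * (u \<bullet> y) \<le> \<eta> * (u \<bullet> y)" using uy[OF that(2)] \<zeta> by (intro mult_right_mono) auto
      then show ?thesis using uy[OF that(2)] le_a[OF that(1)] by linarith
    qed
    show "y \<bullet> gauss_map K y \<le> \<eta> * a \<and> a \<le> \<eta> * (y \<bullet> gauss_map K y)"
      if "y \<in> gauss_domain K" "dist y y0 < \<delta>" for y
    proof -
      have "\<bar>y \<bullet> gauss_map K y - a\<bar> < a - a / \<eta>"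
        using \<delta>3(2)[of y] that by (simp add: \<delta>_def dist_real_def a_def inner_commute)
      then have b: "y \<bullet> gauss_map K y > a / \<eta>" "y \<bullet> gauss_map K y < 2 * a - a / \<eta>" by linarith+
      \<comment> \<open>The margin \<open>a - a / \<eta>\<close> around \<open>a\<close> is made for
        the lower bound; this inequality shows that it serves for the upper bound too.\<close>
      have "2 - 1 / \<eta> \<le> \<eta>"
      proof -
        have "0 \<le> (\<eta> - 1)\<^sup>2 / \<eta>" using \<eta> by simp
        also have "(\<eta> - 1)\<^sup>2 / \<eta> = \<eta> - 2 + 1 / \<eta>"
          using \<eta> by (simp add: power2_eq_square field_simps)
        finally show ?thesis by simp
      qed
      then have "(2 - 1 / \<eta>) * a \<le> \<eta> * a" using a by (intro mult_right_mono) auto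
      moreover have "(2 - 1 / \<eta>) * a = 2 * a - a / \<eta>" by (simp add: left_diff_distrib)
      moreover have "a \<le> \<eta> * (y \<bullet> gauss_map K y)" using b(1) \<eta> by (simp add: field_simps)
      ultimately show ?thesis using b(2) by linarith
    qed
    show "norm ((a / (u \<bullet> y)) *\<^sub>R y - (a / (u \<bullet> y')) *\<^sub>R y') \<le> \<eta> * norm (y - y')
       \<and> norm (y - y') \<le> \<eta> * norm ((a / (u \<bullet> y)) *\<^sub>R y - (a / (u \<bullet> y')) *\<^sub>R y')"
      if y: "y \<in> frontier K" "dist y y0 < \<delta>" and y': "y' \<in> frontier K" "dist y' y0 < \<delta>" for y y'
    proof -
      define s t d where "s = u \<bullet> y" and "t = u \<bullet> y'" and "d = norm (y - y')"
      have s: "s > 0" "s \<le> a" "a \<le> \<zeta> * s" using uy[OF y(2)] le_a[OF y(1)] by (auto simp: s_def)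
      have t: "t > 0" "t \<le> a" "a \<le> \<zeta> * t" using uy[OF y'(2)] le_a[OF y'(1)] by (auto simp: t_def)
      \<comment> \<open>\<open>flat\<close> is used in both directions, each of the two points
        supplying the normal once.\<close>
      have st: "\<bar>t - s\<bar> \<le> \<epsilon> * d"
        using flat[OF y y'(1)] flat[OF y' y(1)]
        by (simp add: s_def t_def d_def inner_diff_right norm_minus_commute abs_le_iff)
      \<comment> \<open>The displacement is the scaled difference
        \<open>(a / s) *\<^sub>R (y - y')\<close> plus \<open>w\<close>, which collects the
        difference of the two scale factors.\<close>
      define w where "w = ((a / s) - (a / t)) *\<^sub>R y'"
      have split: "(a / s) *\<^sub>R y - (a / t) *\<^sub>R y' = (a / s) *\<^sub>R (y - y') + w"
        by (simp add: w_def algebra_simps)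
      have as: "1 \<le> a / s" "a / s \<le> \<zeta>" and at: "a / t \<le> \<zeta>"
        using s t by (auto simp: field_simps)
      have w: "norm w \<le> c * \<epsilon> * d"
      proof -
        have "(a / s) - (a / t) = (a / s) * (a / t) * (t - s) / a"
          using s t a by (simp add: field_simps)
        then have "norm w = (a / s) * (a / t) * \<bar>t - s\<bar> / a * norm y'"
          using s t a by (simp add: w_def abs_mult)
        also have "\<dots> \<le> \<zeta> * \<zeta> * (\<epsilon> * d) / a * R"
          using as at st s t a \<zeta> \<epsilon> R y' frontier_subset_K
          by (intro mult_mono divide_right_mono) (auto simp: d_def)
        also have "\<dots> = c * \<epsilon> * d" by (simp add: c_def power2_eq_square)
        finally show ?thesis .
      qed
      have d0: "d \<ge> 0" by (simp add: d_def)
      have main: "norm ((a / s) *\<^sub>R (y - y')) = (a / s) * d" using s a by (simp add: d_def)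
      have "norm ((a / s) *\<^sub>R y - (a / t) *\<^sub>R y') \<le> (a / s) * d + c * \<epsilon> * d"
        unfolding split using norm_triangle_ineq[of "(a / s) *\<^sub>R (y - y')" w] main w by linarith
      also have "\<dots> = (a / s + c * \<epsilon>) * d" by (simp add: distrib_right)
      also have "\<dots> \<le> \<eta> * d" using as \<epsilon> d0 by (intro mult_right_mono) auto
      finally have up: "norm ((a / s) *\<^sub>R y - (a / t) *\<^sub>R y') \<le> \<eta> * d" .
      have "(1 / \<eta>) * d \<le> (a / s - c * \<epsilon>) * d" using as \<epsilon> d0 by (intro mult_right_mono) auto
      also have "\<dots> = (a / s) * d - c * \<epsilon> * d" by (simp add: left_diff_distrib)
      also have "\<dots> \<le> norm ((a / s) *\<^sub>R y - (a / t) *\<^sub>R y')"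
        unfolding split using norm_diff_ineq[of "(a / s) *\<^sub>R (y - y')" w] main w by linarith
      finally have "d \<le> \<eta> * norm ((a / s) *\<^sub>R y - (a / t) *\<^sub>R y')"
        using \<eta> by (simp add: field_simps)
      with up show ?thesis by (simp add: s_def t_def d_def)
    qed
  qed
qed

text \<open>A boundary element at \<open>y\<close> spans a cone of height
  \<open>y \<bullet> normal_field K y\<close>, whence this density. It is the form that
  \<open>cone_measure\<close> is shown to have.\<close>

definition surface_measure :: "real \<Rightarrow> 'a measure" where
  "surface_measure \<kappa> = density (hausdorff_measure (DIM('a) - 1))
     (\<lambda>y. ennreal \<kappa> * indicator (gauss_domain K) y * ennreal (y \<bullet> normal_field K y))"

lemma sets_surface_measure [measurable_cong, simp]: "sets (surface_measure \<kappa>) = sets borel"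
  by (simp add: surface_measure_def)

lemma emeasure_surface_measure:
  assumes [measurable]: "A \<in> sets borel"
  shows "emeasure (surface_measure \<kappa>) A = (\<integral>\<^sup>+y. ennreal \<kappa> * indicator (gauss_domain K) y
    * ennreal (y \<bullet> normal_field K y) * indicator A y \<partial>hausdorff_measure (DIM('a) - 1))"
  unfolding surface_measure_def by (subst emeasure_density) auto

text \<open>Where the height agrees with \<open>a\<close> up to the factor \<open>\<eta>\<close>,
  the density may be treated as the constant \<open>a * \<kappa>\<close>.\<close>

lemma surface_measure_bounds:
  assumes "\<kappa> > 0" and A [measurable]: "A \<in> sets borel" and sub: "A \<subseteq> gauss_domain K"
    and a: "a > 0" "\<eta> > 0"
    and bnd: "\<And>y. y \<in> A \<Longrightarrow> y \<bullet> gauss_map K y \<le> \<eta> * a \<and> a \<le> \<eta> * (y \<bullet> gauss_map K y)"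
  shows "emeasure (surface_measure \<kappa>) A \<le> ennreal \<eta> * (ennreal (a * \<kappa>) * hausdorff_outer (DIM('a) - 1) A)"
    and "ennreal (a * \<kappa>) * hausdorff_outer (DIM('a) - 1) A \<le> ennreal \<eta> * emeasure (surface_measure \<kappa>) A"
proof -
  let ?H = "hausdorff_measure (DIM('a) - 1) :: 'a measure"
  have int: "(\<integral>\<^sup>+y. ennreal c * indicator A y \<partial>?H) = ennreal c * hausdorff_outer (DIM('a) - 1) A" for c
    by (subst nn_integral_cmult_indicator) (auto simp: emeasure_hausdorff_measure)
  have "emeasure (surface_measure \<kappa>) A \<le> (\<integral>\<^sup>+y. ennreal (\<eta> * (a * \<kappa>)) * indicator A y \<partial>?H)"
    unfolding emeasure_surface_measure[OF A]
  proof (rule nn_integral_mono)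
    fix y
    show "ennreal \<kappa> * indicator (gauss_domain K) y * ennreal (y \<bullet> normal_field K y) * indicator A y
        \<le> ennreal (\<eta> * (a * \<kappa>)) * indicator A y"
    proof (cases "y \<in> A")
      case True
      have "\<kappa> * (y \<bullet> gauss_map K y) \<le> \<kappa> * (\<eta> * a)"
        using bnd[OF True] assms(1) by (intro mult_left_mono) auto
      then have "ennreal (\<kappa> * (y \<bullet> gauss_map K y)) \<le> ennreal (\<eta> * (a * \<kappa>))"
        by (intro ennreal_leI) (simp add: mult_ac)
      then show ?thesis
        using True sub assms(1) by (auto simp: normal_field_eq ennreal_mult'[symmetric])
    qed simp
  qed
  then show "emeasure (surface_measure \<kappa>) A \<le> ennreal \<eta> * (ennreal (a * \<kappa>) * hausdorff_outer (DIM('a) - 1) A)"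
    using a assms(1) unfolding int by (simp add: ennreal_mult mult.assoc)
  have "(\<integral>\<^sup>+y. ennreal (a * \<kappa>) * indicator A y \<partial>?H)
      \<le> (\<integral>\<^sup>+y. ennreal \<eta> * (ennreal \<kappa> * indicator (gauss_domain K) y * ennreal (y \<bullet> normal_field K y) * indicator A y) \<partial>?H)"
  proof (rule nn_integral_mono)
    fix y
    show "ennreal (a * \<kappa>) * indicator A y
        \<le> ennreal \<eta> * (ennreal \<kappa> * indicator (gauss_domain K) y * ennreal (y \<bullet> normal_field K y) * indicator A y)"
    proof (cases "y \<in> A")
      case True
      have "\<kappa> * a \<le> \<kappa> * (\<eta> * (y \<bullet> gauss_map K y))"
        using bnd[OF True] assms(1) by (intro mult_left_mono) auto
      then have "ennreal (a * \<kappa>) \<le> ennreal (\<eta> * (\<kappa> * (y \<bullet> gauss_map K y)))"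
        by (intro ennreal_leI) (simp add: mult_ac)
      also have "\<dots> = ennreal \<eta> * (ennreal \<kappa> * ennreal (y \<bullet> gauss_map K y))"
        using a assms(1) by (simp add: ennreal_mult')
      finally show ?thesis
        using True sub by (auto simp: normal_field_eq)
    qed simp
  qed
  then show "ennreal (a * \<kappa>) * hausdorff_outer (DIM('a) - 1) A \<le> ennreal \<eta> * emeasure (surface_measure \<kappa>) A"
    unfolding int emeasure_surface_measure[OF A] by (subst (asm) nn_integral_cmult) auto
qed

text \<open>The set \<open>A\<close> is projected centrally to the tangent hyperplane at
  \<open>y0\<close>, where the volume of the cone over the image \<open>B\<close> is known exactly.
  The part of \<open>K\<close> on the rays through \<open>A\<close> lies inside this cone and,
  enlarged by \<open>\<eta>\<close>, contains it. The powers of \<open>\<eta>\<close> come from the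
  bi-Lipschitz projection, with exponent \<open>DIM('a) - 1\<close>, and from the dilation, with
  exponent \<open>DIM('a)\<close>.\<close>

lemma cone_measure_hausdorff_bounds:
  assumes \<kappa>: "cone_constant TYPE('a) \<kappa>" and y0: "y0 \<in> gauss_domain K" and \<eta>: "\<eta> > 1"
  defines "a \<equiv> gauss_map K y0 \<bullet> y0"
  obtains U where "open U" "y0 \<in> U"
    "\<And>A. A \<in> sets borel \<Longrightarrow> A \<subseteq> U \<inter> frontier K \<Longrightarrow>
       emeasure (cone_measure K) A \<le> ennreal (\<eta> ^ (DIM('a) - 1)) * (ennreal (a * \<kappa>) * hausdorff_outer (DIM('a) - 1) A)
       \<and> ennreal (a * \<kappa>) * hausdorff_outer (DIM('a) - 1) A
           \<le> ennreal (\<eta> ^ (DIM('a) - 1)) * (ennreal (\<eta> ^ DIM('a)) * emeasure (cone_measure K) A)"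
    "\<And>y. y \<in> gauss_domain K \<Longrightarrow> y \<in> U \<Longrightarrow>
       y \<bullet> gauss_map K y \<le> \<eta> * a \<and> a \<le> \<eta> * (y \<bullet> gauss_map K y)"
proof -
  let ?s = "DIM('a) - 1"
  define u where "u = gauss_map K y0"
  have a_eq: "a = u \<bullet> y0" by (simp add: a_def u_def)
  have nu: "norm u = 1" unfolding u_def by (rule norm_gauss_map[OF y0])
  have a: "a > 0"
    unfolding a_def by (rule normal_inner_pos[OF gauss_domain_frontier gauss_map_normal(1)]) (fact y0)+
  obtain \<delta> where \<delta>: "\<delta> > 0"
    "\<And>y. y \<in> frontier K \<Longrightarrow> dist y y0 < \<delta> \<Longrightarrow> u \<bullet> y > 0 \<and> u \<bullet> y \<le> a \<and> a \<le> \<eta> * (u \<bullet> y)"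
    "\<And>y y'. y \<in> frontier K \<Longrightarrow> dist y y0 < \<delta> \<Longrightarrow> y' \<in> frontier K \<Longrightarrow> dist y' y0 < \<delta> \<Longrightarrow>
       norm ((a / (u \<bullet> y)) *\<^sub>R y - (a / (u \<bullet> y')) *\<^sub>R y') \<le> \<eta> * norm (y - y')
       \<and> norm (y - y') \<le> \<eta> * norm ((a / (u \<bullet> y)) *\<^sub>R y - (a / (u \<bullet> y')) *\<^sub>R y')"
    "\<And>y. y \<in> gauss_domain K \<Longrightarrow> dist y y0 < \<delta> \<Longrightarrow>
       y \<bullet> gauss_map K y \<le> \<eta> * a \<and> a \<le> \<eta> * (y \<bullet> gauss_map K y)"
    unfolding a_def u_def by (rule tangent_projection_near[OF y0 \<eta>]) blast
  show thesis
  proof (rule that[of "ball y0 \<delta>"])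
    fix A assume A [measurable]: "A \<in> sets borel" and sub: "A \<subseteq> ball y0 \<delta> \<inter> frontier K"
    have A_fr: "y \<in> frontier K" "dist y y0 < \<delta>" if "y \<in> A" for y
      using sub that by (auto simp: dist_commute)
    have A2: "u \<bullet> y > 0 \<and> u \<bullet> y \<le> a \<and> a \<le> \<eta> * (u \<bullet> y)" if "y \<in> A" for y
      using \<delta>(2) A_fr[OF that] by blast
    have A3: "norm ((a / (u \<bullet> y)) *\<^sub>R y - (a / (u \<bullet> y')) *\<^sub>R y') \<le> \<eta> * norm (y - y')
       \<and> norm (y - y') \<le> \<eta> * norm ((a / (u \<bullet> y)) *\<^sub>R y - (a / (u \<bullet> y')) *\<^sub>R y')"
      if "y \<in> A" "y' \<in> A" for y y'
      using \<delta>(3) A_fr[OF that(1)] A_fr[OF that(2)] by blast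
    define Q where "Q y = (a / (u \<bullet> y)) *\<^sub>R y" for y
    \<comment> \<open>The image of \<open>A\<close> under \<open>Q\<close>, written as a preimage so
      that it is Borel.\<close>
    define B where "B = {z. u \<bullet> z = a \<and> \<pi> z \<in> A}"
    have B [measurable]: "B \<in> sets borel" unfolding B_def by measurable
    have \<pi>Q: "\<pi> (Q y) = y" if "y \<in> A" for y
    proof -
      have "a / (u \<bullet> y) > 0" using A2[OF that] a by simp
      then show ?thesis
        using A_fr[OF that] by (simp add: Q_def radial_proj_scaleR radial_proj_id)
    qed
    have B_eq: "B = Q ` A"
    proof (intro equalityI subsetI)
      fix z assume z: "z \<in> B"
      define y where "y = \<pi> z"
      have zy: "z = g z *\<^sub>R y" by (simp add: y_def scaleR_radial_proj)
      have "y \<in> A" "u \<bullet> z = a" using z by (auto simp: B_def y_def)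
      then have "g z * (u \<bullet> y) = a" by (metis zy inner_scaleR_right)
      then have "g z = a / (u \<bullet> y)" using A2[OF \<open>y \<in> A\<close>] by (simp add: field_simps)
      then have "z = Q y" using zy by (simp add: Q_def)
      then show "z \<in> Q ` A" using \<open>y \<in> A\<close> by blast
    next
      fix z assume "z \<in> Q ` A"
      then obtain y where y: "y \<in> A" "z = Q y" by blast
      then show "z \<in> B" using \<pi>Q[OF y(1)] A2[OF y(1)] by (simp add: B_def Q_def)
    qed
    have "hausdorff_outer ?s (Q ` A) \<le> ennreal (\<eta> ^ ?s) * hausdorff_outer ?s A"
      using \<eta> A3 by (intro hausdorff_outer_lipschitz) (auto simp: Q_def)
    then have HB: "hausdorff_outer ?s B \<le> ennreal (\<eta> ^ ?s) * hausdorff_outer ?s A"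
      by (simp add: B_eq)
    have "hausdorff_outer ?s (\<pi> ` B) \<le> ennreal (\<eta> ^ ?s) * hausdorff_outer ?s B"
      using \<eta> A3 by (intro hausdorff_outer_lipschitz) (auto simp: B_eq \<pi>Q, auto simp: Q_def)
    moreover have "\<pi> ` B = A" using \<pi>Q by (force simp: B_eq)
    ultimately have HA: "hausdorff_outer ?s A \<le> ennreal (\<eta> ^ ?s) * hausdorff_outer ?s B" by simp
    let ?X = "{x. 0 < u \<bullet> x \<and> u \<bullet> x \<le> a \<and> (a / (u \<bullet> x)) *\<^sub>R x \<in> B}"
    let ?Y = "{x \<in> K. \<pi> x \<in> A}"
    have X [measurable]: "?X \<in> sets borel" by measurable
    have Y [measurable]: "?Y \<in> sets borel" by measurable
    have eX: "emeasure lborel ?X = ennreal (a * \<kappa>) * hausdorff_outer ?s B"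
    proof -
      have "B \<subseteq> {z. u \<bullet> z = a}" by (auto simp: B_def)
      then show ?thesis using \<kappa> nu a B unfolding cone_constant_def by blast
    qed
    have eY: "emeasure (cone_measure K) A = emeasure lborel ?Y" by (rule emeasure_cone_measure[OF A])
    \<comment> \<open>\<open>K\<close> lies on the inner side of its tangent hyperplane.\<close>
    have YX: "?Y \<subseteq> ?X"
    proof
      fix x assume x: "x \<in> ?Y"
      define y where "y = \<pi> x"
      have y: "y \<in> A" using x by (simp add: y_def)
      have "y \<noteq> 0" using A_fr(1)[OF y] frontier_nonzero by blast
      then have "x \<noteq> 0" by (auto simp: y_def)
      then have g: "g x > 0" "g x \<le> 1" using gauge_pos x gauge_le_1_iff by auto
      have ux: "u \<bullet> x = g x * (u \<bullet> y)" by (metis inner_scaleR_right scaleR_radial_proj y_def)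
      have "g x * (u \<bullet> y) \<le> 1 * a" using A2[OF y] g by (intro mult_mono) auto
      moreover have "(a / (u \<bullet> x)) *\<^sub>R x = Q y"
      proof -
        have "(a / (u \<bullet> x)) *\<^sub>R x = (a / (u \<bullet> x)) *\<^sub>R (g x *\<^sub>R y)" by (simp add: y_def scaleR_radial_proj)
        also have "\<dots> = Q y" using g A2[OF y] by (simp add: Q_def ux)
        finally show ?thesis .
      qed
      moreover have "g x * (u \<bullet> y) > 0" using g A2[OF y] by simp
      ultimately show "x \<in> ?X" using y by (simp add: ux B_eq)
    qed
    \<comment> \<open>Along the rays through \<open>A\<close> the tangent hyperplane is at most
      \<open>\<eta>\<close> times as far away as the boundary.\<close>
    have XY: "?X \<subseteq> (\<lambda>x. (1 / \<eta>) *\<^sub>R x) -` ?Y"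
    proof
      fix x assume x: "x \<in> ?X"
      then obtain y where y: "y \<in> A" "(a / (u \<bullet> x)) *\<^sub>R x = Q y" by (auto simp: B_eq)
      have "\<pi> x = \<pi> (Q y)"
        using radial_proj_scaleR[of "a / (u \<bullet> x)" x] x a y(2) by simp
      then have \<pi>x: "\<pi> x = y" using \<pi>Q[OF y(1)] by simp
      have "u \<bullet> x \<le> a" using x by simp
      moreover have "u \<bullet> x = g x * (u \<bullet> y)" by (metis inner_scaleR_right scaleR_radial_proj \<pi>x)
      ultimately have "g x * (u \<bullet> y) \<le> \<eta> * (u \<bullet> y)" using A2[OF y(1)] by linarith
      then have "g x \<le> \<eta>" using A2[OF y(1)] mult_right_le_imp_le by blast
      then have "g ((1 / \<eta>) *\<^sub>R x) \<le> 1" using \<eta> by (simp add: gauge_scaleR field_simps)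
      then show "x \<in> (\<lambda>x. (1 / \<eta>) *\<^sub>R x) -` ?Y"
        using \<eta> \<pi>x y(1) by (simp add: gauge_le_1_iff radial_proj_scaleR)
    qed
    have "emeasure lborel ?Y \<le> emeasure lborel ?X" using YX X by (intro emeasure_mono) auto
    also have "\<dots> \<le> ennreal (a * \<kappa>) * (ennreal (\<eta> ^ ?s) * hausdorff_outer ?s A)"
      unfolding eX by (intro mult_left_mono HB) auto
    finally have 1: "emeasure (cone_measure K) A \<le> ennreal (\<eta> ^ ?s) * (ennreal (a * \<kappa>) * hausdorff_outer ?s A)"
      by (simp add: eY mult_ac)
    have Y': "(\<lambda>x. (1 / \<eta>) *\<^sub>R x) -` ?Y \<in> sets borel"
      using measurable_sets_borel[of "\<lambda>x. (1 / \<eta>) *\<^sub>R x" borel ?Y] Y by simp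
    have "emeasure lborel ?X \<le> emeasure lborel ((\<lambda>x. (1 / \<eta>) *\<^sub>R x) -` ?Y)"
      using XY Y' by (intro emeasure_mono) auto
    also have "\<dots> = ennreal (\<eta> ^ DIM('a)) * emeasure lborel ((\<lambda>x. \<eta> *\<^sub>R x) -` ((\<lambda>x. (1 / \<eta>) *\<^sub>R x) -` ?Y))"
      using \<eta> by (intro emeasure_lborel_vimage_scale Y') auto
    also have "(\<lambda>x. \<eta> *\<^sub>R x) -` ((\<lambda>x. (1 / \<eta>) *\<^sub>R x) -` ?Y) = ?Y" using \<eta> by auto
    finally have "ennreal (a * \<kappa>) * hausdorff_outer ?s B \<le> ennreal (\<eta> ^ DIM('a)) * emeasure (cone_measure K) A"
      by (simp only: eX eY)
    then have "ennreal (\<eta> ^ ?s) * (ennreal (a * \<kappa>) * hausdorff_outer ?s B)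
        \<le> ennreal (\<eta> ^ ?s) * (ennreal (\<eta> ^ DIM('a)) * emeasure (cone_measure K) A)"
      by (rule mult_left_mono) simp
    moreover have "ennreal (a * \<kappa>) * hausdorff_outer ?s A
        \<le> ennreal (a * \<kappa>) * (ennreal (\<eta> ^ ?s) * hausdorff_outer ?s B)"
      by (intro mult_left_mono HA) auto
    ultimately have 2: "ennreal (a * \<kappa>) * hausdorff_outer ?s A
        \<le> ennreal (\<eta> ^ ?s) * (ennreal (\<eta> ^ DIM('a)) * emeasure (cone_measure K) A)"
      by (simp add: mult.left_commute[of "ennreal (a * \<kappa>)"])
    show "emeasure (cone_measure K) A \<le> ennreal (\<eta> ^ ?s) * (ennreal (a * \<kappa>) * hausdorff_outer ?s A)
       \<and> ennreal (a * \<kappa>) * hausdorff_outer ?s A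
           \<le> ennreal (\<eta> ^ ?s) * (ennreal (\<eta> ^ DIM('a)) * emeasure (cone_measure K) A)"
      using 1 2 by blast
  qed (use \<delta>(1,4) in \<open>auto simp: dist_commute\<close>)
qed

lemma cone_measure_surface_measure_near:
  assumes \<kappa>: "cone_constant TYPE('a) \<kappa>" and y0: "y0 \<in> gauss_domain K" and \<theta>: "\<theta> > 1"
  obtains U where "open U" "y0 \<in> U"
    "\<And>A. A \<in> sets borel \<Longrightarrow> A \<subseteq> U \<inter> gauss_domain K \<Longrightarrow>
       emeasure (cone_measure K) A \<le> ennreal \<theta> * emeasure (surface_measure \<kappa>) A
       \<and> emeasure (surface_measure \<kappa>) A \<le> ennreal \<theta> * emeasure (cone_measure K) A"
proof -
  let ?n = "DIM('a)" and ?s = "DIM('a) - 1"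
  have n: "?n > 0" by simp
  \<comment> \<open>The worse of the two estimates collects one factor for the height,
    \<open>DIM('a) - 1\<close> for the projection and \<open>DIM('a)\<close> for the dilation,
    together \<open>\<eta> ^ (2 * DIM('a))\<close>.\<close>
  define \<eta> where "\<eta> = root (2 * ?n) \<theta>"
  have \<eta>: "\<eta> > 1" using \<theta> n by (simp add: \<eta>_def)
  have \<eta>\<theta>: "\<eta> ^ (2 * ?n) = \<theta>" using \<theta> n by (simp add: \<eta>_def real_root_pow_pos2)
  have pw: "\<eta> ^ ?s * \<eta> \<le> \<theta>" "\<eta> * (\<eta> ^ ?s * \<eta> ^ ?n) \<le> \<theta>"
  proof -
    have "\<eta> ^ ?s * \<eta> = \<eta> ^ ?n" by (rule power_minus_mult[OF n])
    then show "\<eta> ^ ?s * \<eta> \<le> \<theta>" using \<eta> \<eta>\<theta> power_increasing[of ?n "2 * ?n" \<eta>] by simp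
    have "\<eta> * (\<eta> ^ ?s * \<eta> ^ ?n) = (\<eta> ^ ?s * \<eta>) * \<eta> ^ ?n" by simp
    also have "\<dots> = \<eta> ^ (2 * ?n)" using \<open>\<eta> ^ ?s * \<eta> = \<eta> ^ ?n\<close> by (simp add: mult_2 power_add)
    finally show "\<eta> * (\<eta> ^ ?s * \<eta> ^ ?n) \<le> \<theta>" using \<eta>\<theta> by simp
  qed
  define a where "a = gauss_map K y0 \<bullet> y0"
  have a: "a > 0"
    unfolding a_def by (rule normal_inner_pos[OF gauss_domain_frontier gauss_map_normal(1)]) (fact y0)+
  have \<kappa>0: "\<kappa> > 0" using \<kappa> by (simp add: cone_constant_def)
  obtain U where U: "open U" "y0 \<in> U"
    "\<And>A. A \<in> sets borel \<Longrightarrow> A \<subseteq> U \<inter> frontier K \<Longrightarrow>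
       emeasure (cone_measure K) A \<le> ennreal (\<eta> ^ ?s) * (ennreal (a * \<kappa>) * hausdorff_outer ?s A)
       \<and> ennreal (a * \<kappa>) * hausdorff_outer ?s A
           \<le> ennreal (\<eta> ^ ?s) * (ennreal (\<eta> ^ ?n) * emeasure (cone_measure K) A)"
    "\<And>y. y \<in> gauss_domain K \<Longrightarrow> y \<in> U \<Longrightarrow>
       y \<bullet> gauss_map K y \<le> \<eta> * a \<and> a \<le> \<eta> * (y \<bullet> gauss_map K y)"
    unfolding a_def by (rule cone_measure_hausdorff_bounds[OF \<kappa> y0 \<eta>]) blast
  show thesis
  proof (rule that[OF U(1,2)])
    fix A assume A: "A \<in> sets borel" and sub: "A \<subseteq> U \<inter> gauss_domain K"
    have "A \<subseteq> U \<inter> frontier K" using sub gauss_domain_frontier by blast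
    note c = U(3)[OF A this]
    have \<eta>0: "\<eta> > 0" using \<eta> by simp
    have sub': "A \<subseteq> gauss_domain K" using sub by blast
    have bnd: "y \<bullet> gauss_map K y \<le> \<eta> * a \<and> a \<le> \<eta> * (y \<bullet> gauss_map K y)" if "y \<in> A" for y
      using U(4) sub that by blast
    note s = surface_measure_bounds[OF \<kappa>0 A sub' a \<eta>0 bnd]
    have "emeasure (cone_measure K) A \<le> ennreal (\<eta> ^ ?s) * (ennreal \<eta> * emeasure (surface_measure \<kappa>) A)"
      using c s(2) by (meson mult_left_mono order_trans zero_le)
    also have "\<dots> = ennreal (\<eta> ^ ?s * \<eta>) * emeasure (surface_measure \<kappa>) A"
      using \<eta> by (simp add: ennreal_mult mult.assoc)
    also have "\<dots> \<le> ennreal \<theta> * emeasure (surface_measure \<kappa>) A"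
      using pw by (intro mult_right_mono ennreal_leI) auto
    finally have 1: "emeasure (cone_measure K) A \<le> ennreal \<theta> * emeasure (surface_measure \<kappa>) A" .
    have "emeasure (surface_measure \<kappa>) A
        \<le> ennreal \<eta> * (ennreal (\<eta> ^ ?s) * (ennreal (\<eta> ^ ?n) * emeasure (cone_measure K) A))"
      using c s(1) by (meson mult_left_mono order_trans zero_le)
    also have "\<dots> = ennreal (\<eta> * (\<eta> ^ ?s * \<eta> ^ ?n)) * emeasure (cone_measure K) A"
      using \<eta> by (simp add: ennreal_mult mult.assoc)
    also have "\<dots> \<le> ennreal \<theta> * emeasure (cone_measure K) A"
      using pw by (intro mult_right_mono ennreal_leI) auto
    finally show "emeasure (cone_measure K) A \<le> ennreal \<theta> * emeasure (surface_measure \<kappa>) A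
       \<and> emeasure (surface_measure \<kappa>) A \<le> ennreal \<theta> * emeasure (cone_measure K) A"
      using 1 by blast
  qed
qed

text \<open>A Lindelof cover by open sets on which the two measures agree up to
  \<open>\<theta>\<close> yields the same comparison on the whole Gauss domain, and
  \<open>\<theta>\<close> tends to 1. Singular boundary points have no mass: for the cone measure
  because almost every ray misses them, for the other by the indicator in its density.\<close>

lemma cone_measure_eq_surface_measure:
  assumes \<kappa>: "cone_constant TYPE('a) \<kappa>"
  shows "cone_measure K = surface_measure \<kappa>"
proof (rule measure_eqI)
  fix A assume "A \<in> sets (cone_measure K)"
  then have A [measurable]: "A \<in> sets borel" by simp
  define D where "D = A \<inter> gauss_domain K"
  have D [measurable]: "D \<in> sets borel" unfolding D_def by measurable
  have comp: "emeasure (cone_measure K) D \<le> ennreal \<theta> * emeasure (surface_measure \<kappa>) D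
      \<and> emeasure (surface_measure \<kappa>) D \<le> ennreal \<theta> * emeasure (cone_measure K) D" if \<theta>: "\<theta> > 1" for \<theta>
  proof -
    define P where "P U \<longleftrightarrow> open U \<and> (\<forall>A. A \<in> sets borel \<longrightarrow> A \<subseteq> U \<inter> gauss_domain K \<longrightarrow>
       emeasure (cone_measure K) A \<le> ennreal \<theta> * emeasure (surface_measure \<kappa>) A
       \<and> emeasure (surface_measure \<kappa>) A \<le> ennreal \<theta> * emeasure (cone_measure K) A)" for U
    have P0: "P {}" by (simp add: P_def)
    obtain \<F> where \<F>: "\<F> \<subseteq> {U. P U}" "countable \<F>" "\<Union>\<F> = \<Union>{U. P U}"
      using Lindelof[of "{U. P U}"] by (auto simp: P_def)
    \<comment> \<open>The empty set is inserted to have a nonempty family, as the enumeration by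
      \<open>from_nat_into\<close> requires.\<close>
    define U where "U = from_nat_into (insert {} \<F>)"
    have rU: "range U = insert {} \<F>"
      unfolding U_def using \<F>(2) by (intro range_from_nat_into) auto
    have PU: "P (U i)" for i
    proof -
      have "U i \<in> insert {} \<F>" by (metis rU rangeI)
      then show ?thesis using \<F>(1) P0 by auto
    qed
    have cov: "gauss_domain K \<subseteq> (\<Union>i. U i)"
    proof
      fix y assume "y \<in> gauss_domain K"
      then obtain W where "P W" "y \<in> W"
        using cone_measure_surface_measure_near[OF \<kappa> _ \<theta>, of y] unfolding P_def by metis
      then show "y \<in> (\<Union>i. U i)" using \<F>(3) unfolding rU by blast
    qed
    have U_op: "U i \<in> sets borel" for i using PU[of i] by (simp add: P_def)
    have "emeasure (cone_measure K) D \<le> ennreal \<theta> * emeasure (surface_measure \<kappa>) D"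
      using cov PU U_op D by (intro emeasure_le_countable_cover[of _ _ D U]) (auto simp: D_def P_def)
    moreover have "emeasure (surface_measure \<kappa>) D \<le> ennreal \<theta> * emeasure (cone_measure K) D"
      using cov PU U_op D by (intro emeasure_le_countable_cover[of _ _ D U]) (auto simp: D_def P_def)
    ultimately show ?thesis by blast
  qed
  have eqD: "emeasure (cone_measure K) D = emeasure (surface_measure \<kappa>) D"
  proof (rule antisym)
    show "emeasure (cone_measure K) D \<le> emeasure (surface_measure \<kappa>) D"
      by (rule ennreal_le_mult_all_gt_1) (use comp in blast)
    show "emeasure (surface_measure \<kappa>) D \<le> emeasure (cone_measure K) D"
      by (rule ennreal_le_mult_all_gt_1) (use comp in blast)
  qed
  have "emeasure (cone_measure K) A = emeasure (cone_measure K) D"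
  proof -
    have "AE x in lborel. (x \<in> {x \<in> K. \<pi> x \<in> A}) = (x \<in> {x \<in> K. \<pi> x \<in> D})"
      using radial_proj_gauss_domain_AE by (rule AE_mp) (auto simp: D_def)
    then show ?thesis
      unfolding emeasure_cone_measure[OF A] emeasure_cone_measure[OF D]
      by (intro emeasure_eq_AE) measurable
  qed
  also note eqD
  also have "emeasure (surface_measure \<kappa>) D = emeasure (surface_measure \<kappa>) A"
    unfolding emeasure_surface_measure[OF A] emeasure_surface_measure[OF D]
    by (intro nn_integral_cong) (auto simp: D_def indicator_def)
  finally show "emeasure (cone_measure K) A = emeasure (surface_measure \<kappa>) A" .
qed simp

end

subsection \<open>Integration against the weighted surface area measure\<close>

context origin_body
begin

text \<open>As a pushforward under the Gauss map the set function is a measure, so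
  \<open>measure_of\<close> does not change it. Off the Gauss domain the map takes the value
  \<open>e\<close>, to stay on the sphere, and the density is 0 there.\<close>

lemma lp_surface_measure_eq_distr:
  assumes [measurable]: "\<phi> \<in> borel_measurable borel" and e: "norm e = (1::real)"
  shows "lp_surface_measure p \<phi> K =
    distr (density (hausdorff_measure (DIM('a) - 1))
        (\<lambda>y. indicator (gauss_domain K) y * ennreal ((y \<bullet> normal_field K y) powr (1 - p) * \<phi> y)))
      (restrict_space borel (sphere 0 1)) (\<lambda>y. if y \<in> gauss_domain K then normal_field K y else e)"
    (is "_ = ?D")
proof -
  let ?N = "\<lambda>y. if y \<in> gauss_domain K then normal_field K y else e"
  let ?w = "\<lambda>y. ennreal ((y \<bullet> normal_field K y) powr (1 - p) * \<phi> y)"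
  have N: "?N \<in> borel \<rightarrow>\<^sub>M restrict_space borel (sphere 0 1)"
  proof (rule measurable_restrict_space2)
    show "?N \<in> space borel \<rightarrow> sphere 0 1"
      using e by (auto simp: normal_field_eq norm_gauss_map)
  qed measurable
  then have N' [measurable]: "?N \<in> density (hausdorff_measure (DIM('a) - 1))
      (\<lambda>y. indicator (gauss_domain K) y * ?w y) \<rightarrow>\<^sub>M restrict_space borel (sphere 0 1)"
    by (simp cong: measurable_cong_sets)
  have sp: "space ?D = sphere 0 1" "sets ?D = sets (restrict_space borel (sphere 0 1))"
    by (auto simp: space_restrict_space)
  have eq: "(\<integral>\<^sup>+ y \<in> {y \<in> gauss_domain K. gauss_map K y \<in> E}.
        ennreal ((y \<bullet> gauss_map K y) powr (1 - p) * \<phi> y) \<partial>hausdorff_measure (DIM('a) - 1)) = emeasure ?D E"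
    if E: "E \<in> sets (restrict_space borel (sphere 0 1))" for E
  proof -
    have vE: "?N -` E \<in> sets borel"
      using measurable_sets[OF N E] by simp
    have "emeasure ?D E = emeasure (density (hausdorff_measure (DIM('a) - 1))
        (\<lambda>y. indicator (gauss_domain K) y * ?w y)) (?N -` E)"
      using E by (subst emeasure_distr) auto
    also have "\<dots> = (\<integral>\<^sup>+y. indicator (gauss_domain K) y * ?w y * indicator (?N -` E) y
        \<partial>hausdorff_measure (DIM('a) - 1))"
      using vE by (subst emeasure_density) auto
    also have "\<dots> = (\<integral>\<^sup>+ y \<in> {y \<in> gauss_domain K. gauss_map K y \<in> E}.
        ennreal ((y \<bullet> gauss_map K y) powr (1 - p) * \<phi> y) \<partial>hausdorff_measure (DIM('a) - 1))"
      by (intro nn_integral_cong) (auto simp: indicator_def normal_field_eq)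
    finally show ?thesis by simp
  qed
  have "lp_surface_measure p \<phi> K = measure_of (sphere 0 1) (sets (restrict_space borel (sphere 0 1))) (emeasure ?D)"
    unfolding lp_surface_measure_def
  proof (intro measure_of_eq)
    show "sets (restrict_space borel (sphere 0 1)) \<subseteq> Pow (sphere (0::'a) 1)"
      using sets.sets_into_space[of _ "restrict_space borel (sphere (0::'a) 1)"]
      by (auto simp: space_restrict_space)
    fix E assume "E \<in> sigma_sets (sphere (0::'a) 1) (sets (restrict_space borel (sphere 0 1)))"
    then have "E \<in> sets (restrict_space borel (sphere (0::'a) 1))"
      using sets.sigma_sets_eq[of "restrict_space borel (sphere (0::'a) 1)"] by (simp add: space_restrict_space)
    then show "(\<integral>\<^sup>+ y \<in> {y \<in> gauss_domain K. gauss_map K y \<in> E}.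
        ennreal ((y \<bullet> gauss_map K y) powr (1 - p) * \<phi> y) \<partial>hausdorff_measure (DIM('a) - 1)) = emeasure ?D E"
      by (rule eq)
  qed
  also have "\<dots> = measure_of (space ?D) (sets ?D) (emeasure ?D)" by (simp only: sp)
  also have "\<dots> = ?D" by (rule measure_of_of_measure)
  finally show ?thesis .
qed

text \<open>On the Gauss domain \<open>y \<bullet> normal_field K y\<close> is the support function
  at the normal, so its power with exponent \<open>1 - p\<close> times \<open>f powr p\<close>
  equals itself times the p-th power of the quotient. The first factor, with
  \<open>\<kappa>\<close>, is the density of the cone measure, and the integral becomes one over
  \<open>K\<close>.\<close>

lemma nn_integral_lp_surface_measure:
  assumes \<kappa>: "cone_constant TYPE('a) \<kappa>"
    and [measurable]: "\<phi> \<in> borel_measurable borel" "f \<in> borel_measurable borel"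
    and nonneg: "\<And>x. \<phi> x \<ge> 0" "\<And>u. f u \<ge> 0"
  shows "ennreal \<kappa> * (\<integral>\<^sup>+u. ennreal (f u powr p) \<partial>lp_surface_measure p \<phi> K) =
    (\<integral>\<^sup>+x. indicator K x * ennreal ((f (normal_field K (\<pi> x)) / support_fun K (normal_field K (\<pi> x))) powr p * \<phi> (\<pi> x)) \<partial>lborel)"
proof -
  let ?H = "hausdorff_measure (DIM('a) - 1) :: 'a measure"
  let ?N = "normal_field K"
  obtain e :: 'a where "e \<in> Basis" using nonempty_Basis by blast
  then have e: "norm e = 1" by simp
  define N where "N y = (if y \<in> gauss_domain K then ?N y else e)" for y
  have N: "N \<in> density ?H (\<lambda>y. indicator (gauss_domain K) y * ennreal ((y \<bullet> ?N y) powr (1 - p) * \<phi> y))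
      \<rightarrow>\<^sub>M restrict_space borel (sphere 0 1)"
    unfolding N_def[abs_def]
    by (rule measurable_restrict_space2)
      (use e in \<open>auto simp: normal_field_eq norm_gauss_map cong: measurable_cong_sets\<close>)
  have [measurable]: "N \<in> borel_measurable borel" unfolding N_def[abs_def] by measurable
  have f1: "(\<lambda>u. ennreal (f u powr p)) \<in> borel_measurable (restrict_space borel (sphere 0 1))"
    by (rule measurable_restrict_space1) measurable
  have "(\<integral>\<^sup>+u. ennreal (f u powr p) \<partial>lp_surface_measure p \<phi> K)
      = (\<integral>\<^sup>+y. ennreal (f (N y) powr p) \<partial>density ?H (\<lambda>y. indicator (gauss_domain K) y * ennreal ((y \<bullet> ?N y) powr (1 - p) * \<phi> y)))"
    unfolding lp_surface_measure_eq_distr[OF assms(2) e] N_def[symmetric]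
    by (rule nn_integral_distr[OF N]) (use f1 in simp)
  also have "\<dots> = (\<integral>\<^sup>+y. indicator (gauss_domain K) y * ennreal ((y \<bullet> ?N y) powr (1 - p) * \<phi> y)
      * ennreal (f (N y) powr p) \<partial>?H)"
    by (rule nn_integral_density) measurable
  finally have "ennreal \<kappa> * (\<integral>\<^sup>+u. ennreal (f u powr p) \<partial>lp_surface_measure p \<phi> K)
      = (\<integral>\<^sup>+y. ennreal \<kappa> * (indicator (gauss_domain K) y * ennreal ((y \<bullet> ?N y) powr (1 - p) * \<phi> y)
      * ennreal (f (N y) powr p)) \<partial>?H)"
    by (simp add: nn_integral_cmult)
  also have "\<dots> = (\<integral>\<^sup>+y. ennreal \<kappa> * indicator (gauss_domain K) y * ennreal (y \<bullet> ?N y)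
      * ennreal ((f (?N y) / support_fun K (?N y)) powr p * \<phi> y) \<partial>?H)"
  proof (rule nn_integral_cong)
    fix y
    show "ennreal \<kappa> * (indicator (gauss_domain K) y * ennreal ((y \<bullet> ?N y) powr (1 - p) * \<phi> y) * ennreal (f (N y) powr p))
        = ennreal \<kappa> * indicator (gauss_domain K) y * ennreal (y \<bullet> ?N y)
          * ennreal ((f (?N y) / support_fun K (?N y)) powr p * \<phi> y)"
    proof (cases "y \<in> gauss_domain K")
      case True
      define s where "s = y \<bullet> ?N y"
      have s: "s > 0" "support_fun K (?N y) = s"
        using normal_inner_pos[OF gauss_domain_frontier[OF True] gauss_map_normal(1)[OF True]] True
        by (auto simp: s_def normal_field_eq support_fun_gauss_map inner_commute)
      have "s powr (1 - p) * \<phi> y * f (?N y) powr p = s * ((f (?N y) / s) powr p * \<phi> y)"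
        using s nonneg(2)[of "?N y"] by (simp add: powr_divide powr_diff)
      then have "ennreal (s powr (1 - p) * \<phi> y) * ennreal (f (?N y) powr p) = ennreal s * ennreal ((f (?N y) / s) powr p * \<phi> y)"
        using s nonneg(1)[of y] by (simp add: ennreal_mult[symmetric])
      then show ?thesis
        using True s by (simp add: N_def s_def[symmetric] mult.assoc)
    qed simp
  qed
  also have "\<dots> = (\<integral>\<^sup>+y. ennreal ((f (?N y) / support_fun K (?N y)) powr p * \<phi> y) \<partial>surface_measure \<kappa>)"
  proof -
    have [measurable]: "support_fun K \<in> borel_measurable borel"
      by (intro borel_measurable_continuous_onI continuous_on_support_fun compact_K K_nonempty)
    show ?thesis unfolding surface_measure_def by (rule nn_integral_density[symmetric]) measurable
  qed
  also have "\<dots> = (\<integral>\<^sup>+y. ennreal ((f (?N y) / support_fun K (?N y)) powr p * \<phi> y) \<partial>cone_measure K)"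
    by (simp only: cone_measure_eq_surface_measure[OF \<kappa>])
  also have "\<dots> = (\<integral>\<^sup>+x. indicator K x * ennreal ((f (?N (\<pi> x)) / support_fun K (?N (\<pi> x))) powr p * \<phi> (\<pi> x)) \<partial>lborel)"
  proof -
    have [measurable]: "support_fun K \<in> borel_measurable borel"
      by (intro borel_measurable_continuous_onI continuous_on_support_fun compact_K K_nonempty)
    show ?thesis by (rule nn_integral_cone_measure) measurable
  qed
  finally show ?thesis .
qed

end

subsection \<open>Existence of $L^p$ sums\<close>

text \<open>Young's inequality for the exponents \<open>p / (p - 1)\<close> and \<open>p\<close>,
  cleared of denominators so that \<open>p = 1\<close> is included.\<close>

lemma Young_powr:
  fixes a b p :: real
  assumes "p \<ge> 1" "a \<ge> 0" "b \<ge> 0"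
  shows "p * (a powr (p - 1) * b) \<le> (p - 1) * a powr p + b powr p"
proof (cases "a = 0 \<or> b = 0")
  case False
  then have "a > 0" "b > 0" using assms by auto
  have "(a powr p) powr ((p - 1) / p) * (b powr p) powr (1 / p) \<le> ((p - 1) / p) * a powr p + (1 / p) * b powr p"
    using assms(1) \<open>a > 0\<close> \<open>b > 0\<close> by (intro Youngs_inequality_0) (auto simp: field_simps)
  also have "(a powr p) powr ((p - 1) / p) * (b powr p) powr (1 / p) = a powr (p - 1) * b"
    using assms(1) \<open>a > 0\<close> \<open>b > 0\<close> by (simp add: powr_powr)
  finally have "p * (a powr (p - 1) * b) \<le> p * (((p - 1) / p) * a powr p + (1 / p) * b powr p)"
    using assms(1) by (intro mult_left_mono) auto
  also have "\<dots> = (p - 1) * a powr p + b powr p"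
    using assms(1) by (simp add: distrib_left)
  finally show ?thesis .
qed (use assms in auto)

text \<open>Young's inequality with first entry 1. It bounds the support function of an L^p sum by
  its linearization in the parameter.\<close>

lemma Bernoulli_powr_inverse:
  fixes z p :: real
  assumes "p \<ge> 1" "z \<ge> - 1"
  shows "(1 + z) powr (1 / p) \<le> 1 + z / p"
proof -
  define b where "b = (1 + z) powr (1 / p)"
  have b: "b \<ge> 0" "b powr p = 1 + z"
    using assms by (auto simp: b_def powr_powr)
  have "p * b \<le> (p - 1) + (1 + z)"
    using Young_powr[OF assms(1), of 1 b] b by simp
  then show ?thesis using assms(1) by (simp add: b_def[symmetric] field_simps)
qed

section \<open>Power means and their linear minorants\<close>

definition lp_mean :: "real \<Rightarrow> real \<Rightarrow> real \<Rightarrow> real \<Rightarrow> real \<Rightarrow> real" where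
  "lp_mean p \<alpha> \<beta> A B = (\<alpha> * A powr p + \<beta> * B powr p) powr (1 / p)"

lemma lp_mean_nonneg: "lp_mean p \<alpha> \<beta> A B \<ge> 0"
  by (simp add: lp_mean_def)

lemma lp_mean_powr:
  assumes "p \<ge> 1" "\<alpha> \<ge> 0" "\<beta> \<ge> 0"
  shows "lp_mean p \<alpha> \<beta> A B powr p = \<alpha> * A powr p + \<beta> * B powr p"
  using assms by (simp add: lp_mean_def powr_powr)

text \<open>The functional comes from the equality case of Hoelder's inequality.\<close>

lemma lp_mean_dual:
  fixes p \<alpha> \<beta> A B :: real
  assumes p: "p \<ge> 1" and \<alpha>\<beta>: "\<alpha> > 0" "\<beta> > 0" and A: "A > 0" and B: "B > 0"
  obtains a b where "a > 0" "b > 0" "a * A + b * B = lp_mean p \<alpha> \<beta> A B"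
    "\<And>A' B'. A' \<ge> 0 \<Longrightarrow> B' \<ge> 0 \<Longrightarrow> a * A' + b * B' \<le> lp_mean p \<alpha> \<beta> A' B'"
proof -
  define N where "N = lp_mean p \<alpha> \<beta> A B"
  have "\<alpha> * A powr p + \<beta> * B powr p > 0" using \<alpha>\<beta> A B by (intro add_pos_pos mult_pos_pos) auto
  then have N: "N > 0" by (simp add: N_def lp_mean_def)
  have Np: "N powr p = \<alpha> * A powr p + \<beta> * B powr p"
    using p \<alpha>\<beta> by (simp add: N_def lp_mean_powr)
  define x y where "x = A / N" and "y = B / N"
  have xy: "x > 0" "y > 0" using A B N by (auto simp: x_def y_def)
  have sum1: "\<alpha> * x powr p + \<beta> * y powr p = 1"
  proof -
    have "\<alpha> * x powr p + \<beta> * y powr p = (\<alpha> * A powr p + \<beta> * B powr p) / N powr p"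
      using A B N by (simp add: x_def y_def powr_divide add_divide_distrib)
    also have "\<dots> = 1" unfolding Np[symmetric] using N by simp
    finally show ?thesis .
  qed
  have pw: "z powr (p - 1) * z = z powr p" if "z > 0" for z :: real
    using that by (simp add: powr_diff)
  \<comment> \<open>The coefficients are the gradient of the mean at \<open>(A, B)\<close>.\<close>
  show thesis
  proof (rule that[of "\<alpha> * x powr (p - 1)" "\<beta> * y powr (p - 1)"])
    show "\<alpha> * x powr (p - 1) > 0" "\<beta> * y powr (p - 1) > 0" using \<alpha>\<beta> xy by auto
    have "A = N * x" "B = N * y" using N by (auto simp: x_def y_def)
    then have "\<alpha> * x powr (p - 1) * A + \<beta> * y powr (p - 1) * B
        = N * (\<alpha> * (x powr (p - 1) * x) + \<beta> * (y powr (p - 1) * y))"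
      by (simp add: algebra_simps)
    also have "\<dots> = N" using sum1 xy by (simp add: pw)
    finally show "\<alpha> * x powr (p - 1) * A + \<beta> * y powr (p - 1) * B = lp_mean p \<alpha> \<beta> A B"
      by (simp add: N_def)
    fix A' B' :: real assume A': "A' \<ge> 0" and B': "B' \<ge> 0"
    show "\<alpha> * x powr (p - 1) * A' + \<beta> * y powr (p - 1) * B' \<le> lp_mean p \<alpha> \<beta> A' B'"
    proof (cases "A' = 0 \<and> B' = 0")
      case True
      then show ?thesis using lp_mean_nonneg by simp
    next
      case False
      define N' where "N' = lp_mean p \<alpha> \<beta> A' B'"
      have "\<alpha> * A' powr p + \<beta> * B' powr p > 0"
        using \<alpha>\<beta> A' B' False by (cases "A' = 0") (auto intro!: add_pos_nonneg)
      then have N': "N' > 0" by (simp add: N'_def lp_mean_def)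
      have N'p: "N' powr p = \<alpha> * A' powr p + \<beta> * B' powr p"
        using p \<alpha>\<beta> by (simp add: N'_def lp_mean_powr)
      define x' y' where "x' = A' / N'" and "y' = B' / N'"
      have xy': "x' \<ge> 0" "y' \<ge> 0" using A' B' N' by (auto simp: x'_def y'_def)
      have sum1': "\<alpha> * x' powr p + \<beta> * y' powr p = 1"
      proof -
        have "\<alpha> * x' powr p + \<beta> * y' powr p = (\<alpha> * A' powr p + \<beta> * B' powr p) / N' powr p"
          using A' B' N' by (simp add: x'_def y'_def powr_divide add_divide_distrib)
        also have "\<dots> = 1" unfolding N'p[symmetric] using N' by simp
        finally show ?thesis .
      qed
      have "p * (\<alpha> * (x powr (p - 1) * x') + \<beta> * (y powr (p - 1) * y'))
          = \<alpha> * (p * (x powr (p - 1) * x')) + \<beta> * (p * (y powr (p - 1) * y'))"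
        by (simp add: algebra_simps)
      also have "\<dots> \<le> \<alpha> * ((p - 1) * x powr p + x' powr p) + \<beta> * ((p - 1) * y powr p + y' powr p)"
        using \<alpha>\<beta> xy xy' p by (intro add_mono mult_left_mono Young_powr) auto
      also have "\<dots> = (p - 1) * (\<alpha> * x powr p + \<beta> * y powr p) + (\<alpha> * x' powr p + \<beta> * y' powr p)"
        by (simp add: algebra_simps)
      also have "\<dots> = p" using sum1 sum1' by simp
      finally have *: "\<alpha> * (x powr (p - 1) * x') + \<beta> * (y powr (p - 1) * y') \<le> 1"
        using p by simp
      have "A' = N' * x'" "B' = N' * y'" using N' by (auto simp: x'_def y'_def)
      then have "\<alpha> * x powr (p - 1) * A' + \<beta> * y powr (p - 1) * B'
          = N' * (\<alpha> * (x powr (p - 1) * x') + \<beta> * (y powr (p - 1) * y'))"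
        by (simp add: algebra_simps)
      also have "\<dots> \<le> N' * 1" using * N' by (intro mult_left_mono) auto
      finally show ?thesis by (simp add: N'_def)
    qed
  qed
qed

text \<open>A point of one body outside the other is cut off by a hyperplane, and the support
  functions differ at its normal. This is the uniqueness behind the description in
  \<open>lp_sum\<close>.\<close>

lemma convex_body_eqI:
  assumes M: "convex_body M" "convex_body M'" and h: "\<And>u. support_fun M u = support_fun M' u"
  shows "M = M'"
proof -
  have sub: "A \<subseteq> B" if A: "convex_body A" and B: "convex_body B" and eq: "\<And>u. support_fun A u = support_fun B u"
    for A B :: "'b::euclidean_space set"
  proof
    fix z assume z: "z \<in> A"
    show "z \<in> B"
    proof (rule ccontr)
      assume "z \<notin> B"
      moreover have "convex B" "closed B" "B \<noteq> {}"
        using B interior_subset by (auto simp: convex_body_def compact_imp_closed)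
      ultimately obtain a b where ab: "a \<bullet> z < b" "\<And>y. y \<in> B \<Longrightarrow> b < a \<bullet> y"
        using separating_hyperplane_closed_point by metis
      have "support_fun B (- a) \<le> - b"
        using ab(2) \<open>B \<noteq> {}\<close> by (intro support_fun_least) (auto simp: less_imp_le)
      moreover have "- a \<bullet> z \<le> support_fun A (- a)"
        using A z by (intro support_fun_upper) (auto simp: convex_body_def)
      ultimately show False using ab(1) eq[of "- a"] by simp
    qed
  qed
  show ?thesis using sub[OF M h] sub[OF M(2,1) h[symmetric]] by blast
qed

text \<open>The sum is built from points \<open>a *\<^sub>R x + b *\<^sub>R y\<close> for which the
  linear form with coefficients \<open>a\<close>, \<open>b\<close> lies below the mean. In direction
  \<open>u\<close> their supremum is the largest value of such forms at the two support values,
  which is the mean by \<open>lp_mean_dual\<close>. Passing to the convex hull does not change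
  it.\<close>

lemma lp_sum_body_exists:
  fixes K L :: "'a::euclidean_space set"
  assumes p: "p \<ge> 1" and \<alpha>\<beta>: "\<alpha> > 0" "\<beta> > 0" and "K \<in> convex_bodies_o" "L \<in> convex_bodies_o"
  shows "\<exists>M. convex_body M \<and> (\<forall>u. support_fun M u = lp_mean p \<alpha> \<beta> (support_fun K u) (support_fun L u))"
proof -
  interpret K: origin_body K by standard fact
  interpret L: origin_body L by standard fact
  define \<Omega> where "\<Omega> = {ab :: real \<times> real. 0 \<le> fst ab \<and> 0 \<le> snd ab \<and>
     (\<forall>A\<ge>0. \<forall>B\<ge>0. fst ab * A + snd ab * B \<le> lp_mean p \<alpha> \<beta> A B)}"
  have "compact \<Omega>"
    unfolding compact_eq_bounded_closed
  proof
    have "\<Omega> = {ab. 0 \<le> fst ab} \<inter> {ab. 0 \<le> snd ab} \<inter>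
        (\<Inter>A\<in>{0..}. \<Inter>B\<in>{0..}. {ab. fst ab * A + snd ab * B \<le> lp_mean p \<alpha> \<beta> A B})"
      by (auto simp: \<Omega>_def)
    then show "closed \<Omega>"
      by (auto intro!: closed_Int closed_INT closed_Collect_le continuous_intros)
    \<comment> \<open>Testing a minorant at \<open>(1, 0)\<close> and \<open>(0, 1)\<close> bounds
      its coefficients.\<close>
    have "\<Omega> \<subseteq> {0..lp_mean p \<alpha> \<beta> 1 0} \<times> {0..lp_mean p \<alpha> \<beta> 0 1}"
    proof
      fix ab assume ab: "ab \<in> \<Omega>"
      then have "fst ab * 1 + snd ab * 0 \<le> lp_mean p \<alpha> \<beta> 1 0" "fst ab * 0 + snd ab * 1 \<le> lp_mean p \<alpha> \<beta> 0 1"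
        unfolding \<Omega>_def by (blast intro: zero_le_one order_refl)+
      then show "ab \<in> {0..lp_mean p \<alpha> \<beta> 1 0} \<times> {0..lp_mean p \<alpha> \<beta> 0 1}"
        using ab by (cases ab) (auto simp: \<Omega>_def)
    qed
    then show "bounded \<Omega>"
      by (rule bounded_subset[rotated]) (intro bounded_Times bounded_closed_interval)
  qed
  define f where "f q = fst (snd (snd q)) *\<^sub>R fst q + snd (snd (snd q)) *\<^sub>R fst (snd q)"
    for q :: "'a \<times> 'a \<times> real \<times> real"
  define U where "U = f ` (K \<times> L \<times> \<Omega>)"
  have cU: "compact U"
    unfolding U_def f_def
    by (intro compact_continuous_image continuous_intros compact_Times K.compact_K L.compact_K \<open>compact \<Omega>\<close>)
  define M where "M = convex hull U"
  have cM: "compact M" unfolding M_def by (rule compact_convex_hull[OF cU])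
  have UM: "U \<subseteq> M" unfolding M_def by (rule hull_subset)
  have U_I: "a *\<^sub>R x + b *\<^sub>R y \<in> U" if "x \<in> K" "y \<in> L" "(a, b) \<in> \<Omega>" for x y a b
    using that unfolding U_def f_def by (intro image_eqI[of _ _ "(x, y, a, b)"]) auto
  \<comment> \<open>A minorant with \<open>a0 > 0\<close>, combined with \<open>0 \<in> L\<close>,
    puts a ball into \<open>M\<close>, whose interior is thus nonempty.\<close>
  obtain a0 b0 where a0: "a0 > 0" "b0 > 0"
    "\<And>A' B'. A' \<ge> 0 \<Longrightarrow> B' \<ge> 0 \<Longrightarrow> a0 * A' + b0 * B' \<le> lp_mean p \<alpha> \<beta> A' B'"
    using lp_mean_dual[OF p \<alpha>\<beta>, of 1 1] by (metis zero_less_one)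
  have \<Omega>0: "(a0, b0) \<in> \<Omega>" using a0 by (auto simp: \<Omega>_def)
  obtain r where r: "r > 0" "cball 0 r \<subseteq> K" by (rule K.inner_radius)
  have "ball 0 (a0 * r) \<subseteq> U"
  proof
    fix z :: 'a assume "z \<in> ball 0 (a0 * r)"
    then have "norm ((1 / a0) *\<^sub>R z) \<le> r" using a0(1) by (simp add: field_simps)
    then have "(1 / a0) *\<^sub>R z \<in> K" using r(2) by auto
    then show "z \<in> U" using U_I[OF _ L.zero_K \<Omega>0, of "(1 / a0) *\<^sub>R z"] a0(1) by simp
  qed
  then have "ball 0 (a0 * r) \<subseteq> interior M" using UM by (intro interior_maximal) auto
  moreover have "0 \<in> ball (0::'a) (a0 * r)" using a0(1) r(1) by simp
  ultimately have int: "interior M \<noteq> {}" by blast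
  then have M_ne: "M \<noteq> {}" using interior_subset by auto
  have "support_fun M u = lp_mean p \<alpha> \<beta> (support_fun K u) (support_fun L u)" for u
  proof (cases "u = 0")
    case True
    have z: "support_fun X 0 = 0" if "compact X" "X \<noteq> {}" for X :: "'a set"
      using support_fun_scaleR[OF that, of 0 0] by simp
    show ?thesis
      using True z[OF cM M_ne] z[OF K.compact_K K.K_nonempty] z[OF L.compact_K L.K_nonempty]
      by (simp add: lp_mean_def)
  next
    case False
    let ?A = "support_fun K u" and ?B = "support_fun L u"
    show ?thesis
    proof (rule antisym)
      have "U \<subseteq> {z. u \<bullet> z \<le> lp_mean p \<alpha> \<beta> ?A ?B}"
      proof
        fix z assume "z \<in> U"
        then obtain x y a b where z: "z = a *\<^sub>R x + b *\<^sub>R y" "x \<in> K" "y \<in> L" "(a, b) \<in> \<Omega>"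
          by (auto simp: U_def f_def)
        have "a * (u \<bullet> x) + b * (u \<bullet> y) \<le> a * ?A + b * ?B"
          using z support_fun_upper[OF K.compact_K z(2)] support_fun_upper[OF L.compact_K z(3)]
          by (intro add_mono mult_left_mono) (auto simp: \<Omega>_def)
        also have "\<dots> \<le> lp_mean p \<alpha> \<beta> ?A ?B"
          using z(4) K.support_fun_nonneg L.support_fun_nonneg by (auto simp: \<Omega>_def)
        finally show "z \<in> {z. u \<bullet> z \<le> lp_mean p \<alpha> \<beta> ?A ?B}" by (simp add: z(1) inner_add_right)
      qed
      then have "M \<subseteq> {z. u \<bullet> z \<le> lp_mean p \<alpha> \<beta> ?A ?B}"
        unfolding M_def by (intro hull_minimal convex_halfspace_le)
      then show "support_fun M u \<le> lp_mean p \<alpha> \<beta> ?A ?B"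
        by (intro support_fun_least M_ne) auto
      obtain a b where ab: "a > 0" "b > 0" "a * ?A + b * ?B = lp_mean p \<alpha> \<beta> ?A ?B"
        "\<And>A' B'. A' \<ge> 0 \<Longrightarrow> B' \<ge> 0 \<Longrightarrow> a * A' + b * B' \<le> lp_mean p \<alpha> \<beta> A' B'"
        using lp_mean_dual[OF p \<alpha>\<beta> K.support_fun_pos[OF False] L.support_fun_pos[OF False]] by metis
      obtain x where x: "x \<in> K" "?A = u \<bullet> x" by (rule support_fun_attained[OF K.compact_K K.K_nonempty])
      obtain y where y: "y \<in> L" "?B = u \<bullet> y" by (rule support_fun_attained[OF L.compact_K L.K_nonempty])
      have "a *\<^sub>R x + b *\<^sub>R y \<in> M"
        using UM U_I[OF x(1) y(1), of a b] ab by (auto simp: \<Omega>_def)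
      then have "u \<bullet> (a *\<^sub>R x + b *\<^sub>R y) \<le> support_fun M u" by (rule support_fun_upper[OF cM])
      then show "lp_mean p \<alpha> \<beta> ?A ?B \<le> support_fun M u"
        using ab(3) x(2) y(2) by (simp add: inner_add_right)
    qed
  qed
  then show ?thesis
    using cM int convex_convex_hull[of U] by (intro exI[of _ M]) (auto simp: convex_body_def M_def)
qed

lemma support_fun_lp_sum:
  fixes K L :: "'a::euclidean_space set"
  assumes "p \<ge> 1" "\<alpha> > 0" "\<beta> > 0" "K \<in> convex_bodies_o" "L \<in> convex_bodies_o"
  shows "support_fun (lp_sum p \<alpha> K \<beta> L) u = lp_mean p \<alpha> \<beta> (support_fun K u) (support_fun L u)"
proof -
  have "\<exists>!M. convex_body M \<and> (\<forall>u. support_fun M u = lp_mean p \<alpha> \<beta> (support_fun K u) (support_fun L u))"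
    using lp_sum_body_exists[OF assms] by (rule ex_ex1I) (rule convex_body_eqI; simp)
  from theI'[OF this] show ?thesis
    unfolding lp_sum_def lp_mean_def by blast
qed

lemma lp_sum_commute: "lp_sum p \<alpha> K \<beta> L = lp_sum p \<beta> L \<alpha> K"
  by (simp add: lp_sum_def add.commute)

text \<open>The p-th powers of the support functions are combined linearly. This lets the concavity
  inequality be applied between \<open>K\<close> and an intermediate sum.\<close>

lemma lp_sum_lp_sum:
  fixes K L :: "'a::euclidean_space set"
  assumes p: "p \<ge> 1" and t: "0 < t" "t < 1" and r: "0 < r" "r < 1"
    and KL: "K \<in> convex_bodies_o" "L \<in> convex_bodies_o"
  shows "lp_sum p (1 - r) K r (lp_sum p (1 - t) K t L) = lp_sum p (1 - r * t) K (r * t) L"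
proof -
  have "(1 - r) * support_fun K u powr p + r * support_fun (lp_sum p (1 - t) K t L) u powr p
      = (1 - r * t) * support_fun K u powr p + (r * t) * support_fun L u powr p" for u
    using p t KL by (simp add: support_fun_lp_sum lp_mean_powr algebra_simps)
  then show ?thesis unfolding lp_sum_def by simp
qed

subsection \<open>Volume of radial perturbations\<close>

context origin_body
begin

lemma emeasure_gauge_le_scale:
  assumes B [measurable]: "B \<in> sets borel" and s: "s > 0"
  shows "emeasure lborel {x. g x \<le> s \<and> \<pi> x \<in> B} = ennreal (s ^ DIM('a)) * emeasure (cone_measure K) B"
proof -
  have "{x. g x \<le> s \<and> \<pi> x \<in> B} \<in> sets borel" by measurable
  then have "emeasure lborel {x. g x \<le> s \<and> \<pi> x \<in> B}
      = ennreal (s ^ DIM('a)) * emeasure lborel ((\<lambda>x. s *\<^sub>R x) -` {x. g x \<le> s \<and> \<pi> x \<in> B})"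
    using s by (rule emeasure_lborel_vimage_scale)
  also have "(\<lambda>x. s *\<^sub>R x) -` {x. g x \<le> s \<and> \<pi> x \<in> B} = {x \<in> K. \<pi> x \<in> B}"
    using s by (auto simp: gauge_scaleR radial_proj_scaleR gauge_le_1_iff)
  finally show ?thesis by (simp add: emeasure_cone_measure)
qed

text \<open>A polar coordinates formula obtained by comparison: where \<open>\<rho>\<close> varies
  by at most a factor \<open>\<theta>\<close>, the perturbed set lies between two dilates of
  \<open>K\<close> whose volumes are known, and the integral of the density lies between the same
  bounds.\<close>

lemma radial_perturbation_measure:
  assumes \<rho> [measurable]: "\<rho> \<in> borel_measurable borel" and c: "c > 0" "\<And>y. c \<le> \<rho> y"
  shows "distr (density lborel (indicator {x. g x \<le> \<rho> (\<pi> x)})) borel \<pi>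
       = density (cone_measure K) (\<lambda>y. ennreal (\<rho> y ^ DIM('a)))" (is "?\<alpha> = ?\<beta>")
proof (rule measure_eqI)
  let ?n = "DIM('a)"
  have [measurable]: "{x. g x \<le> \<rho> (\<pi> x)} \<in> sets borel" by measurable
  have \<alpha>: "emeasure ?\<alpha> B = emeasure lborel {x. g x \<le> \<rho> (\<pi> x) \<and> \<pi> x \<in> B}" if B [measurable]: "B \<in> sets borel" for B
  proof -
    have "\<pi> -` B \<in> sets borel" using measurable_sets_borel[OF radial_proj_borel B] .
    then have "emeasure ?\<alpha> B = (\<integral>\<^sup>+x. indicator {x. g x \<le> \<rho> (\<pi> x)} x * indicator (\<pi> -` B) x \<partial>lborel)"
      by (simp add: emeasure_distr emeasure_density)
    also have "\<dots> = (\<integral>\<^sup>+x. indicator {x. g x \<le> \<rho> (\<pi> x) \<and> \<pi> x \<in> B} x \<partial>lborel)"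
      by (intro nn_integral_cong) (auto simp: indicator_def)
    also have "\<dots> = emeasure lborel {x. g x \<le> \<rho> (\<pi> x) \<and> \<pi> x \<in> B}"
      by (rule nn_integral_indicator) measurable
    finally show ?thesis .
  qed
  have \<beta>: "emeasure ?\<beta> B = (\<integral>\<^sup>+y. ennreal (\<rho> y ^ ?n) * indicator B y \<partial>cone_measure K)" if "B \<in> sets borel" for B
    using that by (subst emeasure_density) auto
  show "sets ?\<alpha> = sets ?\<beta>" by simp
  fix A assume "A \<in> sets ?\<alpha>"
  then have A: "A \<in> sets borel" by simp
  have comp: "emeasure ?\<alpha> A \<le> ennreal \<theta>' * emeasure ?\<beta> A \<and> emeasure ?\<beta> A \<le> ennreal \<theta>' * emeasure ?\<alpha> A"
    if \<theta>': "\<theta>' > 1" for \<theta>'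
  proof -
    \<comment> \<open>Volumes scale with the power \<open>DIM('a)\<close>, so the corresponding root
      is taken.\<close>
    define \<theta> where "\<theta> = root ?n \<theta>'"
    have \<theta>: "\<theta> > 1" "\<theta> ^ ?n = \<theta>'" using \<theta>' by (auto simp: \<theta>_def real_root_pow_pos2)
    \<comment> \<open>Geometric levels of \<open>\<rho>\<close>; as they start at the lower bound
      \<open>c\<close>, natural exponents reach all values.\<close>
    define U where "U i = {y. c * \<theta> ^ i \<le> \<rho> y \<and> \<rho> y < c * \<theta> ^ Suc i}" for i :: nat
    have U [measurable]: "U i \<in> sets borel" for i unfolding U_def by measurable
    have "(\<Union>i. U i) = UNIV"
    proof (intro equalityI subsetI UNIV_I)
      fix y
      obtain m where m: "\<rho> y / c < \<theta> ^ m" using real_arch_pow[OF \<theta>(1)] by blast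
      define k where "k = (LEAST m. \<rho> y / c < \<theta> ^ m)"
      have k: "\<rho> y / c < \<theta> ^ k" "\<And>j. j < k \<Longrightarrow> \<not> \<rho> y / c < \<theta> ^ j"
        using m unfolding k_def by (auto intro: LeastI dest: not_less_Least)
      have "k \<noteq> 0" using k(1) c(1) c(2)[of y] by (auto simp: field_simps intro!: Nat.gr0I)
      then have "\<not> \<rho> y / c < \<theta> ^ (k - 1)" using k(2) by simp
      then have "y \<in> U (k - 1)" using k(1) c(1) \<open>k \<noteq> 0\<close> by (simp add: U_def field_simps)
      then show "y \<in> (\<Union>i. U i)" by blast
    qed
    then have cov: "A \<subseteq> (\<Union>i. U i)" by simp
    have loc: "emeasure ?\<alpha> B \<le> ennreal \<theta>' * emeasure ?\<beta> B \<and> emeasure ?\<beta> B \<le> ennreal \<theta>' * emeasure ?\<alpha> B"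
      if B [measurable]: "B \<in> sets borel" and sub: "B \<subseteq> U i" for i B
    proof -
      define s where "s = c * \<theta> ^ i"
      have s: "s > 0" using c \<theta> by (simp add: s_def)
      have \<rho>B: "s \<le> \<rho> y" "\<rho> y \<le> s * \<theta>" if "y \<in> B" for y
        using sub that by (auto simp: U_def s_def mult_ac)
      have s\<theta>: "s * \<theta> > 0" using s \<theta> by simp
      define m where "m = emeasure (cone_measure K) B"
      have pw: "ennreal ((s * \<theta>) ^ ?n) * m = ennreal \<theta>' * (ennreal (s ^ ?n) * m)"
        using s \<theta> \<theta>' by (simp add: power_mult_distrib ennreal_mult mult_ac)
      have 1: "ennreal (s ^ ?n) * m \<le> emeasure ?\<alpha> B"
        unfolding m_def emeasure_gauge_le_scale[OF B s, symmetric] \<alpha>[OF B]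
        using \<rho>B by (intro emeasure_mono) (auto intro: order_trans)
      have 2: "emeasure ?\<alpha> B \<le> ennreal ((s * \<theta>) ^ ?n) * m"
        unfolding m_def emeasure_gauge_le_scale[OF B s\<theta>, symmetric] \<alpha>[OF B]
        using \<rho>B by (intro emeasure_mono) (auto intro: order_trans)
      have int: "(\<integral>\<^sup>+y. ennreal d * indicator B y \<partial>cone_measure K) = ennreal d * m" for d
        unfolding m_def by (rule nn_integral_cmult_indicator) simp
      have 3: "ennreal (s ^ ?n) * m \<le> emeasure ?\<beta> B"
        unfolding int[symmetric] \<beta>[OF B] using \<rho>B s
        by (intro nn_integral_mono) (auto simp: indicator_def intro!: ennreal_leI power_mono)
      have 4: "emeasure ?\<beta> B \<le> ennreal ((s * \<theta>) ^ ?n) * m"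
      proof -
        have "\<rho> y ^ ?n \<le> (s * \<theta>) ^ ?n" if "y \<in> B" for y
          using \<rho>B[OF that] s by (intro power_mono) auto
        then show ?thesis
          unfolding int[symmetric] \<beta>[OF B]
          by (intro nn_integral_mono) (auto simp: indicator_def intro!: ennreal_leI)
      qed
      show ?thesis
        using 2 3 4 1 unfolding pw
        by (meson mult_left_mono order_trans zero_le)
    qed
    have "emeasure ?\<alpha> A \<le> ennreal \<theta>' * emeasure ?\<beta> A"
      using loc A by (intro emeasure_le_countable_cover[OF _ _ cov]) auto
    moreover have "emeasure ?\<beta> A \<le> ennreal \<theta>' * emeasure ?\<alpha> A"
      using loc A by (intro emeasure_le_countable_cover[OF _ _ cov]) auto
    ultimately show ?thesis by blast
  qed
  show "emeasure ?\<alpha> A = emeasure ?\<beta> A"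
  proof (rule antisym)
    show "emeasure ?\<alpha> A \<le> emeasure ?\<beta> A"
      by (rule ennreal_le_mult_all_gt_1) (use comp in blast)
    show "emeasure ?\<beta> A \<le> emeasure ?\<alpha> A"
      by (rule ennreal_le_mult_all_gt_1) (use comp in blast)
  qed
qed

lemma nn_integral_radial_perturbation:
  assumes [measurable]: "\<rho> \<in> borel_measurable borel" "f \<in> borel_measurable borel"
    and c: "c > 0" "\<And>y. c \<le> \<rho> y"
  shows "(\<integral>\<^sup>+x. indicator {x. g x \<le> \<rho> (\<pi> x)} x * f (\<pi> x) \<partial>lborel)
       = (\<integral>\<^sup>+x. indicator K x * (ennreal (\<rho> (\<pi> x) ^ DIM('a)) * f (\<pi> x)) \<partial>lborel)"
proof -
  have [measurable]: "{x. g x \<le> \<rho> (\<pi> x)} \<in> sets borel" by measurable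
  have "(\<integral>\<^sup>+x. indicator {x. g x \<le> \<rho> (\<pi> x)} x * f (\<pi> x) \<partial>lborel)
      = (\<integral>\<^sup>+y. f y \<partial>distr (density lborel (indicator {x. g x \<le> \<rho> (\<pi> x)})) borel \<pi>)"
    by (simp add: nn_integral_distr nn_integral_density)
  also have "\<dots> = (\<integral>\<^sup>+y. f y \<partial>density (cone_measure K) (\<lambda>y. ennreal (\<rho> y ^ DIM('a))))"
    by (simp only: radial_perturbation_measure[OF assms(1) c])
  also have "\<dots> = (\<integral>\<^sup>+y. ennreal (\<rho> y ^ DIM('a)) * f y \<partial>cone_measure K)"
    by (rule nn_integral_density) measurable
  also have "\<dots> = (\<integral>\<^sup>+x. indicator K x * (ennreal (\<rho> (\<pi> x) ^ DIM('a)) * f (\<pi> x)) \<partial>lborel)"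
    by (rule nn_integral_cone_measure) measurable
  finally show ?thesis .
qed

end

subsection \<open>First variation of the measure\<close>

text \<open>A second-order remainder with a crude constant, chosen so that the induction step
  reduces to \<open>2 * 4 ^ n + n \<le> 4 ^ Suc n\<close>.\<close>

lemma power_one_plus_approx:
  fixes z :: real
  assumes "\<bar>z\<bar> \<le> 1"
  shows "\<bar>(1 + z) ^ n - 1 - real n * z\<bar> \<le> 4 ^ n * z\<^sup>2"
proof (induction n)
  case (Suc n)
  define E where "E = (1 + z) ^ n - 1 - real n * z"
  have "(1 + z) ^ Suc n - 1 - real (Suc n) * z = (1 + z) * E + real n * z\<^sup>2"
    by (simp add: E_def algebra_simps power2_eq_square)
  also have "\<bar>\<dots>\<bar> \<le> \<bar>1 + z\<bar> * \<bar>E\<bar> + real n * z\<^sup>2"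
    by (rule order_trans[OF abs_triangle_ineq]) (simp add: abs_mult)
  also have "\<dots> \<le> 2 * (4 ^ n * z\<^sup>2) + 4 ^ n * z\<^sup>2"
  proof (rule add_mono)
    show "\<bar>1 + z\<bar> * \<bar>E\<bar> \<le> 2 * (4 ^ n * z\<^sup>2)"
      using assms Suc.IH by (intro mult_mono) (auto simp: E_def)
    have "real n \<le> 2 ^ n" using of_nat_less_two_power[of n, where 'a=real] by simp
    also have "\<dots> \<le> 4 ^ n" by (rule power_mono) auto
    finally have "real n \<le> 4 ^ n" .
    then show "real n * z\<^sup>2 \<le> 4 ^ n * z\<^sup>2" by (intro mult_right_mono) auto
  qed
  also have "\<dots> \<le> 4 ^ Suc n * z\<^sup>2" by simp
  finally show ?case .
qed simp

lemma power_diff_le: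
  fixes z :: real
  assumes "0 \<le> z" "z \<le> 1"
  shows "(1 + z) ^ n - (1 - z) ^ n \<le> 2 * (real n + 4 ^ n) * z"
proof -
  have "z\<^sup>2 \<le> z" using assms by (simp add: power2_eq_square mult_left_le)
  then have "4 ^ n * z\<^sup>2 \<le> 4 ^ n * z" by (intro mult_left_mono) auto
  moreover have "(1 + z) ^ n \<le> 1 + real n * z + 4 ^ n * z\<^sup>2"
    using power_one_plus_approx[of z n] assms by (simp add: abs_le_iff)
  moreover have "1 - real n * z - 4 ^ n * z\<^sup>2 \<le> (1 - z) ^ n"
    using power_one_plus_approx[of "- z" n] assms by (simp add: abs_le_iff)
  ultimately have "(1 + z) ^ n - (1 - z) ^ n \<le> 2 * (real n * z) + 2 * (4 ^ n * z)" by linarith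
  then show ?thesis by (simp add: algebra_simps)
qed

text \<open>Both sides measure the union; the additive form avoids subtraction of extended
  reals.\<close>

lemma emeasure_Un_Diff_swap:
  assumes "A \<in> sets M" "B \<in> sets M"
  shows "emeasure M A + emeasure M (B - A) = emeasure M B + emeasure M (A - B)"
proof -
  have "emeasure M A + emeasure M (B - A) = emeasure M (A \<union> (B - A))"
    using assms by (intro plus_emeasure) auto
  moreover have "emeasure M B + emeasure M (A - B) = emeasure M (B \<union> (A - B))"
    using assms by (intro plus_emeasure) auto
  moreover have "A \<union> (B - A) = B \<union> (A - B)" by blast
  ultimately show ?thesis by simp
qed

context origin_body
begin

text \<open>With \<open>u\<close> the normal at \<open>\<pi> x\<close>, the product
  \<open>g x * k\<close> is \<open>u \<bullet> x\<close>, hence at most the support function of the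
  sum. Bernoulli's inequality then replaces the p-th root by its tangent, which is affine in
  \<open>t\<close>.\<close>

lemma lp_sum_subset_radial:
  assumes p: "p \<ge> 1" and t: "0 < t" "t < 1" and L: "L \<in> convex_bodies_o"
    and M: "lp_sum p (1 - t) K t L \<in> convex_bodies_o"
    and x: "x \<in> lp_sum p (1 - t) K t L" "\<pi> x \<in> gauss_domain K"
  shows "g x \<le> 1 + t * (((support_fun L (normal_field K (\<pi> x)) / support_fun K (normal_field K (\<pi> x))) powr p - 1) / p)"
proof -
  interpret L: origin_body L by standard fact
  interpret M: origin_body "lp_sum p (1 - t) K t L" by standard fact
  define u where "u = normal_field K (\<pi> x)"
  define k where "k = support_fun K u"
  define l where "l = support_fun L u"
  define q where "q = (l / k) powr p"
  have u: "u = gauss_map K (\<pi> x)" using x(2) by (simp add: u_def normal_field_eq)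
  have k: "k = \<pi> x \<bullet> u" using support_fun_gauss_map[OF x(2)] by (simp add: k_def u)
  have "norm u = 1" using norm_gauss_map[OF x(2)] by (simp add: u)
  then have k0: "k > 0" unfolding k_def by (intro support_fun_pos) auto
  have l0: "l \<ge> 0" unfolding l_def by (rule L.support_fun_nonneg)
  have "g x * k = u \<bullet> x"
    by (metis k inner_commute inner_scaleR_left scaleR_radial_proj)
  also have "\<dots> \<le> support_fun (lp_sum p (1 - t) K t L) u"
    by (rule support_fun_upper[OF M.compact_K x(1)])
  also have "\<dots> = ((1 - t) * k powr p + t * l powr p) powr (1 / p)"
    using p t L K by (simp add: support_fun_lp_sum lp_mean_def k_def l_def)
  also have "(1 - t) * k powr p + t * l powr p = k powr p * (1 + t * (q - 1))"
    using k0 l0 by (simp add: q_def powr_divide field_simps)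
  also have "(k powr p * (1 + t * (q - 1))) powr (1 / p) = k * (1 + t * (q - 1)) powr (1 / p)"
    using k0 p by (simp add: powr_mult powr_powr)
  also have "\<dots> \<le> k * (1 + t * (q - 1) / p)"
  proof (intro mult_left_mono Bernoulli_powr_inverse p)
    have "t * q \<ge> 0" using t by (simp add: q_def)
    then show "- 1 \<le> t * (q - 1)" using t by (simp add: right_diff_distrib)
  qed (use k0 in simp)
  finally have "k * g x \<le> k * (1 + t * (q - 1) / p)" by (simp add: mult.commute)
  then have "g x \<le> 1 + t * (q - 1) / p" using k0 by simp
  then show ?thesis by (simp add: q_def k_def l_def u_def)
qed

text \<open>The upper half of the first variation formula: by the hypothesis on the integrals the
  first-order term is nonpositive, and the remaining error is at most \<open>\<eta> * t\<close>. The
  sum is enclosed, up to a null set, in the radial set \<open>E\<close>. There the density is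
  replaced by \<open>\<psi>\<close>, its boundary value continued along rays, to which the volume
  formula for radial sets applies. The replacement is made only on the symmetric difference of
  \<open>E\<close> and \<open>K\<close>, because the density may be unbounded near the
  origin.\<close>

lemma measure_lp_sum_upper:
  assumes p: "p \<ge> 1" and L: "L \<in> convex_bodies_o"
    and \<phi>_cont: "continuous_on (- {0}) \<phi>" and \<phi>_nonneg: "\<And>x. \<phi> x \<ge> 0" and \<phi>0: "\<phi> 0 = 0"
    and \<phi> [measurable]: "\<phi> \<in> borel_measurable borel"
    and fin: "emeasure (density lborel (\<lambda>x. ennreal (\<phi> x))) K < top"
    and le: "(\<integral>\<^sup>+x. indicator K x * ennreal ((support_fun L (normal_field K (\<pi> x)) / support_fun K (normal_field K (\<pi> x))) powr p * \<phi> (\<pi> x)) \<partial>lborel)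
      \<le> (\<integral>\<^sup>+x. indicator K x * ennreal ((support_fun K (normal_field K (\<pi> x)) / support_fun K (normal_field K (\<pi> x))) powr p * \<phi> (\<pi> x)) \<partial>lborel)"
    and \<eta>: "\<eta> > 0"
  obtains t0 where "t0 > 0"
    "\<And>t. 0 < t \<Longrightarrow> t < t0 \<Longrightarrow> t < 1 \<Longrightarrow> lp_sum p (1 - t) K t L \<in> convex_bodies_o \<Longrightarrow>
       measure (density lborel (\<lambda>x. ennreal (\<phi> x))) (lp_sum p (1 - t) K t L)
         \<le> measure (density lborel (\<lambda>x. ennreal (\<phi> x))) K + \<eta> * t"
proof -
  interpret L: origin_body L by standard fact
  define \<mu> where "\<mu> = density lborel (\<lambda>x. ennreal (\<phi> x))"
  let ?n = "DIM('a)"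
  let ?N = "normal_field K"
  have [measurable]: "support_fun K \<in> borel_measurable borel" "support_fun L \<in> borel_measurable borel"
    by (intro borel_measurable_continuous_onI continuous_on_support_fun compact_K K_nonempty
        L.compact_K L.K_nonempty)+
  \<comment> \<open>\<open>q\<close> is the p-th power of the quotient of the support functions at
    the normal, and \<open>w\<close> below is the resulting radial speed: \<open>E\<close> has the
    radial function \<open>1 + t * w\<close> relative to \<open>K\<close>.\<close>
  define q where "q y = (support_fun L (?N y) / support_fun K (?N y)) powr p" for y
  have [measurable]: "q \<in> borel_measurable borel" unfolding q_def[abs_def] by measurable
  define w where "w y = (q y - 1) / p" for y
  have [measurable]: "w \<in> borel_measurable borel" unfolding w_def[abs_def] by measurable
  obtain r where r: "r > 0" "cball 0 r \<subseteq> K" by (rule inner_radius)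
  obtain R where R: "R > 0" "\<And>y. y \<in> K \<Longrightarrow> norm y \<le> R" using outer_radius by blast
  obtain R' where R': "R' > 0" "\<And>y. y \<in> L \<Longrightarrow> norm y \<le> R'" using L.outer_radius by blast
  have "\<exists>Q\<ge>0. \<forall>y. q y \<le> Q"
  proof (intro exI conjI allI)
    show "(R' / r) powr p \<ge> 0" by simp
    fix y
    show "q y \<le> (R' / r) powr p"
    proof (cases "?N y = 0")
      case True
      \<comment> \<open>Off the Gauss domain the normal field is 0, and so is
        \<open>q\<close>.\<close>
      have "support_fun L 0 = 0" using support_fun_scaleR[OF L.compact_K L.K_nonempty, of 0 0] by simp
      then show ?thesis using True by (simp add: q_def)
    next
      case False
      have "(r / norm (?N y)) *\<^sub>R ?N y \<in> K" using r False by auto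
      then have "?N y \<bullet> ((r / norm (?N y)) *\<^sub>R ?N y) \<le> support_fun K (?N y)"
        by (rule support_fun_upper[OF compact_K])
      moreover have "?N y \<bullet> ((r / norm (?N y)) *\<^sub>R ?N y) = r * norm (?N y)"
        using False by (simp add: dot_square_norm power2_eq_square)
      ultimately have k: "r * norm (?N y) \<le> support_fun K (?N y)" by simp
      have l: "support_fun L (?N y) \<le> R' * norm (?N y)"
        by (rule support_fun_le_norm[OF L.K_nonempty R'(2)])
      have "support_fun L (?N y) / support_fun K (?N y) \<le> (R' * norm (?N y)) / (r * norm (?N y))"
        using k l r R' False L.support_fun_nonneg by (intro frac_le) auto
      also have "\<dots> = R' / r" using False by simp
      finally show ?thesis
        unfolding q_def using p L.support_fun_nonneg support_fun_nonneg by (intro powr_mono2) auto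
    qed
  qed
  then obtain Q where Q: "Q \<ge> 0" "\<And>y. q y \<le> Q" by blast
  have q0: "q y \<ge> 0" for y by (simp add: q_def)
  define W where "W = Q + 2"
  have W: "W > 0" "\<And>y. \<bar>w y\<bar> < W"
  proof -
    show "W > 0" using Q by (simp add: W_def)
    fix y
    have "\<bar>q y - 1\<bar> \<le> Q + 1" using q0[of y] Q by (simp add: abs_le_iff add_increasing)
    moreover have "\<bar>w y\<bar> \<le> \<bar>q y - 1\<bar>" using p mult_left_mono[of 1 p "\<bar>q y - 1\<bar>"] by (simp add: w_def divide_le_eq)
    ultimately show "\<bar>w y\<bar> < W" by (simp add: W_def)
  qed
  have "continuous_on (frontier K) \<phi>"
    by (rule continuous_on_subset[OF \<phi>_cont]) (use frontier_nonzero in auto)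
  then have "compact (\<phi> ` frontier K)"
    by (intro compact_continuous_image compact_frontier compact_K)
  then obtain B where B: "B > 0" "\<And>y. y \<in> frontier K \<Longrightarrow> \<phi> y \<le> B"
    using compact_imp_bounded[of "\<phi> ` frontier K"] unfolding bounded_pos by fastforce
  define \<psi> where "\<psi> x = \<phi> (\<pi> x)" for x
  have \<psi>_B: "\<psi> x \<le> B" for x
    using B radial_proj_frontier[of x] by (cases "x = 0") (auto simp: \<psi>_def \<phi>0)
  have \<psi>_nonneg: "\<psi> x \<ge> 0" for x by (simp add: \<psi>_def \<phi>_nonneg)
  have [measurable]: "\<psi> \<in> borel_measurable borel" unfolding \<psi>_def[abs_def] by measurable
  have K_fin: "emeasure lborel K < top"
    by (intro emeasure_lborel_bounded_finite compact_imp_bounded compact_K)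
  define V where "V = measure lborel K"
  have V: "V \<ge> 0" "emeasure lborel K = ennreal V"
    using K_fin by (auto simp: V_def emeasure_eq_ennreal_measure)
  \<comment> \<open>\<open>C1 * t\<^sup>2\<close> bounds the quadratic remainder of the radial
    expansion, and \<open>C2 * t\<close> the volume of the shell.\<close>
  define C1 where "C1 = 4 ^ ?n * W\<^sup>2 * (B * V)"
  define C2 where "C2 = 2 * (real ?n + 4 ^ ?n) * W * V"
  have C: "C1 \<ge> 0" "C2 \<ge> 0" using W B V by (auto simp: C1_def C2_def)
  \<comment> \<open>The error \<open>\<eta> * t\<close> is split into halves, one for the density
    error on the shell and one for the quadratic remainder.\<close>
  define \<epsilon> where "\<epsilon> = \<eta> / (2 * (C2 + 1))"
  have \<epsilon>: "\<epsilon> > 0" "\<epsilon> * C2 \<le> \<eta> / 2"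
  proof -
    show "\<epsilon> > 0" using \<eta> C by (simp add: \<epsilon>_def)
    have "\<epsilon> * C2 \<le> \<epsilon> * (C2 + 1)" using \<open>\<epsilon> > 0\<close> by (intro mult_left_mono) auto
    also have "\<dots> = \<eta> / 2"
    proof -
      have cancel: "\<eta> / (2 * c) * c = \<eta> / 2" if "c \<noteq> 0" for c :: real using that by simp
      have "C2 + 1 \<noteq> 0" using C by linarith
      then show ?thesis unfolding \<epsilon>_def by (rule cancel)
    qed
    finally show "\<epsilon> * C2 \<le> \<eta> / 2" .
  qed
  \<comment> \<open>A compact neighbourhood of the boundary that avoids the origin, so that the
    density is uniformly continuous on it.\<close>
  define S0 where "S0 = {x. 1 / 2 \<le> g x \<and> g x \<le> 2}"
  have "closed S0"
    unfolding S0_def by (intro closed_Collect_conj closed_Collect_le continuous_on_gauge continuous_intros)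
  moreover have "bounded S0"
    unfolding bounded_iff
  proof (intro exI ballI)
    fix x assume "x \<in> S0"
    then have "R * g x \<le> R * 2" using R by (intro mult_left_mono) (auto simp: S0_def)
    then show "norm x \<le> R * 2" using gauge_ge_norm[OF R(2,1), of x] by linarith
  qed
  moreover have "continuous_on S0 \<phi>"
    by (rule continuous_on_subset[OF \<phi>_cont]) (auto simp: S0_def)
  ultimately have "uniformly_continuous_on S0 \<phi>"
    by (intro compact_uniformly_continuous) (simp_all add: compact_eq_bounded_closed)
  then obtain \<delta> where \<delta>: "\<delta> > 0"
    "\<And>x x'. x \<in> S0 \<Longrightarrow> x' \<in> S0 \<Longrightarrow> dist x' x < \<delta> \<Longrightarrow> dist (\<phi> x') (\<phi> x) < \<epsilon>"
    unfolding uniformly_continuous_on_def using \<epsilon>(1) by metis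
  \<comment> \<open>The three bounds keep the shell inside \<open>S0\<close>, bring its points
    within \<open>\<delta>\<close> of their radial projections, and keep the quadratic remainder
    within its half of the error.\<close>
  define t0 where "t0 = Min {1 / (2 * W), \<delta> / (W * R), \<eta> / (2 * (C1 + 1))}"
  show thesis
  proof (rule that[of t0], unfold \<mu>_def[symmetric])
    show "t0 > 0" using W \<delta> R \<eta> C by (simp add: t0_def)
    fix t :: real
    assume t: "0 < t" "t < t0" "t < 1" and M: "lp_sum p (1 - t) K t L \<in> convex_bodies_o"
    define X where "X = lp_sum p (1 - t) K t L"
    interpret M: origin_body X unfolding X_def by standard fact
    have t1: "t * W < 1 / 2" and t2: "t * W * R < \<delta>" and t3: "t * C1 \<le> \<eta> / 2"
    proof -
      have "t < 1 / (2 * W)" "t < \<delta> / (W * R)" "t < \<eta> / (2 * (C1 + 1))"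
        using t(2) by (auto simp: t0_def)
      then show "t * W < 1 / 2" "t * W * R < \<delta>" using W(1) R(1) by (simp_all add: field_simps)
      have "t * (2 * (C1 + 1)) < \<eta>"
        using \<open>t < \<eta> / (2 * (C1 + 1))\<close> C by (simp add: pos_less_divide_eq)
      then show "t * C1 \<le> \<eta> / 2" using t(1) by (simp add: algebra_simps)
    qed
    define \<rho> where "\<rho> y = 1 + t * w y" for y
    have [measurable]: "\<rho> \<in> borel_measurable borel" unfolding \<rho>_def[abs_def] by measurable
    have tw: "\<bar>t * w y\<bar> < t * W" for y using W(2)[of y] t by (simp add: abs_mult)
    have \<rho>: "1 - t * W < \<rho> y" "\<rho> y < 1 + t * W" "1 / 2 \<le> \<rho> y" for y
      using tw[of y] t1 by (auto simp: \<rho>_def abs_less_iff)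
    define E where "E = {x. g x \<le> \<rho> (\<pi> x)}"
    have E [measurable]: "E \<in> sets borel" unfolding E_def by measurable
    \<comment> \<open>As the radial speed is bounded by \<open>W\<close>, a point in exactly one of
      \<open>E\<close> and \<open>K\<close> has gauge within \<open>t * W\<close> of 1.\<close>
    define S where "S = {x. g x \<le> 1 + t * W} - {x. g x \<le> 1 - t * W}"
    have S [measurable]: "S \<in> sets borel" unfolding S_def by measurable
    have DS: "E - K \<subseteq> S" and CS: "K - E \<subseteq> S"
      using \<rho> t W(1) by (auto simp: E_def S_def gauge_le_1_iff not_le intro: less_imp_le order_trans less_trans)
        (smt (verit) \<rho> mult_pos_pos)+
    have vol: "emeasure lborel {x. g x \<le> s} = ennreal (s ^ ?n * V)" if "s > 0" for s
      using emeasure_gauge_le_scale[of UNIV s] that V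
      by (simp add: emeasure_cone_measure ennreal_mult)
    have S_vol: "emeasure lborel S = ennreal (((1 + t * W) ^ ?n - (1 - t * W) ^ ?n) * V)"
    proof -
      have "emeasure lborel S = emeasure lborel {x. g x \<le> 1 + t * W} - emeasure lborel {x. g x \<le> 1 - t * W}"
      proof -
        have "1 - t * W \<le> 1 + t * W" "1 - t * W > 0" using mult_pos_pos[OF t(1) W(1)] t1 by linarith+
        then have "{x. g x \<le> 1 - t * W} \<subseteq> {x. g x \<le> 1 + t * W}" by (auto intro: order_trans)
        with \<open>1 - t * W > 0\<close> show ?thesis
          unfolding S_def by (intro emeasure_Diff) (auto simp: vol)
      qed
      also have "\<dots> = ennreal ((1 + t * W) ^ ?n * V - (1 - t * W) ^ ?n * V)"
      proof -
        have "1 + t * W > 0" "1 - t * W > 0" using mult_pos_pos[OF t(1) W(1)] t1 by linarith+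
        then show ?thesis using V by (simp add: vol ennreal_minus)
      qed
      finally show ?thesis by (simp add: left_diff_distrib)
    qed
    have S_vol_le: "measure lborel S \<le> C2 * t"
    proof -
      have tW: "0 \<le> t * W" "t * W \<le> 1" using t W t1 by auto
      have "0 \<le> (1 + t * W) ^ ?n - (1 - t * W) ^ ?n"
        using tW by (simp add: power_mono)
      then have "measure lborel S = ((1 + t * W) ^ ?n - (1 - t * W) ^ ?n) * V"
        using V by (simp add: measure_def S_vol)
      also have "\<dots> \<le> (2 * (real ?n + 4 ^ ?n) * (t * W)) * V"
        using power_diff_le[OF tW] V by (intro mult_right_mono) auto
      finally show ?thesis by (simp add: C2_def mult_ac)
    qed
    have S_fin: "emeasure lborel S < top" by (simp add: S_vol)
    have near: "\<bar>\<phi> x - \<psi> x\<bar> < \<epsilon>" if "x \<in> S" for x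
    proof -
      have gx: "\<bar>g x - 1\<bar> \<le> t * W" using that by (auto simp: S_def abs_le_iff)
      then have x0: "x \<noteq> 0" using t1 by (auto simp: abs_le_iff)
      have "x \<in> S0" using gx t1 by (auto simp: S0_def abs_le_iff)
      moreover have fr: "\<pi> x \<in> frontier K" by (rule radial_proj_frontier[OF x0])
      then have "\<pi> x \<in> S0" by (simp add: S0_def frontier_eq_gauge)
      moreover have "dist x (\<pi> x) < \<delta>"
      proof -
        have "x - \<pi> x = (g x - 1) *\<^sub>R \<pi> x" by (simp add: scaleR_diff_left scaleR_radial_proj)
        then have "dist x (\<pi> x) = \<bar>g x - 1\<bar> * norm (\<pi> x)" by (simp add: dist_norm)
        also have "\<dots> \<le> (t * W) * R"
          using gx R fr frontier_subset_K t W(1) by (intro mult_mono) auto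
        finally show ?thesis using t2 by simp
      qed
      ultimately show ?thesis using \<delta>(2)[of "\<pi> x" x] by (simp add: \<psi>_def dist_real_def)
    qed
    \<comment> \<open>The density is constant along rays, so that the formula for radial
      perturbations applies to \<open>E\<close>.\<close>
    define J where "J = density lborel (\<lambda>x. ennreal (\<psi> x))"
    have sets_J: "sets J = sets borel" "sets \<mu> = sets borel" by (auto simp: J_def \<mu>_def)
    have J_eq: "emeasure J A = (\<integral>\<^sup>+x. ennreal (\<psi> x) * indicator A x \<partial>lborel)" if "A \<in> sets borel" for A
      unfolding J_def using that by (subst emeasure_density) auto
    have \<mu>_eq: "emeasure \<mu> A = (\<integral>\<^sup>+x. ennreal (\<phi> x) * indicator A x \<partial>lborel)" if "A \<in> sets borel" for A
      unfolding \<mu>_def using that by (subst emeasure_density) auto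
    have add_\<epsilon>: "(\<integral>\<^sup>+x. (ennreal (f x) + ennreal \<epsilon>) * indicator A x \<partial>lborel)
        = (\<integral>\<^sup>+x. ennreal (f x) * indicator A x \<partial>lborel) + ennreal \<epsilon> * emeasure lborel A"
      if [measurable]: "A \<in> sets borel" "f \<in> borel_measurable borel" for A and f :: "'a \<Rightarrow> real"
    proof -
      have "(\<integral>\<^sup>+x. (ennreal (f x) + ennreal \<epsilon>) * indicator A x \<partial>lborel)
          = (\<integral>\<^sup>+x. ennreal (f x) * indicator A x + ennreal \<epsilon> * indicator A x \<partial>lborel)"
        by (simp add: distrib_right)
      also have "\<dots> = (\<integral>\<^sup>+x. ennreal (f x) * indicator A x \<partial>lborel) + (\<integral>\<^sup>+x. ennreal \<epsilon> * indicator A x \<partial>lborel)"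
        by (rule nn_integral_add) measurable
      finally show ?thesis using that by (simp add: nn_integral_cmult_indicator)
    qed
    have \<mu>J: "emeasure \<mu> A \<le> emeasure J A + ennreal \<epsilon> * emeasure lborel A"
      and J\<mu>: "emeasure J A \<le> emeasure \<mu> A + ennreal \<epsilon> * emeasure lborel A"
      if A: "A \<in> sets borel" "A \<subseteq> S" for A
    proof -
      have "ennreal (\<phi> x) \<le> ennreal (\<psi> x) + ennreal \<epsilon>" "ennreal (\<psi> x) \<le> ennreal (\<phi> x) + ennreal \<epsilon>"
        if "x \<in> A" for x
        using near[of x] that A(2) \<epsilon>(1) \<phi>_nonneg \<psi>_nonneg
        by (auto simp: ennreal_plus[symmetric] abs_less_iff simp del: ennreal_plus intro!: ennreal_leI)
      then have "(\<integral>\<^sup>+x. ennreal (\<phi> x) * indicator A x \<partial>lborel) \<le> (\<integral>\<^sup>+x. (ennreal (\<psi> x) + ennreal \<epsilon>) * indicator A x \<partial>lborel)"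
        "(\<integral>\<^sup>+x. ennreal (\<psi> x) * indicator A x \<partial>lborel) \<le> (\<integral>\<^sup>+x. (ennreal (\<phi> x) + ennreal \<epsilon>) * indicator A x \<partial>lborel)"
        by (auto intro!: nn_integral_mono simp: indicator_def)
      then show "emeasure \<mu> A \<le> emeasure J A + ennreal \<epsilon> * emeasure lborel A"
        "emeasure J A \<le> emeasure \<mu> A + ennreal \<epsilon> * emeasure lborel A"
        using A(1) by (simp_all add: add_\<epsilon> J_eq \<mu>_eq)
    qed
    have J_fin: "emeasure J A \<le> ennreal B * emeasure lborel A" if A: "A \<in> sets borel" for A
    proof -
      have "emeasure J A \<le> (\<integral>\<^sup>+x. ennreal B * indicator A x \<partial>lborel)"
        unfolding J_eq[OF A] using \<psi>_B by (intro nn_integral_mono mult_right_mono ennreal_leI) auto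
      then show ?thesis using A by (simp add: nn_integral_cmult_indicator)
    qed
    have JK: "emeasure J K \<le> ennreal (B * V)"
      using J_fin[OF K_borel] V B by (simp add: ennreal_mult)
    have JK_fin: "emeasure J K < top" using JK by (meson ennreal_less_top le_less_trans)
    \<comment> \<open>The hypothesis on the integrals in terms of \<open>J\<close>: its right-hand
      side is \<open>emeasure J K\<close>, because the quotient there is 1 at almost every
      point.\<close>
    have J_int: "(\<integral>\<^sup>+x. indicator K x * ennreal (q (\<pi> x) * \<psi> x) \<partial>lborel) \<le> emeasure J K"
    proof -
      have "(\<integral>\<^sup>+x. indicator K x * ennreal ((support_fun K (?N (\<pi> x)) / support_fun K (?N (\<pi> x))) powr p * \<phi> (\<pi> x)) \<partial>lborel)
          = (\<integral>\<^sup>+x. ennreal (\<psi> x) * indicator K x \<partial>lborel)"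
      proof (rule nn_integral_cong_AE, rule AE_mp[OF radial_proj_gauss_domain_AE], rule AE_I2, rule impI)
        fix x assume "\<pi> x \<in> gauss_domain K"
        then have "norm (?N (\<pi> x)) = 1" by (simp add: normal_field_eq norm_gauss_map)
        then have "support_fun K (?N (\<pi> x)) > 0" by (intro support_fun_pos) auto
        then show "indicator K x * ennreal ((support_fun K (?N (\<pi> x)) / support_fun K (?N (\<pi> x))) powr p * \<phi> (\<pi> x))
            = ennreal (\<psi> x) * indicator K x"
          by (simp add: \<psi>_def mult.commute)
      qed
      then show ?thesis using le by (simp add: q_def \<psi>_def J_eq)
    qed
    \<comment> \<open>The first-order term is \<open>a * (q - 1)\<close> with
      \<open>a = real ?n * t / p\<close>. Its negative part is moved to the left, to stay within
      nonnegative quantities, and \<open>J_int\<close> bounds the positive part.\<close>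
    have JE: "emeasure J E + ennreal (real ?n * t / p) * emeasure J K
        \<le> emeasure J K + ennreal (real ?n * t / p) * emeasure J K + ennreal (4 ^ ?n * (t * W)\<^sup>2) * emeasure J K"
    proof -
      define a where "a = real ?n * t / p"
      define d where "d = 4 ^ ?n * (t * W)\<^sup>2"
      have a: "a \<ge> 0" using t p by (simp add: a_def)
      have d: "d \<ge> 0" by (simp add: d_def)
      have pt: "\<rho> y ^ ?n + a \<le> 1 + a * q y + d" for y
      proof -
        have "\<bar>t * w y\<bar> \<le> 1" using tw[of y] t1 by linarith
        from power_one_plus_approx[OF this, of ?n]
        have "\<rho> y ^ ?n \<le> 1 + real ?n * (t * w y) + 4 ^ ?n * (t * w y)\<^sup>2"
          unfolding \<rho>_def by linarith
        moreover have "(t * w y)\<^sup>2 \<le> (t * W)\<^sup>2"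
          using tw[of y] by (intro abs_le_square_iff[THEN iffD1]) auto
        then have "4 ^ ?n * (t * w y)\<^sup>2 \<le> d" unfolding d_def by (intro mult_left_mono) auto
        moreover have "real ?n * (t * w y) = a * q y - a" using p by (simp add: a_def w_def field_simps)
        ultimately show ?thesis by linarith
      qed
      have "emeasure J E = (\<integral>\<^sup>+x. indicator {x. g x \<le> \<rho> (\<pi> x)} x * ennreal (\<phi> (\<pi> x)) \<partial>lborel)"
        unfolding J_eq[OF E] by (simp add: E_def \<psi>_def mult.commute)
      also have "\<dots> = (\<integral>\<^sup>+x. indicator K x * (ennreal (\<rho> (\<pi> x) ^ ?n) * ennreal (\<phi> (\<pi> x))) \<partial>lborel)"
        by (rule nn_integral_radial_perturbation[of \<rho> "\<lambda>y. ennreal (\<phi> y)" "1 / 2"]) (use \<rho> in auto)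
      finally have "emeasure J E + ennreal a * emeasure J K
          = (\<integral>\<^sup>+x. indicator K x * (ennreal (\<rho> (\<pi> x) ^ ?n) * ennreal (\<psi> x)) \<partial>lborel)
            + (\<integral>\<^sup>+x. ennreal a * (ennreal (\<psi> x) * indicator K x) \<partial>lborel)"
        by (simp add: J_eq \<psi>_def[symmetric] nn_integral_cmult)
      also have "\<dots> = (\<integral>\<^sup>+x. indicator K x * (ennreal (\<rho> (\<pi> x) ^ ?n) * ennreal (\<psi> x))
            + ennreal a * (ennreal (\<psi> x) * indicator K x) \<partial>lborel)"
        by (rule nn_integral_add[symmetric]) measurable
      also have "\<dots> \<le> (\<integral>\<^sup>+x. ennreal (\<psi> x) * indicator K x + (ennreal a * (indicator K x * ennreal (q (\<pi> x) * \<psi> x))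
            + ennreal d * (ennreal (\<psi> x) * indicator K x)) \<partial>lborel)"
      proof (rule nn_integral_mono)
        fix x
        define y where "y = \<pi> x"
        have "(\<rho> y ^ ?n + a) * \<psi> x \<le> (1 + a * q y + d) * \<psi> x"
          using pt \<psi>_nonneg by (intro mult_right_mono) auto
        then have "ennreal (\<rho> y ^ ?n * \<psi> x + a * \<psi> x) \<le> ennreal (\<psi> x + (a * (q y * \<psi> x) + d * \<psi> x))"
          by (intro ennreal_leI) (simp add: algebra_simps)
        moreover have "0 \<le> \<rho> y ^ ?n" using \<rho>(3)[of y] by (intro zero_le_power) linarith
        ultimately have "ennreal (\<rho> y ^ ?n) * ennreal (\<psi> x) + ennreal a * ennreal (\<psi> x)
            \<le> ennreal (\<psi> x) + (ennreal a * ennreal (q y * \<psi> x) + ennreal d * ennreal (\<psi> x))"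
          using a d q0[of y] \<psi>_nonneg[of x] by (simp add: ennreal_mult'[symmetric] ennreal_plus[symmetric] del: ennreal_plus)
        then show "indicator K x * (ennreal (\<rho> (\<pi> x) ^ ?n) * ennreal (\<psi> x))
            + ennreal a * (ennreal (\<psi> x) * indicator K x)
          \<le> ennreal (\<psi> x) * indicator K x + (ennreal a * (indicator K x * ennreal (q (\<pi> x) * \<psi> x))
            + ennreal d * (ennreal (\<psi> x) * indicator K x))"
          by (auto simp: indicator_def y_def)
      qed
      also have "\<dots> = (\<integral>\<^sup>+x. ennreal (\<psi> x) * indicator K x \<partial>lborel)
          + ((\<integral>\<^sup>+x. ennreal a * (indicator K x * ennreal (q (\<pi> x) * \<psi> x)) \<partial>lborel)
            + (\<integral>\<^sup>+x. ennreal d * (ennreal (\<psi> x) * indicator K x) \<partial>lborel))"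
        by (simp add: nn_integral_add)
      also have "\<dots> = emeasure J K + (ennreal a * (\<integral>\<^sup>+x. indicator K x * ennreal (q (\<pi> x) * \<psi> x) \<partial>lborel)
            + ennreal d * emeasure J K)"
        by (simp add: nn_integral_cmult J_eq)
      also have "\<dots> \<le> emeasure J K + (ennreal a * emeasure J K + ennreal d * emeasure J K)"
        by (intro add_left_mono add_right_mono mult_left_mono J_int) auto
      finally show ?thesis by (simp add: a_def d_def add.assoc)
    qed
    have EK [measurable]: "E - K \<in> sets borel" "K - E \<in> sets borel" by measurable
    have fin_lb: "emeasure lborel A < top" if "A \<subseteq> S" for A
      using le_less_trans[OF emeasure_mono[OF that, of lborel] S_fin] by simp
    have J_fin': "emeasure J A < top" if "A \<subseteq> S" "A \<in> sets borel" for A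
      using le_less_trans[OF J_fin[OF that(2)], of top] fin_lb[OF that(1)]
      by (simp add: ennreal_mult_less_top)
    have \<mu>_fin: "emeasure \<mu> A < top" if "A \<subseteq> S" "A \<in> sets borel" for A
    proof -
      have "emeasure J A + ennreal \<epsilon> * emeasure lborel A < top"
        using J_fin'[OF that] fin_lb[OF that(1)] by (simp add: ennreal_mult_less_top)
      then show ?thesis using \<mu>J[OF that(2,1)] by (rule le_less_trans[rotated])
    qed
    have fK: "emeasure \<mu> K < top" using fin by (simp add: \<mu>_def)
    \<comment> \<open>The measures of \<open>E\<close> and \<open>K\<close> differ as those of
      \<open>E - K\<close> and \<open>K - E\<close> do, and the latter two sets lie in the
      shell.\<close>
    have swap\<mu>: "emeasure \<mu> E + emeasure \<mu> (K - E) = emeasure \<mu> K + emeasure \<mu> (E - K)"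
      and swapJ: "emeasure J E + emeasure J (K - E) = emeasure J K + emeasure J (E - K)"
      by (rule emeasure_Un_Diff_swap; simp add: sets_J)+
    have fE: "emeasure \<mu> E < top" "emeasure J E < top"
    proof -
      have "emeasure \<mu> E \<le> emeasure \<mu> K + emeasure \<mu> (E - K)"
        unfolding swap\<mu>[symmetric] by simp
      also have "\<dots> < top" using fK \<mu>_fin[OF DS EK(1)] by simp
      finally show "emeasure \<mu> E < top" .
      have "emeasure J E \<le> emeasure J K + emeasure J (E - K)"
        unfolding swapJ[symmetric] by simp
      also have "\<dots> < top" using JK_fin J_fin'[OF DS EK(1)] by simp
      finally show "emeasure J E < top" .
    qed
    have em: "emeasure M A = ennreal (measure M A)" if "emeasure M A < top" for M :: "'a measure" and A
      using that by (simp add: emeasure_eq_ennreal_measure)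
    note e\<mu>E = em[OF fE(1)] and eJE = em[OF fE(2)] and e\<mu>K = em[OF fK] and eJK = em[OF JK_fin]
      and e\<mu>D = em[OF \<mu>_fin[OF DS EK(1)]] and e\<mu>C = em[OF \<mu>_fin[OF CS EK(2)]]
      and eJD = em[OF J_fin'[OF DS EK(1)]] and eJC = em[OF J_fin'[OF CS EK(2)]]
      and elD = em[OF fin_lb[OF DS]] and elC = em[OF fin_lb[OF CS]]
    have 1: "measure \<mu> E + measure \<mu> (K - E) = measure \<mu> K + measure \<mu> (E - K)"
      using swap\<mu> unfolding e\<mu>E e\<mu>K e\<mu>D e\<mu>C by (simp add: ennreal_plus[symmetric] del: ennreal_plus)
    have 2: "measure J E + measure J (K - E) = measure J K + measure J (E - K)"
      using swapJ unfolding eJE eJK eJD eJC by (simp add: ennreal_plus[symmetric] del: ennreal_plus)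
    have 3: "measure \<mu> (E - K) \<le> measure J (E - K) + \<epsilon> * measure lborel (E - K)"
      using \<mu>J[OF EK(1) DS] \<epsilon>(1) unfolding e\<mu>D eJD elD
      by (simp add: ennreal_mult[symmetric] ennreal_plus[symmetric] del: ennreal_plus)
    have 4: "measure J (K - E) \<le> measure \<mu> (K - E) + \<epsilon> * measure lborel (K - E)"
      using J\<mu>[OF EK(2) CS] \<epsilon>(1) unfolding e\<mu>C eJC elC
      by (simp add: ennreal_mult[symmetric] ennreal_plus[symmetric] del: ennreal_plus)
    have 5: "measure lborel (E - K) + measure lborel (K - E) \<le> measure lborel S"
    proof -
      have "measure lborel (E - K) + measure lborel (K - E) = measure lborel ((E - K) \<union> (K - E))"
        using fin_lb[OF DS] fin_lb[OF CS] by (intro measure_Union[symmetric]) (auto simp: less_top)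
      also have "\<dots> \<le> measure lborel S"
        using DS CS S_fin by (intro measure_mono_fmeasurable) (auto simp: fmeasurable_def)
      finally show ?thesis .
    qed
    have 6: "measure J E \<le> measure J K + 4 ^ ?n * (t * W)\<^sup>2 * (B * V)"
    proof -
      have nt: "0 \<le> real ?n * t / p" using t p by simp
      have "measure J E + real ?n * t / p * measure J K
          \<le> measure J K + real ?n * t / p * measure J K + 4 ^ ?n * (t * W)\<^sup>2 * measure J K"
        using JE nt unfolding eJE eJK
        by (simp add: ennreal_mult[symmetric] ennreal_plus[symmetric] del: ennreal_plus)
      moreover have "measure J K \<le> B * V"
        using JK B V unfolding eJK by simp
      then have "4 ^ ?n * (t * W)\<^sup>2 * measure J K \<le> 4 ^ ?n * (t * W)\<^sup>2 * (B * V)"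
        by (intro mult_left_mono) auto
      ultimately show ?thesis by linarith
    qed
    have "measure \<mu> E - measure \<mu> K \<le> measure J E - measure J K
        + (\<epsilon> * measure lborel (E - K) + \<epsilon> * measure lborel (K - E))"
      using 1 2 3 4 by linarith
    moreover have "\<epsilon> * measure lborel (E - K) + \<epsilon> * measure lborel (K - E) \<le> \<epsilon> * (C2 * t)"
      using 5 S_vol_le \<epsilon>(1) by (simp add: distrib_left[symmetric])
    moreover have "\<epsilon> * (C2 * t) \<le> \<eta> / 2 * t"
      using mult_right_mono[OF \<epsilon>(2), of t] t(1) by (simp add: mult.assoc)
    moreover have "4 ^ ?n * (t * W)\<^sup>2 * (B * V) = t * C1 * t"
      by (simp add: C1_def power2_eq_square)
    moreover have "t * C1 * t \<le> \<eta> / 2 * t" using t3 t(1) by (intro mult_right_mono) auto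
    ultimately have final: "measure \<mu> E \<le> measure \<mu> K + \<eta> * t" using 6 by linarith
    \<comment> \<open>The radial bound concerns rays through the Gauss domain only, so the inclusion
      of \<open>X\<close> in \<open>E\<close> holds almost everywhere.\<close>
    have "emeasure \<mu> X \<le> emeasure \<mu> E"
    proof (rule emeasure_mono_AE)
      have "AE x in lborel. x \<in> X \<longrightarrow> x \<in> E"
      proof (rule AE_mp[OF radial_proj_gauss_domain_AE], rule AE_I2, intro impI)
        fix x assume "\<pi> x \<in> gauss_domain K" "x \<in> X"
        then have "g x \<le> 1 + t * (((support_fun L (?N (\<pi> x)) / support_fun K (?N (\<pi> x))) powr p - 1) / p)"
          using lp_sum_subset_radial[OF p t(1,3) L M] by (simp add: X_def)
        then show "x \<in> E" by (simp add: E_def \<rho>_def w_def q_def)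
      qed
      then show "AE x in \<mu>. x \<in> X \<longrightarrow> x \<in> E"
        unfolding \<mu>_def by (subst AE_density) auto
    qed (simp add: sets_J)
    then have "measure \<mu> X \<le> measure \<mu> E"
      unfolding measure_def using fE(1) by (intro enn2real_mono) auto
    then show "measure \<mu> (lp_sum p (1 - t) K t L) \<le> measure \<mu> K + \<eta> * t"
      using final by (simp add: X_def)
  qed
qed

end

subsection \<open>Equality in the concavity inequality\<close>

text \<open>Phrased with \<open>\<sigma> * F\<close>, which is increasing whether \<open>F\<close>
  increases or decreases; applying it to both sides of the concavity inequality eliminates the
  inverse of \<open>F\<close>.\<close>

lemma lp_F_concave_overD:
  assumes conc: "lp_F_concave_over p I F \<mu> C" and KL: "K \<in> C" "L \<in> C" and t: "0 < t" "t < 1"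
    and Z: "lp_sum p (1 - t) K t L \<in> C"
    and \<sigma>: "strict_mono_on I F \<and> \<sigma> = 1 \<or> strict_antimono_on I F \<and> \<sigma> = - 1"
  shows "\<sigma> * ((1 - t) * F (measure \<mu> K) + t * F (measure \<mu> L)) \<le> \<sigma> * F (measure \<mu> (lp_sum p (1 - t) K t L))"
proof -
  define v where "v = (1 - t) * F (measure \<mu> K) + t * F (measure \<mu> L)"
  let ?Z = "lp_sum p (1 - t) K t L"
  have I: "is_interval I" "continuous_on I F" and mem: "\<And>X. X \<in> C \<Longrightarrow> emeasure \<mu> X < top \<and> measure \<mu> X \<in> I"
    and ineq: "ennreal (inv_into I F v) \<le> emeasure \<mu> ?Z"
    using conc KL t unfolding lp_F_concave_over_def v_def by auto
  \<comment> \<open>The image of the interval is again an interval, so it contains the convex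
    combination \<open>v\<close>, and \<open>inv_into\<close> is a genuine inverse at
    \<open>v\<close>.\<close>
  have "convex (F ` I)"
    using connected_continuous_image[OF I(2)] I(1) by (simp add: is_interval_connected_1 is_interval_convex_1[symmetric])
  then have "v \<in> F ` I"
    unfolding v_def using mem KL t by (intro convexD_alt[of "F ` I", simplified]) auto
  then have z: "inv_into I F v \<in> I" "F (inv_into I F v) = v"
    by (auto intro: inv_into_into f_inv_into_f)
  have "emeasure \<mu> ?Z = ennreal (measure \<mu> ?Z)"
    using emeasure_eq_ennreal_measure[of \<mu> ?Z] mem[OF Z] by auto
  \<comment> \<open>\<open>ennreal\<close> truncates negative values, but then the bound holds
    because measures are nonnegative.\<close>
  then have le: "inv_into I F v \<le> measure \<mu> ?Z"
    using ineq by (cases "inv_into I F v \<ge> 0") (auto intro: order_trans[of _ 0])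
  show ?thesis
    using \<sigma>
  proof
    assume "strict_mono_on I F \<and> \<sigma> = 1"
    then show ?thesis
      using strict_mono_onD[of I F "inv_into I F v" "measure \<mu> ?Z"] le z mem[OF Z]
      by (cases "inv_into I F v = measure \<mu> ?Z") (auto simp: v_def)
  next
    assume "strict_antimono_on I F \<and> \<sigma> = - 1"
    then show ?thesis
      using monotone_onD[of I "(<)" "(>)" F "inv_into I F v" "measure \<mu> ?Z"] le z mem[OF Z]
      by (cases "inv_into I F v = measure \<mu> ?Z") (auto simp: v_def)
  qed
qed

text \<open>By contradiction from a gain \<open>\<gamma>\<close> of \<open>f = \<sigma> * F\<close>
  at \<open>t\<close>. Concavity between \<open>K\<close> and the sum at \<open>t\<close> gives a
  gain of at least \<open>r * \<gamma>\<close> at \<open>r * t\<close>. There the measure exceeds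
  \<open>m\<close> by at most \<open>\<eta> * (r * t)\<close>, and the derivative at
  \<open>m\<close> bounds the gain by \<open>D\<close> times this excess.\<close>

lemma measure_lp_sum_eq:
  fixes \<phi> :: "'a::euclidean_space \<Rightarrow> real"
  assumes p: "p \<ge> 1"
    and \<phi>: "continuous_on (- {0}) \<phi>" "\<And>x. \<phi> x \<ge> 0" "\<phi> 0 = 0" "\<phi> \<in> borel_measurable borel"
    and \<mu>: "\<mu> = density lborel (\<lambda>x. ennreal (\<phi> x))"
    and C: "C \<subseteq> convex_bodies_o" and conc: "lp_F_concave_over p I F \<mu> C" and diff: "F differentiable_on I"
    and KL: "K \<in> C" "L \<in> C" and sum: "\<And>t. t \<in> {0<..<1} \<Longrightarrow> lp_sum p (1 - t) K t L \<in> C"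
    and eq: "measure \<mu> K = measure \<mu> L"
    and le: "(\<integral>\<^sup>+u. ennreal (support_fun L u powr p) \<partial>lp_surface_measure p \<phi> K)
      \<le> (\<integral>\<^sup>+u. ennreal (support_fun K u powr p) \<partial>lp_surface_measure p \<phi> K)"
    and t: "0 < t" "t < 1"
  shows "measure \<mu> (lp_sum p (1 - t) K t L) = measure \<mu> K"
proof -
  interpret K: origin_body K using KL C by unfold_locales auto
  interpret L: origin_body L using KL C by unfold_locales auto
  have [measurable]: "\<phi> \<in> borel_measurable borel"
    "support_fun K \<in> borel_measurable borel" "support_fun L \<in> borel_measurable borel"
    using \<phi>(4) by (auto intro!: borel_measurable_continuous_onI continuous_on_support_fun K.compact_K K.K_nonempty
        L.compact_K L.K_nonempty)
  obtain \<kappa> where \<kappa>: "cone_constant TYPE('a) \<kappa>" by (rule cone_constant_exists)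
  \<comment> \<open>The factor \<open>\<kappa>\<close> is the same on both sides, so the comparison
    passes to the integrals over \<open>K\<close>.\<close>
  have le': "(\<integral>\<^sup>+x. indicator K x * ennreal ((support_fun L (normal_field K (radial_proj K x)) / support_fun K (normal_field K (radial_proj K x))) powr p * \<phi> (radial_proj K x)) \<partial>lborel)
      \<le> (\<integral>\<^sup>+x. indicator K x * ennreal ((support_fun K (normal_field K (radial_proj K x)) / support_fun K (normal_field K (radial_proj K x))) powr p * \<phi> (radial_proj K x)) \<partial>lborel)"
    unfolding K.nn_integral_lp_surface_measure[OF \<kappa> \<phi>(4) \<open>support_fun L \<in> _\<close> \<phi>(2) L.support_fun_nonneg, symmetric]
      K.nn_integral_lp_surface_measure[OF \<kappa> \<phi>(4) \<open>support_fun K \<in> _\<close> \<phi>(2) K.support_fun_nonneg, symmetric]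
    by (rule mult_left_mono[OF le]) simp
  define m where "m = measure \<mu> K"
  define M where "M t = measure \<mu> (lp_sum p (1 - t) K t L)" for t
  have mem: "\<And>X. X \<in> C \<Longrightarrow> emeasure \<mu> X < top \<and> measure \<mu> X \<in> I"
    and mono: "strict_mono_on I F \<or> strict_antimono_on I F"
    using conc unfolding lp_F_concave_over_def by auto
  have mI: "m \<in> I" using mem KL by (simp add: m_def)
  have MI: "M s \<in> I" if "0 < s" "s < 1" for s using mem sum that by (simp add: M_def)
  obtain \<sigma> :: real where \<sigma>: "strict_mono_on I F \<and> \<sigma> = 1 \<or> strict_antimono_on I F \<and> \<sigma> = - 1"
    using mono by blast
  define f where "f x = \<sigma> * F x" for x
  have f_mono: "f x < f y" if "x \<in> I" "y \<in> I" "x < y" for x y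
    using \<sigma>
  proof
    assume "strict_mono_on I F \<and> \<sigma> = 1"
    then show ?thesis using strict_mono_onD[of I F x y] that by (simp add: f_def)
  next
    assume "strict_antimono_on I F \<and> \<sigma> = - 1"
    then show ?thesis using monotone_onD[of I "(<)" "(>)" F x y] that by (simp add: f_def)
  qed
  have f_le: "x \<le> y" if "x \<in> I" "y \<in> I" "f x \<le> f y" for x y
    using f_mono[of y x] that by force
  have M_ge: "f m \<le> f (M s)" if "0 < s" "s < 1" for s
  proof -
    have "f m = \<sigma> * ((1 - s) * F (measure \<mu> K) + s * F (measure \<mu> L))"
      by (simp add: f_def m_def eq[symmetric] algebra_simps)
    also have "\<dots> \<le> \<sigma> * F (measure \<mu> (lp_sum p (1 - s) K s L))"
      using that by (intro lp_F_concave_overD[OF conc KL that sum \<sigma>]) simp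
    also have "\<dots> = f (M s)" by (simp add: f_def M_def)
    finally show ?thesis .
  qed
  have M_scale: "r * (f (M t) - f m) \<le> f (M (r * t)) - f m" if r: "0 < r" "r < 1" for r
  proof -
    have rt: "0 < r * t" "r * t < 1" using r t mult_strict_mono[of r 1 t 1] by auto
    have lp: "lp_sum p (1 - r) K r (lp_sum p (1 - t) K t L) = lp_sum p (1 - r * t) K (r * t) L"
      using KL C by (intro lp_sum_lp_sum p t r) auto
    have "\<sigma> * ((1 - r) * F (measure \<mu> K) + r * F (measure \<mu> (lp_sum p (1 - t) K t L)))
        \<le> \<sigma> * F (measure \<mu> (lp_sum p (1 - r) K r (lp_sum p (1 - t) K t L)))"
      using sum[of t] sum[of "r * t"] t rt
      by (intro lp_F_concave_overD[OF conc KL(1) _ r _ \<sigma>]) (auto simp: lp)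
    then show ?thesis by (simp add: lp f_def m_def M_def algebra_simps)
  qed
  have "f (M t) \<le> f m"
  proof (rule ccontr)
    assume "\<not> f (M t) \<le> f m"
    define \<gamma> where "\<gamma> = f (M t) - f m"
    have \<gamma>: "\<gamma> > 0" using \<open>\<not> f (M t) \<le> f m\<close> by (simp add: \<gamma>_def)
    have "f differentiable_on I"
      unfolding f_def by (intro differentiable_on_mult differentiable_on_const diff)
    then have "f differentiable (at m within I)"
      using mI by (simp add: differentiable_on_def)
    then obtain d where d: "(f has_derivative (\<lambda>h. d * h)) (at m within I)"
      by (auto simp: real_differentiable_def has_field_derivative_def)
    obtain \<delta> where \<delta>: "\<delta> > 0"
      "\<And>y. y \<in> I \<Longrightarrow> norm (y - m) < \<delta> \<Longrightarrow> norm (f y - f m - d * (y - m)) \<le> 1 * norm (y - m)"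
      using d unfolding has_derivative_within_alt by (meson zero_less_one)
    \<comment> \<open>The modulus of the derivative, plus 1 for the error in the difference
      quotient.\<close>
    define D where "D = \<bar>d\<bar> + 1"
    have D: "D > 0" by (simp add: D_def)
    \<comment> \<open>Chosen so that \<open>D * (\<eta> * (r * t))\<close> is half of
      \<open>r * \<gamma>\<close>.\<close>
    define \<eta> where "\<eta> = \<gamma> / (2 * t * D)"
    have \<eta>: "\<eta> > 0" using \<gamma> t D by (simp add: \<eta>_def)
    have "emeasure (density lborel (\<lambda>x. ennreal (\<phi> x))) K < top"
      using mem KL \<mu> by simp
    then obtain s0 where s0: "s0 > 0"
      "\<And>s. 0 < s \<Longrightarrow> s < s0 \<Longrightarrow> s < 1 \<Longrightarrow> lp_sum p (1 - s) K s L \<in> convex_bodies_o \<Longrightarrow>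
         measure \<mu> (lp_sum p (1 - s) K s L) \<le> measure \<mu> K + \<eta> * s"
      unfolding \<mu> using K.measure_lp_sum_upper[OF p _ \<phi> _ le' \<eta>] L.K by metis
    \<comment> \<open>Small enough for the upper bound to hold at \<open>r * t\<close> and for the
      measure there to be within \<open>\<delta>\<close> of \<open>m\<close>.\<close>
    define r where "r = Min {1 / 2, s0 / (2 * t), \<delta> / (2 * \<eta> * t)}"
    have r: "0 < r" "r < 1" "r * t < s0" "\<eta> * (r * t) < \<delta>"
    proof -
      show "0 < r" using s0 t \<delta> \<eta> by (simp add: r_def)
      have "r \<le> 1 / 2" "r \<le> s0 / (2 * t)" "r \<le> \<delta> / (2 * \<eta> * t)" by (auto simp: r_def)
      then show "r < 1" "r * t < s0" "\<eta> * (r * t) < \<delta>"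
        using t \<eta> s0(1) \<delta>(1) by (auto simp: field_simps)
    qed
    have rt: "0 < r * t" "r * t < 1" using r t mult_strict_mono[of r 1 t 1] by auto
    have up: "M (r * t) \<le> m + \<eta> * (r * t)"
      using s0(2)[OF rt(1) r(3) rt(2)] sum[of "r * t"] rt C by (auto simp: M_def m_def)
    have lo: "m \<le> M (r * t)" using f_le[OF mI MI[OF rt] M_ge[OF rt]] .
    have "r * \<gamma> \<le> f (M (r * t)) - f m" unfolding \<gamma>_def by (rule M_scale[OF r(1,2)])
    also have "\<dots> \<le> D * (M (r * t) - m)"
    proof -
      have "norm (M (r * t) - m) < \<delta>" using up lo r(4) by simp
      from \<delta>(2)[OF MI[OF rt] this] have "f (M (r * t)) - f m \<le> d * (M (r * t) - m) + (M (r * t) - m)"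
        using lo by (simp add: abs_le_iff)
      also have "d * (M (r * t) - m) \<le> \<bar>d\<bar> * (M (r * t) - m)" using lo by (intro mult_right_mono) auto
      finally show ?thesis by (simp add: D_def algebra_simps)
    qed
    also have "\<dots> \<le> D * (\<eta> * (r * t))" using up D by (intro mult_left_mono) auto
    also have "\<dots> = r * \<gamma> / 2" using D t by (simp add: \<eta>_def field_simps)
    finally show False using r(1) \<gamma> by simp
  qed
  then have "M t \<le> m" using f_le MI[OF t] mI by blast
  moreover have "m \<le> M t" using f_le[OF mI MI[OF t] M_ge[OF t]] .
  ultimately show ?thesis by (simp add: M_def m_def)
qed

theorem theorem1p9:
  fixes p :: real
    and \<mu> :: "'a::euclidean_space measure"
    and \<phi> :: "'a \<Rightarrow> real"
    and I :: "real set"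
    and F :: "real \<Rightarrow> real"
    and C :: "'a set set"
    and K L :: "'a set"
  assumes "p \<ge> 1"
    and "continuous_on (- {0}) \<phi>"
    and "\<And>x. x \<noteq> 0 \<Longrightarrow> \<phi> x \<ge> 0"
    and "\<mu> = density lborel (\<lambda>x. ennreal (\<phi> x))"
    and "C \<subseteq> convex_bodies_o"
    and "lp_F_concave_over p I F \<mu> C"
    and "F differentiable_on I"
    and "K \<in> C"
    and "L \<in> C"
    and "\<And>t. t \<in> {0<..<1} \<Longrightarrow> lp_sum p (1 - t) K t L \<in> C"
    and "emeasure \<mu> K = emeasure \<mu> L"
    and "finite_measure (lp_surface_measure p \<phi> K)"
    and "finite_measure (lp_surface_measure p \<phi> L)"
    and "lp_surface_measure p \<phi> K = lp_surface_measure p \<phi> L"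
  shows "\<forall>t\<in>{0<..<1}. emeasure \<mu> (lp_sum p (1 - t) K t L) =
           ennreal (inv_into I F ((1 - t) * F (measure \<mu> K) + t * F (measure \<mu> L)))"
proof
  fix t :: real assume "t \<in> {0<..<1}"
  then have t: "0 < t" "t < 1" by auto
  \<comment> \<open>The value of the density at the origin is arbitrary, possibly negative, and is
    set to 0. A point has Lebesgue measure 0 and the boundaries avoid the origin, so neither
    \<open>\<mu>\<close> nor the surface measures change.\<close>
  define \<psi> where "\<psi> x = (if x = 0 then 0 else \<phi> x)" for x
  have \<psi>_nonneg: "\<psi> x \<ge> 0" and \<psi>0: "\<psi> 0 = 0" for x using assms(3) by (auto simp: \<psi>_def)
  have \<psi>_cont: "continuous_on (- {0}) \<psi>"
    using assms(2) by (rule continuous_on_eq) (simp add: \<psi>_def)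
  have "\<psi> = (\<lambda>x. indicator (- {0}) x *\<^sub>R \<phi> x)" by (auto simp: \<psi>_def indicator_def)
  moreover have "(\<lambda>x. indicator (- {0}) x *\<^sub>R \<phi> x) \<in> borel_measurable borel"
    using assms(2) by (intro borel_measurable_continuous_on_indicator) auto
  ultimately have \<psi>_meas: "\<psi> \<in> borel_measurable borel" by simp
  have "\<phi> x = indicator (- {0}) x *\<^sub>R \<phi> x + indicator {0} x *\<^sub>R \<phi> 0" for x
    by (simp add: indicator_def)
  then have "\<phi> = (\<lambda>x. indicator (- {0}) x *\<^sub>R \<phi> x + indicator {0} x *\<^sub>R \<phi> 0)" by blast
  moreover have "(\<lambda>x. indicator (- {0}) x *\<^sub>R \<phi> x + indicator {0} x *\<^sub>R \<phi> 0) \<in> borel_measurable borel"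
    using \<open>(\<lambda>x. indicator (- {0}) x *\<^sub>R \<phi> x) \<in> _\<close> by measurable
  ultimately have \<phi>_meas: "\<phi> \<in> borel_measurable borel" by simp
  have \<mu>: "\<mu> = density lborel (\<lambda>x. ennreal (\<psi> x))"
    unfolding assms(4)
  proof (rule density_cong)
    have "AE x in lborel. x \<noteq> (0::'a)" by (rule AE_lborel_singleton)
    then show "AE x in lborel. ennreal (\<phi> x) = ennreal (\<psi> x)"
      by (rule AE_mp) (simp add: \<psi>_def)
  qed (use \<phi>_meas \<psi>_meas in auto)
  have surf: "lp_surface_measure p \<phi> X = lp_surface_measure p \<psi> X" if "X \<in> C" for X
  proof -
    interpret X: origin_body X using that assms(5) by unfold_locales auto
    have "(\<integral>\<^sup>+ y \<in> {y \<in> gauss_domain X. gauss_map X y \<in> E}.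
          ennreal ((y \<bullet> gauss_map X y) powr (1 - p) * \<phi> y) \<partial>hausdorff_measure (DIM('a) - 1))
        = (\<integral>\<^sup>+ y \<in> {y \<in> gauss_domain X. gauss_map X y \<in> E}.
          ennreal ((y \<bullet> gauss_map X y) powr (1 - p) * \<psi> y) \<partial>hausdorff_measure (DIM('a) - 1))" for E
      using X.gauss_domain_frontier X.frontier_nonzero
      by (intro nn_integral_cong) (auto simp: \<psi>_def indicator_def)
    then show ?thesis by (simp add: lp_surface_measure_def)
  qed
  have eq: "measure \<mu> K = measure \<mu> L" using assms(11) by (simp add: measure_def)
  have fin: "emeasure \<mu> X < top" "measure \<mu> X \<in> I" if "X \<in> C" for X
    using assms(6) that unfolding lp_F_concave_over_def by auto
  have S: "lp_surface_measure p \<psi> K = lp_surface_measure p \<psi> L"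
    using assms(14) surf assms(8,9) by simp
  \<comment> \<open>If the integrals are ordered the other way, equality of the surface measures
    permits exchanging \<open>K\<close> and \<open>L\<close>, with \<open>t\<close> replaced by
    \<open>1 - t\<close>.\<close>
  have "measure \<mu> (lp_sum p (1 - t) K t L) = measure \<mu> K"
  proof (cases "(\<integral>\<^sup>+u. ennreal (support_fun L u powr p) \<partial>lp_surface_measure p \<psi> K)
      \<le> (\<integral>\<^sup>+u. ennreal (support_fun K u powr p) \<partial>lp_surface_measure p \<psi> K)")
    case True
    then show ?thesis
      by (intro measure_lp_sum_eq[OF assms(1) \<psi>_cont \<psi>_nonneg \<psi>0 \<psi>_meas \<mu> assms(5-10) eq _ t])
  next
    case False
    then have le: "(\<integral>\<^sup>+u. ennreal (support_fun K u powr p) \<partial>lp_surface_measure p \<psi> L)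
      \<le> (\<integral>\<^sup>+u. ennreal (support_fun L u powr p) \<partial>lp_surface_measure p \<psi> L)"
      by (simp add: S)
    have sum: "lp_sum p (1 - s) L s K \<in> C" if "s \<in> {0<..<1}" for s
      using assms(10)[of "1 - s"] that by (simp add: lp_sum_commute[of p "1 - s" L])
    have "measure \<mu> (lp_sum p (1 - (1 - t)) L (1 - t) K) = measure \<mu> L"
      using t by (intro measure_lp_sum_eq[OF assms(1) \<psi>_cont \<psi>_nonneg \<psi>0 \<psi>_meas \<mu> assms(5-7) assms(9,8) sum eq[symmetric] le]) auto
    then show ?thesis using eq by (simp add: lp_sum_commute[of p t L])
  qed
  moreover have "lp_sum p (1 - t) K t L \<in> C" using assms(10) t by simp
  ultimately have "emeasure \<mu> (lp_sum p (1 - t) K t L) = ennreal (measure \<mu> K)"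
    using fin(1)[of "lp_sum p (1 - t) K t L"] by (simp add: emeasure_eq_ennreal_measure)
  \<comment> \<open>As \<open>K\<close> and \<open>L\<close> have the same measure, the convex
    combination is the value of \<open>F\<close> at it, and strict monotonicity makes
    \<open>F\<close> injective.\<close>
  moreover have "inv_into I F ((1 - t) * F (measure \<mu> K) + t * F (measure \<mu> L)) = measure \<mu> K"
  proof -
    have "inj_on F I"
    proof (rule inj_onI, rule ccontr)
      fix x y assume xy: "x \<in> I" "y \<in> I" "F x = F y" "x \<noteq> y"
      then consider "x < y" | "y < x" by linarith
      then show False
        using assms(6) xy monotone_onD[of I "(<)" "(<)" F x y] monotone_onD[of I "(<)" "(<)" F y x]
          monotone_onD[of I "(<)" "(>)" F x y] monotone_onD[of I "(<)" "(>)" F y x]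
        unfolding lp_F_concave_over_def by cases auto
    qed
    moreover have "(1 - t) * F (measure \<mu> K) + t * F (measure \<mu> L) = F (measure \<mu> K)"
      by (simp add: eq[symmetric] algebra_simps)
    ultimately show ?thesis using fin(2)[OF assms(8)] by simp
  qed
  ultimately show "emeasure \<mu> (lp_sum p (1 - t) K t L) =
           ennreal (inv_into I F ((1 - t) * F (measure \<mu> K) + t * F (measure \<mu> L)))" by simp
qed

end
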